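(* Let $n$ be a positive integer. There exists a cubic (3-regular) nut graph on $n$ vertices if and only if $n$ is even, $n \geq 12$ and $n \notin \{14,16\}$.
   Context: All graphs are finite and simple. For a graph $G$ with 0--1 adjacency matrix $\mathbf{A}(G)$, the nullity $\eta(G)$ is the multiplicity of $0$ as an eigenvalue of $\mathbf{A}(G)$. A vertex is a core vertex if it corresponds to a nonzero entry of some vector in $\ker \mathbf{A}(G)$. A core graph is a singular graph ($\eta(G)>0$) in which every vertex is a core vertex. A nut graph is a core graph of nullity one, i.e. $\eta(G)=1$ and the kernel of $\mathbf{A}(G)$ is spanned by a vector with all entries nonzero. *)

theory Defs
  imports
    "Graph_Theory.Pair_Digraph"
    "Jordan_Normal_Form.Char_Poly"
    "Jordan_Normal_Form.Matrix_Kernel"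
begin

text \<open>
  A finite simple graph is a \<open>pair_graph\<close>: a finite, symmetric, loop-free set of arcs, the edge
  \<open>uv\<close> being represented by the two arcs \<open>(u, v)\<close> and \<open>(v, u)\<close>. Adjacency matrices are indexed by
  the vertices themselves, so the vertices of a graph of order \<open>n\<close> are taken to be \<open>0, ..., n - 1\<close>.
\<close>

definition simple_graph_on :: "nat \<Rightarrow> nat pair_pre_digraph \<Rightarrow> bool" where
  "simple_graph_on n G \<longleftrightarrow> pair_graph G \<and> pverts G = {0..<n}"

definition adjacency_matrix :: "nat pair_pre_digraph \<Rightarrow> real mat" where
  "adjacency_matrix G = mat (card (pverts G)) (card (pverts G))
     (\<lambda>(u, v). if (u, v) \<in> parcs G then 1 else 0)"

text \<open>
  The multiplicity of an eigenvalue is its multiplicity as a root of the characteristic polynomial;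
  the matrix being real and symmetric, this is also the dimension of the eigenspace.
\<close>

definition nullity :: "nat pair_pre_digraph \<Rightarrow> nat" where
  "nullity G = Polynomial.order 0 (char_poly (adjacency_matrix G))"

definition core_vertex :: "nat pair_pre_digraph \<Rightarrow> nat \<Rightarrow> bool" where
  "core_vertex G v \<longleftrightarrow> v \<in> pverts G \<and> (\<exists>x \<in> mat_kernel (adjacency_matrix G). x $ v \<noteq> 0)"

definition core_graph :: "nat pair_pre_digraph \<Rightarrow> bool" where
  "core_graph G \<longleftrightarrow> nullity G > 0 \<and> (\<forall>v \<in> pverts G. core_vertex G v)"

definition nut_graph :: "nat pair_pre_digraph \<Rightarrow> bool" where
  "nut_graph G \<longleftrightarrow> core_graph G \<and> nullity G = 1"

text \<open>Every edge at \<open>v\<close> contributes exactly one arc with tail \<open>v\<close>.\<close>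

definition cubic_graph :: "nat pair_pre_digraph \<Rightarrow> bool" where
  "cubic_graph G \<longleftrightarrow> (\<forall>v \<in> pverts G. out_degree (with_proj G) v = 3)"

end

theory Submission
  imports Defs
begin

text \<open>
  Existence: three cubic nut graphs of orders 12, 20 and 22 are given explicitly, and replacing the
  star of a vertex by a larger gadget (Fowler's construction) adds 6 vertices.

  Non-existence: the kernel is spanned by a primitive integer vector. Let \<open>O\<close> be its odd support.
  Each vertex has 0 or 2 neighbours in \<open>O\<close>; let \<open>A\<close> be the set of vertices that have 2. Double counting
  gives \<open>|O| = 2k\<close>, \<open>|A| = 3k\<close>, and evaluating the quadratic form of the adjacency matrix at the
  indicator of \<open>O\<close> modulo 8 gives \<open>4 dvd |O \<inter> A|\<close>. For each small order only a few cardinalities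
  remain. Each is excluded by a search that adds edges one at a time and maintains, as integer linear
  forms, the coordinate functionals modulo the rows of the completed vertices: in a nut graph no
  coordinate functional lies in the row space, and fewer than all of the rows are independent.
\<close>

subsection \<open>A search procedure\<close>

text \<open>Nullity one plus core is used in the form \<open>nut_on\<close>: the kernel is nonzero
  and each nonzero kernel vector is nowhere zero. This needs no dimension and transports along
  relabellings. Both pruning rules follow from it. A kernel vector is orthogonal to all rows, so a
  coordinate functional in the row space would vanish on it. A dependence among rows is, by symmetry
  of the matrix, itself a kernel vector, so it involves every row. The 8 arises as follows: write
  the odd indicator as z = x - 2w with Ax = 0. All terms containing Ax drop out, so the form at z is
  4 times the form at w, and the form at w is even because A is symmetric with zero diagonal. The
  searches run inside the logic by \<open>simp only\<close>, and the cost of rewriting shapes their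
  definitions: constructor patterns, unary counters and indices, integer forms in which fractions
  are avoided by rescaling the unknown functionals. The larger cases would repeat isomorphic
  branches; there a certificate prescribes the branching, and a partial graph refuted once is reused
  under every relabelling that preserves the kinds of the vertices.\<close>

type_synonym form = "int list"

fun vadd :: "form \<Rightarrow> form \<Rightarrow> form" where
  "vadd [] g = g" | "vadd (x # f) [] = x # f" | "vadd (x # f) (y # g) = (x + y) # vadd f g"

text \<open>Missing factors count as 1, so \<open>[]\<close> is the trivial scaling.\<close>

fun vmul :: "form \<Rightarrow> form \<Rightarrow> form" where
  "vmul [] f = f" | "vmul (s # ss) [] = []" | "vmul (s # ss) (x # f) = s * x # vmul ss f"

fun vcomb :: "form \<Rightarrow> int \<Rightarrow> form \<Rightarrow> form" where
  "vcomb f c [] = f"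
| "vcomb [] c (y # g) = c * y # vcomb [] c g"
| "vcomb (x # f) c (y # g) = (x + c * y) # vcomb f c g"

text \<open>Only the length of \<open>a\<close> matters: it is a unary index. The pivot functions
  return the entries before the pivot, which serve as this index without any arithmetic on
  positions.\<close>

fun coef :: "form \<Rightarrow> form \<Rightarrow> int" where
  "coef a [] = 0" | "coef [] (c # f) = c" | "coef (y # a) (x # f) = coef a f"

fun del :: "form \<Rightarrow> form \<Rightarrow> form" where
  "del a [] = []" | "del [] (c # f) = f" | "del (y # a) (x # f) = x # del a f"

primrec nonzero :: "form \<Rightarrow> bool" where
  "nonzero [] = False" | "nonzero (x # f) = (x \<noteq> 0 \<or> nonzero f)"

fun push :: "int \<Rightarrow> (form \<times> int \<times> form) option \<Rightarrow> (form \<times> int \<times> form) option" where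
  "push x None = None" | "push x (Some (a, p, b)) = Some (x # a, p, b)"

primrec unit_pivot :: "form \<Rightarrow> (form \<times> int \<times> form) option" where
  "unit_pivot [] = None"
| "unit_pivot (x # f) = (if x = 1 \<or> x = - 1 then Some ([], x, f) else push x (unit_pivot f))"

primrec any_pivot :: "form \<Rightarrow> (form \<times> int \<times> form) option" where
  "any_pivot [] = None"
| "any_pivot (x # f) = (if x \<noteq> 0 then Some ([], x, f) else push x (any_pivot f))"

text \<open>The result (s, h) satisfies p * h = - s * y. If an unknown with coefficient y is
  replaced by s times a new unknown, then the pivot unknown has the integer coefficient h at the new
  one. The first three cases keep s = 1, so that coefficients do not grow.\<close>

definition ratio :: "int \<Rightarrow> int \<Rightarrow> int \<times> int" where
  "ratio p y = (if y = 0 then (1, 0) else if y = p then (1, - 1) else if y = - p then (1, 1) else (p, - y))"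

fun rcons :: "int \<times> int \<Rightarrow> form \<times> form \<Rightarrow> form \<times> form" where
  "rcons (s, h) (ss, hs) = (s # ss, h # hs)"

primrec ratios :: "int \<Rightarrow> form \<Rightarrow> form \<times> form" where
  "ratios p [] = ([], [])" | "ratios p (y # g) = rcons (ratio p y) (ratios p g)"

fun solve_any :: "(form \<times> int \<times> form) option \<Rightarrow> (form \<times> form \<times> form) option" where
  "solve_any None = None" | "solve_any (Some (a, p, b)) = Some (a, ratios p (a @ b))"

fun solve_unit :: "form \<Rightarrow> (form \<times> int \<times> form) option \<Rightarrow> (form \<times> form \<times> form) option" where
  "solve_unit g None = solve_any (any_pivot g)"
| "solve_unit g (Some (a, p, b)) = Some (a, [], map ((*) (- p)) (a @ b))"

text \<open>Reads g = 0 as an equation for one unknown. The result consists of the position of that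
  unknown, the factors by which the others are rescaled, and its expression in the rescaled
  unknowns. A pivot 1 or -1 is its own inverse and needs no rescaling. \<open>None\<close> means
  that g vanishes.\<close>

definition solve :: "form \<Rightarrow> (form \<times> form \<times> form) option" where
  "solve g = solve_unit g (unit_pivot g)"

datatype cap = C0 | C1 | C2 | C3

text \<open>\<open>vcls\<close> is membership in the odd support; \<open>cap1\<close> and
  \<open>cap0\<close> count the neighbours that are still missing inside and outside of it. The form
  has a meaning only once \<open>nbs\<close> is nonempty.\<close>

datatype 'v node = Node (vid: 'v) (vcls: bool) (cap1: cap) (cap0: cap) (nbs: "'v list") (fm: form)

text \<open>\<open>Contra\<close> means that no nut graph extends the state, \<open>Stuck\<close>
  that nothing has been shown. The second component of \<open>State\<close> is a list of zeros, one
  for each unknown functional in use, kept as a prefix for the next unit vector.\<close>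

datatype 'v result = Contra | Stuck | State "'v node list" form

primrec mem :: "'a \<Rightarrow> 'a list \<Rightarrow> bool" where
  "mem v [] = False" | "mem v (x # xs) = (if v = x then True else mem v xs)"

fun get :: "'v \<Rightarrow> 'v node list \<Rightarrow> 'v node option" where
  "get v [] = None" | "get v (Node u c i j nb f # ns) = (if u = v then Some (Node u c i j nb f) else get v ns)"

fun form_of :: "'v node option \<Rightarrow> form" where
  "form_of None = []" | "form_of (Some (Node u c i j nb f)) = f"

fun form_sum :: "'v list \<Rightarrow> 'v node list \<Rightarrow> form" where
  "form_sum [] ns = []" | "form_sum (u # us) ns = vadd (form_of (get u ns)) (form_sum us ns)"

fun ncons :: "'a \<Rightarrow> 'a list option \<Rightarrow> 'a list option" where
  "ncons x None = None" | "ncons x (Some ns) = Some (x # ns)"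

fun ncons_if :: "bool \<Rightarrow> 'a \<Rightarrow> 'a list option \<Rightarrow> 'a list option" where
  "ncons_if False x r = None" | "ncons_if True x r = ncons x r"

text \<open>A form without the pivot unknown is merely rescaled and cannot become zero, so the test
  is made only when something is substituted. A form that becomes zero puts a coordinate functional
  into the row space.\<close>

definition elim_node :: "int \<Rightarrow> form \<Rightarrow> form \<Rightarrow> 'v \<Rightarrow> bool \<Rightarrow> cap \<Rightarrow> cap \<Rightarrow> 'v list \<Rightarrow> form \<Rightarrow>
    'v node list option \<Rightarrow> 'v node list option" where
  "elim_node x ss hs v c i j nb f r = (if x = 0 then ncons (Node v c i j nb (vmul ss f)) r
     else ncons_if (nonzero (vcomb (vmul ss f) x hs)) (Node v c i j nb (vcomb (vmul ss f) x hs)) r)"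

fun elim_nodes :: "form \<Rightarrow> form \<Rightarrow> form \<Rightarrow> 'v node list \<Rightarrow> 'v node list option" where
  "elim_nodes a ss hs [] = Some []"
| "elim_nodes a ss hs (Node v c i j [] f # ns) = ncons (Node v c i j [] f) (elim_nodes a ss hs ns)"
| "elim_nodes a ss hs (Node v c i j (u # nb) f # ns) =
     elim_node (coef a f) ss hs v c i j (u # nb) (del a f) (elim_nodes a ss hs ns)"

fun incomplete :: "'v node list \<Rightarrow> bool" where
  "incomplete [] = False"
| "incomplete (Node v c C0 C0 nb f # ns) = incomplete ns"
| "incomplete (Node v c i j nb f # ns) = True"

fun to_result :: "form \<Rightarrow> 'v node list option \<Rightarrow> 'v result" where
  "to_result zs None = Contra" | "to_result zs (Some ns) = State ns (tl zs)"

fun dependent :: "bool \<Rightarrow> 'v result" where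
  "dependent True = Contra" | "dependent False = Stuck"

text \<open>\<open>None\<close> says that the new row depends on the rows treated before, which is
  legitimate only for the very last row. \<open>strict\<close> asserts that another row is still
  untreated; otherwise the nodes are inspected for an incomplete vertex.\<close>

fun complete :: "bool \<Rightarrow> 'v node list \<Rightarrow> form \<Rightarrow> (form \<times> form \<times> form) option \<Rightarrow> 'v result" where
  "complete True ns zs None = Contra"
| "complete False ns zs None = dependent (incomplete ns)"
| "complete strict ns zs (Some (a, ss, hs)) = to_result zs (elim_nodes a ss hs ns)"

fun dec :: "cap \<Rightarrow> cap" where "dec C0 = C0" | "dec C1 = C0" | "dec C2 = C1" | "dec C3 = C2"

text \<open>The coordinate functional of a vertex becomes an unknown only at its first edge, which
  keeps the forms short.\<close>

fun new_form :: "'v list \<Rightarrow> form \<Rightarrow> form \<Rightarrow> form" where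
  "new_form [] f zs = zs @ [1]" | "new_form (x # nb) f zs = f"

fun new_zs :: "'v list \<Rightarrow> form \<Rightarrow> form" where
  "new_zs [] zs = 0 # zs" | "new_zs (x # nb) zs = zs"

fun link :: "'v \<Rightarrow> bool \<Rightarrow> cap \<Rightarrow> cap \<Rightarrow> 'v list \<Rightarrow> form \<Rightarrow> 'v \<Rightarrow> bool \<Rightarrow> 'v node" where
  "link v c i j nb f u True = Node v c (dec i) j (u # nb) f"
| "link v c i j nb f u False = Node v c i (dec j) (u # nb) f"

fun repl :: "'v node \<Rightarrow> 'v node list \<Rightarrow> 'v node list" where
  "repl x [] = []"
| "repl (Node v c i j nb f) (Node w d k l mb g # ns) =
     (if w = v then Node v c i j nb f # ns else Node w d k l mb g # repl (Node v c i j nb f) ns)"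

fun finish :: "bool \<Rightarrow> 'v node \<Rightarrow> 'v result \<Rightarrow> 'v result" where
  "finish strict x Contra = Contra"
| "finish strict x Stuck = Stuck"
| "finish strict (Node v c C0 C0 nb f) (State ns zs) = complete strict ns zs (solve (form_sum nb ns))"
| "finish strict (Node v c i j nb f) (State ns zs) = State ns zs"

text \<open>The edge may complete both ends at once. While the row of \<open>x\<close> is treated,
  that of \<open>y\<close> is still pending, even if \<open>y\<close> is complete; hence the first
  call is strict.\<close>

fun finish_both :: "'v node \<Rightarrow> 'v node \<Rightarrow> 'v node list \<Rightarrow> form \<Rightarrow> 'v result" where
  "finish_both x y ns zs = finish False y (finish True x (State (repl x (repl y ns)) zs))"

fun add_edge :: "'v node \<Rightarrow> 'v node \<Rightarrow> 'v node list \<Rightarrow> form \<Rightarrow> 'v result" where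
  "add_edge (Node v c i j nb f) (Node u d k l mb g) ns zs =
     finish_both (link v c i j nb (new_form nb f zs) u d)
       (link u d k l mb (new_form mb g (new_zs nb zs)) v c) ns (new_zs mb (new_zs nb zs))"

fun room :: "bool \<Rightarrow> cap \<Rightarrow> cap \<Rightarrow> bool" where
  "room True C0 j = False" | "room True C1 j = True" | "room True C2 j = True" | "room True C3 j = True"
| "room False i C0 = False" | "room False i C1 = True" | "room False i C2 = True" | "room False i C3 = True"

section \<open>Choice of the next edge\<close>

fun pick1 :: "'v node list \<Rightarrow> ('v node \<times> bool) option" where
  "pick1 [] = None"
| "pick1 (Node v c C0 j nb f # ns) = pick1 ns"
| "pick1 (Node v c i j [] f # ns) = pick1 ns"
| "pick1 (x # ns) = Some (x, True)"

fun pick2 :: "'v node list \<Rightarrow> ('v node \<times> bool) option" where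
  "pick2 [] = None"
| "pick2 (Node v False i j nb f # ns) = pick2 ns"
| "pick2 (Node v c i C0 nb f # ns) = pick2 ns"
| "pick2 (Node v c i j [] f # ns) = pick2 ns"
| "pick2 (x # ns) = Some (x, False)"

fun pick3 :: "'v node list \<Rightarrow> ('v node \<times> bool) option" where
  "pick3 [] = None"
| "pick3 (Node v False i j nb f # ns) = pick3 ns"
| "pick3 (Node v c C0 C0 nb f # ns) = pick3 ns"
| "pick3 (Node v c i j nb f # ns) = Some (Node v c i j nb f, room True i j)"

fun pick4 :: "'v node list \<Rightarrow> ('v node \<times> bool) option" where
  "pick4 [] = None"
| "pick4 (Node v c i C1 (u # nb) f # ns) = Some (Node v c i C1 (u # nb) f, False)"
| "pick4 (x # ns) = pick4 ns"

fun pick5 :: "'v node list \<Rightarrow> ('v node \<times> bool) option" where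
  "pick5 [] = None"
| "pick5 (Node v c i C0 nb f # ns) = pick5 ns"
| "pick5 (Node v c i j [] f # ns) = pick5 ns"
| "pick5 (x # ns) = Some (x, False)"

fun pick6 :: "'v node list \<Rightarrow> ('v node \<times> bool) option" where
  "pick6 [] = None"
| "pick6 (Node v c C0 C0 nb f # ns) = pick6 ns"
| "pick6 (Node v c i j nb f # ns) = Some (Node v c i j nb f, room True i j)"

primrec orelse :: "'a option \<Rightarrow> 'a option \<Rightarrow> 'a option" where
  "orelse None r = r" | "orelse (Some x) r = Some x"

text \<open>The order of preference is a heuristic for small search trees. Soundness asks only that
  the chosen vertex still lacks a neighbour in the chosen class.\<close>

definition pick :: "'v node list \<Rightarrow> ('v node \<times> bool) option" where
  "pick ns = orelse (pick1 ns) (orelse (pick2 ns) (orelse (pick3 ns) (orelse (pick4 ns) (orelse (pick5 ns) (pick6 ns)))))"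

type_synonym kind = "bool \<times> cap \<times> cap"

fun both :: "bool \<Rightarrow> bool \<Rightarrow> bool" where "both True a = a" | "both False a = False"

fun eqb :: "bool \<Rightarrow> bool \<Rightarrow> bool" where
  "eqb True b = b" | "eqb False True = False" | "eqb False False = True"

fun fresh :: "bool \<Rightarrow> kind \<Rightarrow> kind list \<Rightarrow> kind list option" where
  "fresh True t seen = None" | "fresh False t seen = Some (t # seen)"

fun classify2 :: "bool \<Rightarrow> kind list \<Rightarrow> 'v node \<Rightarrow> kind list option" where
  "classify2 True seen x = None"
| "classify2 False seen (Node u d k l (w # mb) g) = Some seen"
| "classify2 False seen (Node u d k l [] g) = fresh (mem (d, k, l) seen) (d, k, l) seen"

fun classify1 :: "bool \<Rightarrow> 'v list \<Rightarrow> kind list \<Rightarrow> 'v node \<Rightarrow> kind list option" where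
  "classify1 False nb seen x = None"
| "classify1 True nb seen (Node u d k l mb g) = classify2 (mem u nb) seen (Node u d k l mb g)"

fun classify :: "'v list \<Rightarrow> bool \<Rightarrow> bool \<Rightarrow> kind list \<Rightarrow> 'v node \<Rightarrow> kind list option" where
  "classify nb c e seen (Node u d k l mb g) = classify1 (both (eqb d e) (room c k l)) nb seen (Node u d k l mb g)"

text \<open>Symmetry breaking: vertices without edges that agree in class and capacities are
  interchangeable, so only the first of each kind is tried; \<open>seen\<close> collects these
  kinds.\<close>

primrec cands :: "'v list \<Rightarrow> bool \<Rightarrow> bool \<Rightarrow> kind list \<Rightarrow> 'v node list \<Rightarrow> 'v node list" where
  "cands nb c e seen [] = []"
| "cands nb c e seen (x # ns) = (case classify nb c e seen x of
     None \<Rightarrow> cands nb c e seen ns | Some s \<Rightarrow> x # cands nb c e s ns)"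

fun children :: "'v node \<Rightarrow> bool \<Rightarrow> 'v node list \<Rightarrow> 'v node list" where
  "children (Node v c i j nb f) e ns = cands (v # nb) c e [] ns"

type_synonym 'v test = "'v node list \<Rightarrow> form \<Rightarrow> bool"

fun on_result :: "'v test \<Rightarrow> 'v result \<Rightarrow> bool" where
  "on_result Q Contra = True" | "on_result Q Stuck = False" | "on_result Q (State ns zs) = Q ns zs"

fun every :: "'v test \<Rightarrow> 'v node list \<Rightarrow> form \<Rightarrow> 'v node \<Rightarrow> 'v node list \<Rightarrow> bool" where
  "every Q ns zs x [] = True"
| "every Q ns zs x (y # ys) = both (on_result Q (add_edge x y ns zs)) (every Q ns zs x ys)"

fun branch :: "'v test \<Rightarrow> 'v node list \<Rightarrow> form \<Rightarrow> ('v node \<times> bool) option \<Rightarrow> bool" where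
  "branch Q ns zs None = False"
| "branch Q ns zs (Some (x, e)) = every Q ns zs x (children x e ns)"

text \<open>One unit pays for one added edge; a cubic graph on 16 vertices, the largest order
  treated, has 24. Running out of fuel makes the test fail and thus cannot harm soundness.\<close>

datatype fuel = Stop | Go fuel

fun search :: "fuel \<Rightarrow> 'v test" where
  "search Stop ns zs = False"
| "search (Go k) ns zs = branch (search k) ns zs (pick ns)"

text \<open>\<open>Split\<close> prescribes the vertex to be extended and the class of its new
  neighbour. \<open>Ref\<close> lists the images of the vertices under a relabelling that carries
  some refuted partial graph into the current one.\<close>

datatype 'v cert = Search | Ref "'v list" | Split 'v bool "'v cert list"

fun has_edge :: "'v \<Rightarrow> 'v node option \<Rightarrow> bool" where
  "has_edge u None = False" | "has_edge u (Some (Node v c i j nb f)) = mem u nb"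

fun image :: "'v list \<Rightarrow> 'v list \<Rightarrow> 'v \<Rightarrow> 'v" where
  "image (v # vs) (w # ws) u = (if v = u then w else image vs ws u)"
| "image vs ws u = u"

fun embeds :: "'v list \<Rightarrow> 'v list \<Rightarrow> 'v node list \<Rightarrow> ('v \<times> 'v) list \<Rightarrow> bool" where
  "embeds vs ws ns [] = True"
| "embeds vs ws ns ((a, b) # es) = both (has_edge (image vs ws b) (get (image vs ws a) ns)) (embeds vs ws ns es)"

fun embeds_any :: "'v list \<Rightarrow> 'v list \<Rightarrow> 'v node list \<Rightarrow> ('v \<times> 'v) list list \<Rightarrow> bool" where
  "embeds_any vs ws ns [] = False"
| "embeds_any vs ws ns (es # rs) = (if embeds vs ws ns es then True else embeds_any vs ws ns rs)"

type_synonym 'v type_list = "('v \<times> kind) list"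

fun preserves :: "'v type_list \<Rightarrow> 'v type_list \<Rightarrow> 'v list \<Rightarrow> bool" where
  "preserves T [] [] = True"
| "preserves T ((v, k) # ts) (w # ws) = both (mem (w, k) T) (preserves T ts ws)"
| "preserves T ts ws = False"

fun distinct_list :: "'a list \<Rightarrow> bool" where
  "distinct_list [] = True" | "distinct_list (x # xs) = (if mem x xs then False else distinct_list xs)"

text \<open>Tests are handed out in order to those children that leave a state; a contradictory
  child consumes none, which keeps the certificates short.\<close>

fun every2 :: "'v test list \<Rightarrow> 'v node list \<Rightarrow> form \<Rightarrow> 'v node \<Rightarrow> 'v node list \<Rightarrow> bool"
  and next2 :: "'v result \<Rightarrow> 'v test list \<Rightarrow> 'v node list \<Rightarrow> form \<Rightarrow> 'v node \<Rightarrow> 'v node list \<Rightarrow> bool" where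
  "every2 Qs ns zs x [] = True"
| "every2 Qs ns zs x (y # ys) = next2 (add_edge x y ns zs) Qs ns zs x ys"
| "next2 Contra Qs ns zs x ys = every2 Qs ns zs x ys"
| "next2 Stuck Qs ns zs x ys = False"
| "next2 (State ms us) [] ns zs x ys = False"
| "next2 (State ms us) (Q # Qs) ns zs x ys = both (Q ms us) (every2 Qs ns zs x ys)"

fun node_room :: "bool \<Rightarrow> 'v node \<Rightarrow> bool" where "node_room e (Node v c i j nb f) = room e i j"

fun split :: "'v test list \<Rightarrow> 'v node list \<Rightarrow> form \<Rightarrow> 'v node option \<Rightarrow> bool \<Rightarrow> bool" where
  "split Qs ns zs None e = False"
| "split Qs ns zs (Some x) e = both (node_room e x) (every2 Qs ns zs x (children x e ns))"

definition fuel0 :: fuel where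
  "fuel0 = Go (Go (Go (Go (Go (Go (Go (Go (Go (Go (Go (Go (Go (Go (Go (Go (Go (Go (Go (Go (Go (Go (Go (Go (Go Stop))))))))))))))))))))))))"

primrec cover :: "'v type_list \<Rightarrow> ('v \<times> 'v) list list \<Rightarrow> 'v cert \<Rightarrow> 'v test" where
  "cover T rs Search = search fuel0"
| "cover T rs (Ref ws) = (\<lambda>ns zs. both (preserves T T ws) (both (distinct_list ws) (embeds_any (map fst T) ws ns rs)))"
| "cover T rs (Split v e cs) = (\<lambda>ns zs. split (map (cover T rs) cs) ns zs (get v ns) e)"

fun init_node :: "'v \<times> kind \<Rightarrow> 'v node" where
  "init_node (v, c, i, j) = Node v c i j [] []"

text \<open>Rejects an edge that is already present: adding it again would lower the capacities
  twice.\<close>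

fun guard :: "bool \<Rightarrow> 'v result \<Rightarrow> 'v result" where
  "guard True r = Stuck" | "guard False r = r"

fun add_pair :: "'v node option \<Rightarrow> 'v node option \<Rightarrow> 'v node list \<Rightarrow> form \<Rightarrow> 'v result" where
  "add_pair (Some x) (Some (Node u d k l mb g)) ns zs =
     guard (has_edge u (Some x)) (add_edge x (Node u d k l mb g) ns zs)"
| "add_pair None y ns zs = Stuck" | "add_pair (Some x) None ns zs = Stuck"

fun build :: "('v \<times> 'v) list \<Rightarrow> 'v result \<Rightarrow> 'v result" where
  "build [] r = r"
| "build (e # es) Contra = Contra" | "build (e # es) Stuck = Stuck"
| "build ((a, b) # es) (State ns zs) = build es (add_pair (get a ns) (get b ns) ns zs)"

definition check :: "'v type_list \<Rightarrow> ('v \<times> 'v) list list \<Rightarrow> 'v cert \<Rightarrow> ('v \<times> 'v) list \<Rightarrow> bool" where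
  "check T rs c es = on_result (cover T rs c) (build es (State (map init_node T) []))"


section \<open>Evaluation by rewriting\<close>

text \<open>These constants replace conditionals. The rewriter normalises arguments first; here the
  arguments are plain data and the recursive call appears only after the condition has been decided.
  \<open>elim_checked\<close> receives the new form as an argument, so that it is computed once
  although it is used twice.\<close>

definition "elim_checked v c i j nb f r = ncons_if (nonzero f) (Node v c i j nb f) r"
definition "mem_if b v xs = (if b then True else mem v xs)"
definition "get_if b x v ns = (if b then Some x else get v ns)"
definition "repl_if b x y ns = (if b then x # ns else y # repl x ns)"
definition "cands_if r nb c e seen x ns = (case r of None \<Rightarrow> cands nb c e seen ns | Some s \<Rightarrow> x # cands nb c e s ns)"
definition "image_if b w vs ws u = (if b then w else image vs ws u)"
definition "embeds_if b vs ws ns rs = (if b then True else embeds_any vs ws ns rs)"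
definition "distinct_if b xs = (if b then False else distinct_list xs)"

lemma mem_rules: "mem v [] = False" "mem v (x # xs) = mem_if (v = x) v xs"
    "mem_if True v xs = True" "mem_if False v xs = mem v xs"
  by (simp_all add: mem_if_def)

lemma get_rules: "get v [] = None"
    "get v (Node u c i j nb f # ns) = get_if (u = v) (Node u c i j nb f) v ns"
    "get_if True x v ns = Some x" "get_if False x v ns = get v ns"
  by (simp_all add: get_if_def)

lemma repl_rules: "repl x [] = []"
    "repl (Node v c i j nb f) (Node w d k l mb g # ns) =
       repl_if (w = v) (Node v c i j nb f) (Node w d k l mb g) ns"
    "repl_if True x y ns = x # ns" "repl_if False x y ns = y # repl x ns"
  by (simp_all add: repl_if_def)

lemma cands_rules: "cands nb c e seen [] = []"
    "cands nb c e seen (x # ns) = cands_if (classify nb c e seen x) nb c e seen x ns"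
    "cands_if None nb c e seen x ns = cands nb c e seen ns"
    "cands_if (Some s) nb c e seen x ns = x # cands nb c e s ns"
  by (simp_all add: cands_if_def)

lemma image_rules: "image (v # vs) (w # ws) u = image_if (v = u) w vs ws u"
    "image_if True w vs ws u = w" "image_if False w vs ws u = image vs ws u"
  by (simp_all add: image_if_def)

lemma embeds_any_rules: "embeds_any vs ws ns [] = False"
    "embeds_any vs ws ns (es # rs) = embeds_if (embeds vs ws ns es) vs ws ns rs"
    "embeds_if True vs ws ns rs = True" "embeds_if False vs ws ns rs = embeds_any vs ws ns rs"
  by (simp_all add: embeds_if_def)

lemma distinct_rules: "distinct_list [] = True" "distinct_list (x # xs) = distinct_if (mem x xs) xs"
    "distinct_if True xs = False" "distinct_if False xs = distinct_list xs"
  by (simp_all add: distinct_if_def)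

text \<open>Integers are computed in the binary representation by \<open>0\<close>,
  \<open>Int.Pos\<close> and \<open>Int.Neg\<close>, so that tests for zero and for 1 or -1 become
  pattern matches.\<close>

lemma int_rules:
    "1 = Int.Pos num.One" "- Int.Pos m = Int.Neg m" "- Int.Neg m = Int.Pos m" "- (0::int) = 0"
    "(0::int) + k = k" "k + (0::int) = k"
    "Int.Pos m + Int.Pos n = Int.Pos (m + n)" "Int.Neg m + Int.Neg n = Int.Neg (m + n)"
    "Int.Pos m + Int.Neg n = Int.sub m n" "Int.Neg m + Int.Pos n = Int.sub n m"
    "(0::int) * k = 0" "k * (0::int) = 0"
    "Int.Pos m * Int.Pos n = Int.Pos (m * n)" "Int.Pos m * Int.Neg n = Int.Neg (m * n)"
    "Int.Neg m * Int.Pos n = Int.Neg (m * n)" "Int.Neg m * Int.Neg n = Int.Pos (m * n)"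
  by (simp_all add: Int.sub_def)

lemma dup_sub_rules:
    "Int.sub num.One num.One = 0" "Int.sub (num.Bit0 m) num.One = Int.Pos (Num.BitM m)"
    "Int.sub (num.Bit1 m) num.One = Int.Pos (num.Bit0 m)"
    "Int.sub num.One (num.Bit0 n) = Int.Neg (Num.BitM n)" "Int.sub num.One (num.Bit1 n) = Int.Neg (num.Bit0 n)"
    "Int.sub (num.Bit0 m) (num.Bit0 n) = Int.dup (Int.sub m n)"
    "Int.sub (num.Bit1 m) (num.Bit1 n) = Int.dup (Int.sub m n)"
    "Int.sub (num.Bit1 m) (num.Bit0 n) = Int.dup (Int.sub m n) + Int.Pos num.One"
    "Int.sub (num.Bit0 m) (num.Bit1 n) = Int.dup (Int.sub m n) + Int.Neg num.One"
    "Int.dup 0 = 0"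
  by (simp_all only: Int.sub_code Int.dup_code minus_int_code uminus_int_code) (simp_all add: Int.sub_def Int.dup_def)

lemma nonzero_rules: "nonzero [] = False" "nonzero (0 # f) = nonzero f"
    "nonzero (Int.Pos m # f) = True" "nonzero (Int.Neg m # f) = True"
  by simp_all

lemma unit_pivot_rules: "unit_pivot [] = None" "unit_pivot (0 # f) = push 0 (unit_pivot f)"
    "unit_pivot (Int.Pos num.One # f) = Some ([], Int.Pos num.One, f)"
    "unit_pivot (Int.Neg num.One # f) = Some ([], Int.Neg num.One, f)"
    "unit_pivot (Int.Pos (num.Bit0 m) # f) = push (Int.Pos (num.Bit0 m)) (unit_pivot f)"
    "unit_pivot (Int.Pos (num.Bit1 m) # f) = push (Int.Pos (num.Bit1 m)) (unit_pivot f)"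
    "unit_pivot (Int.Neg (num.Bit0 m) # f) = push (Int.Neg (num.Bit0 m)) (unit_pivot f)"
    "unit_pivot (Int.Neg (num.Bit1 m) # f) = push (Int.Neg (num.Bit1 m)) (unit_pivot f)"
  by (simp_all add: Int.Pos_def Int.Neg_def)

lemma any_pivot_rules: "any_pivot [] = None" "any_pivot (0 # f) = push 0 (any_pivot f)"
    "any_pivot (Int.Pos m # f) = Some ([], Int.Pos m, f)" "any_pivot (Int.Neg m # f) = Some ([], Int.Neg m, f)"
  by simp_all

text \<open>With d = y - p and s = y + p the comparisons of y with p and - p turn into matches
  against 0.\<close>

definition "ratio_by d s p y = (if d = 0 then (1, - 1) else if s = 0 then (1, 1) else (p, - y))"

lemma ratio_rules: "ratio p 0 = (1, 0)"
    "ratio p (Int.Pos m) = ratio_by (Int.Pos m + - p) (Int.Pos m + p) p (Int.Pos m)"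
    "ratio p (Int.Neg m) = ratio_by (Int.Neg m + - p) (Int.Neg m + p) p (Int.Neg m)"
    "ratio_by 0 s p y = (1, - 1)" "ratio_by (Int.Pos m) 0 p y = (1, 1)" "ratio_by (Int.Neg m) 0 p y = (1, 1)"
    "ratio_by (Int.Pos m) (Int.Pos n) p y = (p, - y)" "ratio_by (Int.Pos m) (Int.Neg n) p y = (p, - y)"
    "ratio_by (Int.Neg m) (Int.Pos n) p y = (p, - y)" "ratio_by (Int.Neg m) (Int.Neg n) p y = (p, - y)"
  by (auto simp: ratio_def ratio_by_def)

lemma elim_node_rules:
    "elim_node 0 ss hs v c i j nb f r = ncons (Node v c i j nb (vmul ss f)) r"
    "elim_node (Int.Pos m) ss hs v c i j nb f r = elim_checked v c i j nb (vcomb (vmul ss f) (Int.Pos m) hs) r"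
    "elim_node (Int.Neg m) ss hs v c i j nb f r = elim_checked v c i j nb (vcomb (vmul ss f) (Int.Neg m) hs) r"
    "elim_checked v c i j nb f r = ncons_if (nonzero f) (Node v c i j nb f) r"
  by (simp_all add: elim_node_def elim_checked_def)

lemmas if_rules = int_rules Int.dup_code dup_sub_rules nonzero_rules unit_pivot_rules any_pivot_rules ratio_rules elim_node_rules
  add_num_simps mult_num_simps BitM.simps
  mem_rules get_rules repl_rules cands_rules image_rules embeds_any_rules distinct_rules

lemma cover_rules:
  "cover T rs Search ns zs = search fuel0 ns zs"
  "cover T rs (Ref ws) ns zs = both (preserves T T ws) (both (distinct_list ws) (embeds_any (map fst T) ws ns rs))"
  "cover T rs (Split v e cs) ns zs = split (map (cover T rs) cs) ns zs (get v ns) e"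
  by simp_all

text \<open>With constructors as vertex names, a comparison of vertices is one rewrite step. Sixteen
  names suffice for the largest excluded order.\<close>

datatype vx = A0 | A1 | A2 | A3 | A4 | A5 | A6 | A7 | A8 | A9 | B0 | B1 | B2 | B3 | B4 | B5

lemmas eval_rules = vadd.simps vmul.simps
  vcomb.simps coef.simps del.simps push.simps rcons.simps ratios.simps solve_any.simps solve_unit.simps solve_def
  form_of.simps form_sum.simps ncons.simps ncons_if.simps elim_nodes.simps
  incomplete.simps to_result.simps dependent.simps complete.simps dec.simps new_form.simps new_zs.simps
  link.simps finish.simps finish_both.simps add_edge.simps room.simps pick1.simps pick2.simps pick3.simps
  pick4.simps pick5.simps pick6.simps orelse.simps pick_def both.simps eqb.simps fresh.simps classify2.simps
  classify1.simps classify.simps children.simps on_result.simps every.simps branch.simps search.simps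
  has_edge.simps embeds.simps preserves.simps every2.simps next2.simps node_room.simps split.simps fuel0_def
  init_node.simps guard.simps add_pair.simps build.simps check_def if_rules cover_rules list.map append.simps list.sel
  prod.inject vx.distinct cap.distinct fst_conv simp_thms

subsection \<open>Linear forms modulo rows\<close>

primrec ev :: "form \<Rightarrow> (nat \<Rightarrow> real) \<Rightarrow> real" where
  "ev [] P = 0"
| "ev (x # f) P = of_int x * P 0 + ev f (\<lambda>i. P (Suc i))"

lemma ev_vadd: "ev (vadd f g) P = ev f P + ev g P"
  by (induction f g arbitrary: P rule: vadd.induct) (auto simp: algebra_simps)

lemma ev_vcomb: "ev (vcomb f c g) P = ev f P + of_int c * ev g P"
  by (induction f c g arbitrary: P rule: vcomb.induct) (auto simp: algebra_simps)

lemma ev_scale: "ev (map ((*) c) f) P = of_int c * ev f P"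
  by (induction f arbitrary: P) (auto simp: algebra_simps)

lemma ev_cong: "(\<And>i. i < length f \<Longrightarrow> P i = Q i) \<Longrightarrow> ev f P = ev f Q"
proof (induction f arbitrary: P Q)
  case (Cons x f)
  have "ev f (\<lambda>i. P (Suc i)) = ev f (\<lambda>i. Q (Suc i))"
    by (rule Cons.IH) (use Cons.prems in auto)
  then show ?case using Cons.prems[of 0] by simp
qed simp

lemma ev_append: "ev (f @ g) P = ev f P + ev g (\<lambda>i. P (length f + i))"
  by (induction f arbitrary: P) auto

lemma ev_zeros: "set f \<subseteq> {0} \<Longrightarrow> ev f P = 0"
  by (induction f arbitrary: P) auto

definition skip :: "nat \<Rightarrow> (nat \<Rightarrow> real) \<Rightarrow> nat \<Rightarrow> real" where
  "skip k P i = (if i < k then P i else P (Suc i))"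

lemma skip_Suc: "(\<lambda>i. skip (Suc k) P (Suc i)) = skip k (\<lambda>i. P (Suc i))" "skip (Suc k) P 0 = P 0"
  by (auto simp: skip_def fun_eq_iff)

lemma skip_0: "skip 0 P = (\<lambda>i. P (Suc i))"
  by (auto simp: skip_def)

lemma ev_del: "ev f P = of_int (coef a f) * P (length a) + ev (del a f) (skip (length a) P)"
proof (induction a f arbitrary: P rule: coef.induct)
  case (3 y a x f)
  show ?case using "3.IH"[of "\<lambda>i. P (Suc i)"] by (simp add: skip_Suc)
qed (auto simp: skip_0)

text \<open>The new unknowns are the old ones divided by the factors, so multiplying the
  coefficients by the factors leaves the value of a form unchanged.\<close>

definition unscale :: "form \<Rightarrow> (nat \<Rightarrow> real) \<Rightarrow> nat \<Rightarrow> real" where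
  "unscale ss P i = (if i < length ss then P i / of_int (ss ! i) else P i)"

lemma unscale_Cons: "(\<lambda>i. unscale (s # ss) P (Suc i)) = unscale ss (\<lambda>i. P (Suc i))"
    "unscale (s # ss) P 0 = P 0 / of_int s"
  by (auto simp: unscale_def fun_eq_iff)

lemma unscale_Nil [simp]: "unscale [] P = P"
  by (auto simp: unscale_def)

lemma ev_vmul: "0 \<notin> set ss \<Longrightarrow> ev (vmul ss f) (unscale ss P) = ev f P"
  by (induction ss f arbitrary: P rule: vmul.induct) (auto simp: unscale_Cons)

lemma coef_append: "coef a (a @ p # b) = p"
  by (induction a) auto

lemma del_append: "del a (a @ p # b) = a @ b"
  by (induction a) auto

lemma push_Some: "push x r = Some t \<longleftrightarrow> (\<exists>a p b. r = Some (a, p, b) \<and> t = (x # a, p, b))"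
  by (cases r) auto

lemma unit_pivot_Some: "unit_pivot g = Some (a, p, b) \<Longrightarrow> g = a @ p # b \<and> (p = 1 \<or> p = - 1)"
  by (induction g arbitrary: a) (auto simp: push_Some split: if_splits)

lemma any_pivot_Some: "any_pivot g = Some (a, p, b) \<Longrightarrow> g = a @ p # b \<and> p \<noteq> 0"
  by (induction g arbitrary: a) (auto simp: push_Some split: if_splits)

lemma push_None: "push x r = None \<longleftrightarrow> r = None"
  by (cases r) auto

lemma any_pivot_None: "any_pivot g = None \<Longrightarrow> set g \<subseteq> {0}"
  by (induction g) (auto simp: push_None split: if_splits)

lemma solve_None: "solve g = None \<Longrightarrow> ev g P = 0"
proof (rule ev_zeros, rule any_pivot_None)
  assume "solve g = None"
  then show "any_pivot g = None"
    by (cases "unit_pivot g"; cases "any_pivot g") (auto simp: solve_def)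
qed

lemma ratios_spec:
  assumes "p \<noteq> 0" "ratios p g = (ss, hs)"
  shows "length ss = length g \<and> length hs = length g \<and> 0 \<notin> set ss \<and>
    (\<forall>Q. of_int p * ev hs (unscale ss Q) = - ev g Q)"
  using assms(2)
proof (induction g arbitrary: ss hs)
  case (Cons y g)
  obtain s h where sh: "ratio p y = (s, h)" by force
  obtain ss' hs' where r: "ratios p g = (ss', hs')" by force
  have eq: "ss = s # ss'" "hs = h # hs'" using Cons.prems by (auto simp: sh r)
  have s: "s \<noteq> 0" "p * h = - (s * y)"
    using sh assms(1) by (auto simp: ratio_def split: if_splits)
  then have "of_int p * of_int h / of_int s = - (of_int y :: real)"
    by (simp add: field_simps flip: of_int_mult of_int_minus)
  then have *: "of_int p * (of_int h * (Q 0 / of_int s)) = - of_int y * Q 0" for Q :: "nat \<Rightarrow> real"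
    by (metis (no_types, lifting) mult.assoc times_divide_eq_left times_divide_eq_right)
  show ?case
    using Cons.IH[OF r] s(1) * by (auto simp: eq unscale_Cons distrib_left)
qed simp

lemma solve_Some:
  assumes "solve g = Some (a, ss, hs)"
  shows "0 \<notin> set ss" "coef a g \<noteq> 0" "length a < length g" "Suc (length hs) = length g"
    "of_int (coef a g) * ev hs (unscale ss Q) = - ev (del a g) Q"
proof -
  have "0 \<notin> set ss \<and> coef a g \<noteq> 0 \<and> length a < length g \<and> Suc (length hs) = length g \<and>
    (\<forall>Q. of_int (coef a g) * ev hs (unscale ss Q) = - ev (del a g) Q)"
  proof (cases "unit_pivot g")
    case None
    then obtain p b where ap: "any_pivot g = Some (a, p, b)" and r: "ratios p (a @ b) = (ss, hs)"
      using assms by (cases "any_pivot g") (auto simp: solve_def)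
    note g = any_pivot_Some[OF ap]
    show ?thesis using g ratios_spec[OF _ r]
      by (auto simp: coef_append del_append)
  next
    case (Some t)
    then obtain p b where up: "unit_pivot g = Some (a, p, b)" and eq: "ss = []" "hs = map ((*) (- p)) (a @ b)"
      using assms by (cases t) (auto simp: solve_def)
    note g = unit_pivot_Some[OF up]
    have "ev hs Q = - of_int p * ev (a @ b) Q" for Q
      by (simp only: eq ev_scale of_int_minus)
    then show ?thesis using g by (auto simp: eq coef_append del_append)
  qed
  then show "0 \<notin> set ss" "coef a g \<noteq> 0" "length a < length g" "Suc (length hs) = length g"
    "of_int (coef a g) * ev hs (unscale ss Q) = - ev (del a g) Q" by blast+
qed

definition elim_form :: "form \<Rightarrow> form \<Rightarrow> form \<Rightarrow> form \<Rightarrow> form" where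
  "elim_form a ss hs f = (if coef a f = 0 then vmul ss (del a f) else vcomb (vmul ss (del a f)) (coef a f) hs)"

text \<open>Substituting for the pivot unknown amounts to subtracting the multiple of
  \<open>g\<close> that cancels the pivot coefficient. Where \<open>g\<close> vanishes modulo the
  rows, the represented functional therefore stays the same modulo the rows.\<close>

lemma ev_elim_form:
  assumes "solve g = Some (a, ss, hs)"
  shows "ev (elim_form a ss hs f) (unscale ss (skip (length a) P)) =
    ev f P - of_int (coef a f) / of_int (coef a g) * ev g P"
proof -
  let ?Q = "skip (length a) P" and ?p = "of_int (coef a g) :: real" and ?c = "of_int (coef a f) :: real"
  note s = solve_Some[OF assms]
  have 1: "ev (elim_form a ss hs f) (unscale ss ?Q) = ev (del a f) ?Q + ?c * ev hs (unscale ss ?Q)"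
    by (simp add: elim_form_def ev_vcomb ev_vmul[OF s(1)])
  have "?p \<noteq> 0" using s(2) by simp
  then have 2: "ev hs (unscale ss ?Q) = - ev (del a g) ?Q / ?p"
    using s(5)[of ?Q] by (simp add: field_simps)
  show ?thesis
    unfolding 1 2 ev_del[of f P a] ev_del[of g P a] using \<open>?p \<noteq> 0\<close> by (simp add: field_simps)
qed

lemma length_vcomb: "length (vcomb f c g) = max (length f) (length g)"
  by (induction f c g rule: vcomb.induct) auto

lemma length_vmul [simp]: "length (vmul ss f) = length f"
  by (induction ss f rule: vmul.induct) auto

lemma length_vadd: "length (vadd f g) = max (length f) (length g)"
  by (induction f g rule: vadd.induct) auto

lemma length_del: "length (del a f) = (if length a < length f then length f - 1 else length f)"
  by (induction a f rule: del.induct) auto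

lemma length_elim_form:
  assumes "solve g = Some (a, ss, hs)" "length g \<le> k" "length f \<le> k"
  shows "length (elim_form a ss hs f) \<le> k - 1"
  using solve_Some(3,4)[OF assms(1)] assms(2,3)
  by (auto simp: elim_form_def length_vcomb length_del)

lemma ev_not_nonzero: "\<not> nonzero f \<Longrightarrow> ev f P = 0"
  by (induction f arbitrary: P) auto

section \<open>Kernels and row spaces of nut graphs\<close>

definition kernel :: "'v set \<Rightarrow> ('v \<Rightarrow> 'v set) \<Rightarrow> ('v \<Rightarrow> real) \<Rightarrow> bool" where
  "kernel V N x \<longleftrightarrow> (\<forall>v\<in>V. (\<Sum>u\<in>N v. x u) = 0)"

text \<open>The last clause implies nullity one: two independent kernel vectors would have a nonzero
  combination that vanishes at a chosen vertex.\<close>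

definition nut_on :: "'v set \<Rightarrow> ('v \<Rightarrow> 'v set) \<Rightarrow> bool" where
  "nut_on V N \<longleftrightarrow> finite V \<and> (\<forall>v\<in>V. N v \<subseteq> V \<and> v \<notin> N v) \<and> (\<forall>u\<in>V. \<forall>v\<in>V. u \<in> N v \<longrightarrow> v \<in> N u) \<and>
     (\<exists>x. kernel V N x \<and> (\<exists>v\<in>V. x v \<noteq> 0)) \<and>
     (\<forall>x. kernel V N x \<and> (\<exists>v\<in>V. x v \<noteq> 0) \<longrightarrow> (\<forall>v\<in>V. x v \<noteq> 0))"

lemma nut_on_finite: "nut_on V N \<Longrightarrow> finite V"
  and nut_on_subset: "nut_on V N \<Longrightarrow> v \<in> V \<Longrightarrow> N v \<subseteq> V"
  and nut_on_irrefl: "nut_on V N \<Longrightarrow> v \<in> V \<Longrightarrow> v \<notin> N v"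
  and nut_on_sym: "nut_on V N \<Longrightarrow> u \<in> V \<Longrightarrow> v \<in> V \<Longrightarrow> u \<in> N v \<longleftrightarrow> v \<in> N u"
  and nut_on_full: "nut_on V N \<Longrightarrow> kernel V N x \<Longrightarrow> u \<in> V \<Longrightarrow> x u \<noteq> 0 \<Longrightarrow> v \<in> V \<Longrightarrow> x v \<noteq> 0"
  unfolding nut_on_def by blast+

lemma nut_on_kernel:
  assumes "nut_on V N" obtains x where "kernel V N x" "\<And>v. v \<in> V \<Longrightarrow> x v \<noteq> 0"
  using assms unfolding nut_on_def by blast

abbreviation delta :: "bool \<Rightarrow> real" where "delta \<equiv> of_bool"

lemma sum_row:
  assumes "finite V" "A \<subseteq> V" shows "(\<Sum>z\<in>V. x z * delta (z \<in> A)) = (\<Sum>z\<in>A. x z)"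
proof -
  have "(\<Sum>z\<in>V. x z * delta (z \<in> A)) = (\<Sum>z\<in>V \<inter> A. x z)"
    using assms(1) by (simp add: sum.inter_restrict of_bool_def if_distrib cong: if_cong)
  then show ?thesis using assms(2) by (simp add: Int_absorb1)
qed

text \<open>A form of a vertex expresses its coordinate functional by unknown functionals P, modulo the rows
  of the adjacency matrix indexed by C.\<close>

definition expresses :: "'v set \<Rightarrow> ('v \<Rightarrow> 'v set) \<Rightarrow> 'v set \<Rightarrow> (nat \<Rightarrow> 'v \<Rightarrow> real) \<Rightarrow> 'v set \<Rightarrow> form \<Rightarrow> bool" where
  "expresses V N C P A f \<longleftrightarrow>
     (\<exists>Y. \<forall>z\<in>V. delta (z \<in> A) = ev f (\<lambda>i. P i z) + (\<Sum>c\<in>C. Y c * delta (z \<in> N c)))"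

lemma expressesI:
  assumes "\<And>z. z \<in> V \<Longrightarrow> delta (z \<in> A) = ev f (\<lambda>i. P i z) + (\<Sum>c\<in>C. Y c * delta (z \<in> N c))"
  shows "expresses V N C P A f"
  using assms unfolding expresses_def by blast

text \<open>All forms share one choice of unknown functionals. It is hidden by a quantifier because
  each elimination replaces the unknowns by rescaled ones.\<close>

definition forms :: "'v set \<Rightarrow> ('v \<Rightarrow> 'v set) \<Rightarrow> 'v set \<Rightarrow> ('v \<times> form) set \<Rightarrow> nat \<Rightarrow> bool" where
  "forms V N C F k \<longleftrightarrow> (\<exists>P. \<forall>(v, f)\<in>F. length f \<le> k \<and> expresses V N C P {v} f)"

lemma forms_mono: "forms V N C F k \<Longrightarrow> F' \<subseteq> F \<Longrightarrow> forms V N C F' k"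
  unfolding forms_def by blast

lemma forms_cong: "(\<And>c. c \<in> C \<Longrightarrow> N c = N' c) \<Longrightarrow> forms V N C F k \<Longrightarrow> forms V N' C F k"
  unfolding forms_def expresses_def by (simp cong: sum.cong)

text \<open>The unknown with index \<open>k\<close> is taken to be the coordinate functional of
  \<open>v\<close> itself; the earlier forms are too short to involve that index.\<close>

lemma forms_new:
  assumes "forms V N C F k" "length zs = k" "set zs \<subseteq> {0}"
  shows "forms V N C (insert (v, zs @ [1]) F) (Suc k)"
proof -
  from assms(1) obtain P where P: "\<And>u f. (u, f) \<in> F \<Longrightarrow> length f \<le> k \<and> expresses V N C P {u} f"
    unfolding forms_def by blast
  define P' where "P' = P(k := \<lambda>z. delta (z = v))"
  have "length f \<le> Suc k \<and> expresses V N C P' {u} f" if uf: "(u, f) \<in> insert (v, zs @ [1]) F" for u f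
  proof (cases "(u, f) \<in> F")
    case True
    have "ev f (\<lambda>i. P' i z) = ev f (\<lambda>i. P i z)" for z
      by (rule ev_cong) (use P[OF True] in \<open>auto simp: P'_def\<close>)
    then show ?thesis using P[OF True] by (auto simp: expresses_def)
  next
    case False
    then have uf: "u = v" "f = zs @ [1]" using uf by auto
    have "expresses V N C P' {u} f"
      by (rule expressesI[where Y = "\<lambda>_. 0"])
        (use assms(2,3) in \<open>auto simp: uf ev_append ev_zeros P'_def\<close>)
    then show ?thesis using assms(2) uf(2) by auto
  qed
  then show ?thesis unfolding forms_def by blast
qed

lemma expresses_form_sum:
  assumes F: "\<And>v f. (v, f) \<in> F \<Longrightarrow> length f \<le> k \<and> expresses V N C P {v} f"
    and nb: "\<And>u. u \<in> set us \<Longrightarrow> (u, form_of (get u ns)) \<in> F" "distinct us"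
  shows "length (form_sum us ns) \<le> k \<and> expresses V N C P (set us) (form_sum us ns)"
  using nb
proof (induction us)
  case Nil
  have "expresses V N C P (set []) (form_sum [] ns)"
    by (rule expressesI[where Y = "\<lambda>_. 0"]) simp
  then show ?case by simp
next
  case (Cons u us)
  have "length (form_sum us ns) \<le> k \<and> expresses V N C P (set us) (form_sum us ns)"
    by (rule Cons.IH) (use Cons.prems in auto)
  then obtain Y1 where 1: "length (form_sum us ns) \<le> k" "\<And>z. z \<in> V \<Longrightarrow> delta (z \<in> set us) =
     ev (form_sum us ns) (\<lambda>i. P i z) + (\<Sum>c\<in>C. Y1 c * delta (z \<in> N c))"
    unfolding expresses_def by blast
  have "length (form_of (get u ns)) \<le> k \<and> expresses V N C P {u} (form_of (get u ns))"
    by (rule F) (use Cons.prems in auto)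
  then obtain Y2 where 2: "length (form_of (get u ns)) \<le> k" "\<And>z. z \<in> V \<Longrightarrow> delta (z \<in> {u}) =
     ev (form_of (get u ns)) (\<lambda>i. P i z) + (\<Sum>c\<in>C. Y2 c * delta (z \<in> N c))"
    unfolding expresses_def by blast
  have "delta (z \<in> set (u # us)) = ev (form_sum (u # us) ns) (\<lambda>i. P i z) +
      (\<Sum>c\<in>C. (Y1 c + Y2 c) * delta (z \<in> N c))" if "z \<in> V" for z
  proof -
    have "delta (z \<in> set (u # us)) = delta (z \<in> {u}) + delta (z \<in> set us)"
      using Cons.prems(2) by (cases "z = u") auto
    then show ?thesis
      unfolding 1(2)[OF that] 2(2)[OF that] by (simp add: ev_vadd distrib_right sum.distrib)
  qed
  then have "expresses V N C P (set (u # us)) (form_sum (u # us) ns)"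
    by (rule expressesI)
  then show ?case using 1(1) 2(1) by (simp add: length_vadd)
qed

lemma row_independent:
  assumes nut: "nut_on V N" and C: "C \<subseteq> V" "w \<in> V" "w \<notin> C" "d \<in> V" "d \<notin> C" "d \<noteq> w"
  shows "\<not> (\<forall>z\<in>V. delta (z \<in> N w) = (\<Sum>c\<in>C. Y c * delta (z \<in> N c)))"
proof
  assume eq: "\<forall>z\<in>V. delta (z \<in> N w) = (\<Sum>c\<in>C. Y c * delta (z \<in> N c))"
  note fin = nut_on_finite[OF nut]
  define y where "y c = (if c = w then 1 else if c \<in> C then - Y c else 0)" for c
  have "(\<Sum>c\<in>N z. y c) = 0" if z: "z \<in> V" for z
  proof -
    have "(\<Sum>c\<in>N z. y c) = (\<Sum>c\<in>V. y c * delta (c \<in> N z))"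
      using sum_row[OF fin nut_on_subset[OF nut z], of y] by simp
    also have "\<dots> = (\<Sum>c\<in>V. y c * delta (z \<in> N c))"
      using nut_on_sym[OF nut z] by (intro sum.cong) auto
    also have "\<dots> = (\<Sum>c\<in>insert w C. y c * delta (z \<in> N c))"
      using C by (intro sum.mono_neutral_right[OF fin]) (auto simp: y_def)
    also have "\<dots> = delta (z \<in> N w) + (\<Sum>c\<in>C. y c * delta (z \<in> N c))"
      using C finite_subset[OF C(1) fin] by (simp add: y_def)
    also have "(\<Sum>c\<in>C. y c * delta (z \<in> N c)) = - (\<Sum>c\<in>C. Y c * delta (z \<in> N c))"
      unfolding sum_negf[symmetric] using C by (intro sum.cong) (auto simp: y_def)
    finally show ?thesis using eq z by simp
  qed
  then have "kernel V N y" by (simp add: kernel_def)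
  from nut_on_full[OF nut this C(2) _ C(4)] show False
    using C by (simp add: y_def)
qed

text \<open>A nowhere zero kernel vector \<open>x\<close> is orthogonal to every row; applied to the
  assumed identity it gives \<open>x v\<close> = 0.\<close>

lemma unit_not_in_row_space:
  assumes nut: "nut_on V N" and C: "C \<subseteq> V" "v \<in> V"
  shows "\<not> (\<forall>z\<in>V. delta (z = v) = (\<Sum>c\<in>C. Y c * delta (z \<in> N c)))"
proof
  assume eq: "\<forall>z\<in>V. delta (z = v) = (\<Sum>c\<in>C. Y c * delta (z \<in> N c))"
  note fin = nut_on_finite[OF nut]
  obtain x where x: "kernel V N x" "\<And>v. v \<in> V \<Longrightarrow> x v \<noteq> 0"
    using nut_on_kernel[OF nut] by blast
  have "x v = (\<Sum>z\<in>V. x z * delta (z = v))"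
    using C fin sum_row[of V "{v}" x] by simp
  also have "\<dots> = (\<Sum>z\<in>V. x z * (\<Sum>c\<in>C. Y c * delta (z \<in> N c)))"
    using eq by (intro sum.cong) auto
  also have "\<dots> = (\<Sum>z\<in>V. \<Sum>c\<in>C. Y c * (x z * delta (z \<in> N c)))"
    by (simp add: sum_distrib_left mult_ac)
  also have "\<dots> = (\<Sum>c\<in>C. \<Sum>z\<in>V. Y c * (x z * delta (z \<in> N c)))"
    by (rule sum.swap)
  also have "\<dots> = (\<Sum>c\<in>C. Y c * (\<Sum>z\<in>V. x z * delta (z \<in> N c)))"
    by (simp add: sum_distrib_left)
  also have "\<dots> = 0"
  proof (rule sum.neutral, rule ballI)
    fix c assume "c \<in> C"
    then have "c \<in> V" using C by auto
    then show "Y c * (\<Sum>z\<in>V. x z * delta (z \<in> N c)) = 0"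
      using x(1) sum_row[OF fin nut_on_subset[OF nut \<open>c \<in> V\<close>], of x] by (simp add: kernel_def)
  qed
  finally show False using x(2) C by auto
qed

text \<open>The row of \<open>w\<close> is the sum of the coordinate functionals of its neighbours.
  Once this row is factored out too, \<open>form_sum nb ns\<close> represents zero, and solving it
  removes one unknown.\<close>

lemma forms_elim:
  assumes nut: "nut_on V N" and C: "C \<subseteq> V" "w \<notin> C"
    and F: "forms V N C F k" and nb: "\<And>u. u \<in> set nb \<Longrightarrow> (u, form_of (get u ns)) \<in> F"
      "distinct nb" "N w = set nb"
    and s: "solve (form_sum nb ns) = Some (a, ss, hs)"
  shows "forms V N (insert w C) ((\<lambda>(v, f). (v, elim_form a ss hs f)) ` F) (k - 1)"
proof -
  from F obtain P where P: "\<And>u f. (u, f) \<in> F \<Longrightarrow> length f \<le> k \<and> expresses V N C P {u} f"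
    unfolding forms_def by blast
  let ?g = "form_sum nb ns"
  define P' where "P' i z = unscale ss (skip (length a) (\<lambda>i. P i z)) i" for i z
  have fC: "finite C" using C(1) nut_on_finite[OF nut] by (rule finite_subset)
  from expresses_form_sum[OF P nb(1,2)] obtain Yw where
    g: "length ?g \<le> k" "\<And>z. z \<in> V \<Longrightarrow> delta (z \<in> set nb) = ev ?g (\<lambda>i. P i z) + (\<Sum>c\<in>C. Yw c * delta (z \<in> N c))"
    unfolding expresses_def by blast
  have main: "length (elim_form a ss hs f) \<le> k - 1 \<and> expresses V N (insert w C) P' {v} (elim_form a ss hs f)"
    if vf: "(v, f) \<in> F" for v f
  proof
    show "length (elim_form a ss hs f) \<le> k - 1"
      using length_elim_form[OF s g(1)] P[OF vf] by blast
    obtain Y where Y: "\<And>z. z \<in> V \<Longrightarrow> delta (z \<in> {v}) = ev f (\<lambda>i. P i z) + (\<Sum>c\<in>C. Y c * delta (z \<in> N c))"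
      using P[OF vf] unfolding expresses_def by blast
    define m where "m = of_int (coef a f) / (of_int (coef a ?g) :: real)"
    \<comment> \<open>Elimination subtracts m times \<open>form_sum nb ns\<close>, which is row
      \<open>w\<close> less the combination \<open>Yw\<close> of earlier rows; hence the coefficient
      m at \<open>w\<close> and the correction - m * \<open>Yw\<close> elsewhere.\<close>
    have "delta (z \<in> {v}) = ev (elim_form a ss hs f) (\<lambda>i. P' i z) +
        (\<Sum>c\<in>insert w C. (if c = w then m else Y c - m * Yw c) * delta (z \<in> N c))" if z: "z \<in> V" for z
    proof -
      have "ev (elim_form a ss hs f) (\<lambda>i. P' i z) = ev f (\<lambda>i. P i z) - m * ev ?g (\<lambda>i. P i z)"
        unfolding P'_def m_def using ev_elim_form[OF s] by (simp add: eta_contract_eq)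
      moreover have "ev f (\<lambda>i. P i z) = delta (z \<in> {v}) - (\<Sum>c\<in>C. Y c * delta (z \<in> N c))"
        using Y[OF z] by simp
      moreover have "ev ?g (\<lambda>i. P i z) = delta (z \<in> N w) - (\<Sum>c\<in>C. Yw c * delta (z \<in> N c))"
        using g(2)[OF z] nb(3) by simp
      moreover have "(\<Sum>c\<in>insert w C. (if c = w then m else Y c - m * Yw c) * delta (z \<in> N c)) =
          m * delta (z \<in> N w) + (\<Sum>c\<in>C. (Y c - m * Yw c) * delta (z \<in> N c))"
        using C(2) fC by (auto intro!: sum.cong)
      ultimately show ?thesis
        by (simp add: left_diff_distrib sum_subtractf sum_distrib_left right_diff_distrib mult.assoc del: singleton_iff)
    qed
    then show "expresses V N (insert w C) P' {v} (elim_form a ss hs f)"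
      by (rule expressesI)
  qed
  show ?thesis unfolding forms_def by (intro exI[of _ P']) (use main in auto)
qed

lemma form_sum_nonzero:
  assumes nut: "nut_on V N" and C: "C \<subseteq> V" "w \<in> V" "w \<notin> C" "d \<in> V" "d \<notin> C" "d \<noteq> w"
    and F: "forms V N C F k" and nb: "\<And>u. u \<in> set nb \<Longrightarrow> (u, form_of (get u ns)) \<in> F"
      "distinct nb" "N w = set nb"
  shows "solve (form_sum nb ns) \<noteq> None"
proof
  assume s: "solve (form_sum nb ns) = None"
  from F obtain P where P: "\<And>u f. (u, f) \<in> F \<Longrightarrow> length f \<le> k \<and> expresses V N C P {u} f"
    unfolding forms_def by blast
  from expresses_form_sum[OF P nb(1,2)] obtain Y where
    "\<And>z. z \<in> V \<Longrightarrow> delta (z \<in> N w) = (\<Sum>c\<in>C. Y c * delta (z \<in> N c))"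
    unfolding expresses_def solve_None[OF s] nb(3)[symmetric] by auto
  with row_independent[OF nut C] show False by blast
qed

lemma form_nonzero:
  assumes "nut_on V N" "C \<subseteq> V" "v \<in> V" "forms V N C F k" "(v, f) \<in> F"
  shows "nonzero f"
proof (rule ccontr)
  assume "\<not> nonzero f"
  then have "ev f P = 0" for P by (rule ev_not_nonzero)
  moreover obtain P where "expresses V N C P {v} f"
    using assms(4,5) unfolding forms_def by blast
  ultimately obtain Y where "\<And>z. z \<in> V \<Longrightarrow> delta (z = v) = (\<Sum>c\<in>C. Y c * delta (z \<in> N c))"
    unfolding expresses_def by auto
  with unit_not_in_row_space[OF assms(1-3)] show False by blast
qed

subsection \<open>Soundness of the search\<close>

fun cval :: "cap \<Rightarrow> nat" where "cval C0 = 0" | "cval C1 = 1" | "cval C2 = 2" | "cval C3 = 3"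

definition verts :: "'v type_list \<Rightarrow> 'v set" where "verts T = fst ` set T"
definition ones :: "'v type_list \<Rightarrow> 'v set" where "ones T = {v. \<exists>k. (v, True, k) \<in> set T}"

definition model :: "'v type_list \<Rightarrow> ('v \<Rightarrow> 'v set) \<Rightarrow> bool" where
  "model T N \<longleftrightarrow> distinct (map fst T) \<and> nut_on (verts T) N \<and>
     (\<forall>(v, c, i, j) \<in> set T. card (N v \<inter> ones T) = cval i \<and> card (N v - ones T) = cval j)"

definition refuted :: "'v type_list \<Rightarrow> ('v \<times> 'v) list \<Rightarrow> bool" where
  "refuted T es \<longleftrightarrow> \<not> (\<exists>N. model T N \<and> (\<forall>(a, b) \<in> set es. b \<in> N a))"

definition node_ok :: "'v type_list \<Rightarrow> ('v \<Rightarrow> 'v set) \<Rightarrow> 'v node \<Rightarrow> bool" where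
  "node_ok T N x \<longleftrightarrow> (vcls x \<longleftrightarrow> vid x \<in> ones T) \<and> distinct (nbs x) \<and> set (nbs x) \<subseteq> N (vid x) \<and>
     cval (cap1 x) = card (N (vid x) \<inter> ones T - set (nbs x)) \<and>
     cval (cap0 x) = card (N (vid x) - ones T - set (nbs x))"

definition sym_nodes :: "'v node list \<Rightarrow> bool" where
  "sym_nodes ns \<longleftrightarrow> (\<forall>x \<in> set ns. \<forall>u \<in> set (nbs x). \<exists>y \<in> set ns. vid y = u \<and> vid x \<in> set (nbs y))"

definition nodes_ok :: "'v type_list \<Rightarrow> ('v \<Rightarrow> 'v set) \<Rightarrow> 'v node list \<Rightarrow> bool" where
  "nodes_ok T N ns \<longleftrightarrow> map vid ns = map fst T \<and> (\<forall>x \<in> set ns. node_ok T N x) \<and> sym_nodes ns"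

definition full :: "'v node \<Rightarrow> bool" where "full x \<longleftrightarrow> cap1 x = C0 \<and> cap0 x = C0"
definition done_set :: "'v node list \<Rightarrow> 'v set" where "done_set ns = vid ` {x \<in> set ns. full x}"
definition touched :: "'v node list \<Rightarrow> ('v \<times> form) set" where
  "touched ns = (\<lambda>x. (vid x, fm x)) ` {x \<in> set ns. nbs x \<noteq> []}"

definition inv_state :: "'v type_list \<Rightarrow> ('v \<Rightarrow> 'v set) \<Rightarrow> 'v node list \<Rightarrow> form \<Rightarrow> bool" where
  "inv_state T N ns zs \<longleftrightarrow> nodes_ok T N ns \<and> set zs \<subseteq> {0} \<and>
     forms (verts T) N (done_set ns) (touched ns) (length zs)"

text \<open>Everything except the form, the only part of a node that elimination changes.\<close>

definition skeleton :: "'v node \<Rightarrow> 'v \<times> bool \<times> cap \<times> cap \<times> 'v list" where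
  "skeleton x = (vid x, vcls x, cap1 x, cap0 x, nbs x)"

lemma cval_0 [simp]: "cval i = 0 \<longleftrightarrow> i = C0" by (cases i) auto
lemma cval_dec: "cval (dec i) = cval i - 1" by (cases i) auto
lemma cval_room: "room c i j \<longleftrightarrow> cval (if c then i else j) > 0" by (cases "(c, i, j)" rule: room.cases) auto

lemma mem_iff [simp]: "mem v xs \<longleftrightarrow> v \<in> set xs" by (induction xs) auto
lemma both_iff [simp]: "both a b \<longleftrightarrow> a \<and> b" by (cases a) auto
lemma eqb_iff [simp]: "eqb a b \<longleftrightarrow> a = b" by (cases a; cases b) auto

lemma get_SomeD: "get v ns = Some x \<Longrightarrow> x \<in> set ns \<and> vid x = v"
  by (induction v ns rule: get.induct) (auto split: if_splits)

lemma get_Some: "distinct (map vid ns) \<Longrightarrow> x \<in> set ns \<Longrightarrow> get (vid x) ns = Some x"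
  by (induction "vid x" ns rule: get.induct) (auto simp: image_iff)

lemma form_of_Some [simp]: "form_of (Some x) = fm x" by (cases x) auto

lemma repl_eq: "distinct (map vid ns) \<Longrightarrow> repl x ns = map (\<lambda>y. if vid y = vid x then x else y) ns"
proof (induction x ns rule: repl.induct)
  case (2 v c i j nb f w d k l mb g ns)
  have "map (\<lambda>y. if vid y = v then Node v c i j nb f else y) ns = ns" if "w = v"
    using 2(2) that by (intro map_idI) force
  then show ?case using 2 by auto
qed auto

definition elim_upd :: "form \<Rightarrow> form \<Rightarrow> form \<Rightarrow> 'v node \<Rightarrow> 'v node" where
  "elim_upd a ss hs x = (if nbs x = [] then x
     else Node (vid x) (vcls x) (cap1 x) (cap0 x) (nbs x) (elim_form a ss hs (fm x)))"

lemma skeleton_elim_upd [simp]: "skeleton (elim_upd a ss hs x) = skeleton x"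
  by (simp add: skeleton_def elim_upd_def)

lemma ncons_Some: "ncons x r = Some ms \<longleftrightarrow> (\<exists>ns. r = Some ns \<and> ms = x # ns)" by (cases r) auto
lemma ncons_None: "ncons x r = None \<longleftrightarrow> r = None" by (cases r) auto

lemma elim_nodes_Some: "elim_nodes a ss hs ns = Some ms \<Longrightarrow> ms = map (elim_upd a ss hs) ns"
proof (induction a ss hs ns arbitrary: ms rule: elim_nodes.induct)
  case (3 a ss hs v c i j u nb f ns)
  then show ?case
    by (cases "nonzero (vcomb (vmul ss (del a f)) (coef a f) hs)")
      (auto simp: elim_node_def elim_upd_def elim_form_def ncons_Some split: if_splits)
qed (auto simp: ncons_Some elim_upd_def)

lemma elim_nodes_None:
  "elim_nodes a ss hs ns = None \<Longrightarrow> \<exists>x \<in> set ns. nbs x \<noteq> [] \<and> \<not> nonzero (elim_form a ss hs (fm x))"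
proof (induction a ss hs ns rule: elim_nodes.induct)
  case (3 a ss hs v c i j u nb f ns)
  then show ?case
    by (cases "nonzero (vcomb (vmul ss (del a f)) (coef a f) hs)")
      (auto simp: elim_node_def elim_form_def ncons_None split: if_splits)
qed (auto simp: ncons_None)

lemma nodes_ok_skeleton:
  assumes "nodes_ok T N ns" "map skeleton ms = map skeleton ns"
  shows "nodes_ok T N ms"
proof -
  have len: "length ms = length ns" using assms(2) by (rule map_eq_imp_length_eq)
  have sk: "skeleton (ms ! i) = skeleton (ns ! i)" if "i < length ns" for i
    using arg_cong[OF assms(2), of "\<lambda>l. l ! i"] that len by simp
  have sel: "vid x = vid y" "vcls x = vcls y" "cap1 x = cap1 y" "cap0 x = cap0 y" "nbs x = nbs y"
    if "skeleton x = skeleton y" for x y :: "'a node"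
    using that by (simp_all add: skeleton_def)
  have img: "skeleton ` set ms = skeleton ` set ns"
    using arg_cong[OF assms(2), of set] by simp
  have ex1: "\<exists>y \<in> set ns. skeleton x = skeleton y" if "x \<in> set ms" for x
    using imageI[OF that, of skeleton] unfolding img by blast
  have ex2: "\<exists>x \<in> set ms. skeleton x = skeleton y" if "y \<in> set ns" for y
    using imageI[OF that, of skeleton] unfolding img[symmetric] by force
  have "map vid ms = map vid ns"
    by (rule nth_equalityI) (use len sel(1)[OF sk] in simp_all)
  moreover have "node_ok T N x" if xm: "x \<in> set ms" for x
  proof -
    obtain y where y: "y \<in> set ns" "skeleton x = skeleton y" using ex1[OF xm] by blast
    have "node_ok T N y" using y(1) assms(1) by (simp add: nodes_ok_def)
    then show ?thesis by (simp add: node_ok_def sel[OF y(2)])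
  qed
  moreover have "sym_nodes ms"
    unfolding sym_nodes_def
  proof (intro ballI)
    fix x u assume x: "x \<in> set ms" and u: "u \<in> set (nbs x)"
    obtain x' where x': "x' \<in> set ns" "skeleton x = skeleton x'" using ex1[OF x] by blast
    have "u \<in> set (nbs x')" using u sel(5)[OF x'(2)] by simp
    then obtain y' where y': "y' \<in> set ns" "vid y' = u" "vid x' \<in> set (nbs y')"
      using assms(1) x'(1) unfolding nodes_ok_def sym_nodes_def by blast
    obtain y where y: "y \<in> set ms" "skeleton y = skeleton y'" using ex2[OF y'(1)] by blast
    show "\<exists>y \<in> set ms. vid y = u \<and> vid x \<in> set (nbs y)"
      using y y' sel[OF y(2)] sel(1)[OF x'(2)] by auto
  qed
  ultimately show ?thesis using assms(1) by (auto simp: nodes_ok_def)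
qed

lemma incomplete_Cons: "incomplete (x # ns) \<longleftrightarrow> \<not> full x \<or> incomplete ns"
  by (cases x; cases "cap1 x"; cases "cap0 x") (simp_all add: full_def)

lemma incomplete_iff: "incomplete ns \<longleftrightarrow> (\<exists>x \<in> set ns. \<not> full x)"
  by (induction ns) (simp_all add: incomplete_Cons)

lemma done_set_alt: "done_set ns = (\<lambda>(v, c, i, j, nb). v) ` {s \<in> skeleton ` set ns. (case s of (v, c, i, j, nb) \<Rightarrow> i = C0 \<and> j = C0)}"
  unfolding done_set_def by (auto simp: skeleton_def full_def image_iff) metis

lemma done_set_skeleton: "map skeleton ms = map skeleton ns \<Longrightarrow> done_set ms = done_set ns"
  unfolding done_set_alt by (simp only: set_map[symmetric])

locale modelled =
  fixes T :: "'v type_list" and N :: "'v \<Rightarrow> 'v set"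
  assumes model: "model T N"
begin

lemma nut: "nut_on (verts T) N" and dist: "distinct (map fst T)"
  using model by (auto simp: model_def)

lemma finite_nb: "v \<in> verts T \<Longrightarrow> finite (N v)"
  using nut_on_subset[OF nut] nut_on_finite[OF nut] by (rule finite_subset)

lemma vids:
  assumes "nodes_ok T N ns"
  shows "distinct (map vid ns)" "vid ` set ns = verts T"
proof -
  have "map vid ns = map fst T" using assms by (simp add: nodes_ok_def)
  then show "distinct (map vid ns)" "vid ` set ns = verts T"
    using dist by (simp, metis image_set verts_def)
qed

lemma full_nbs:
  assumes "nodes_ok T N ns" "x \<in> set ns" "full x"
  shows "N (vid x) = set (nbs x)"
proof -
  have ok: "node_ok T N x" using assms by (simp add: nodes_ok_def)
  have "finite (N (vid x))" by (rule finite_nb) (use vids(2)[OF assms(1)] assms(2) in auto)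
  then show ?thesis using ok assms(3) by (auto simp: node_ok_def full_def)
qed

lemma nbs_touched:
  assumes "nodes_ok T N ns" "x \<in> set ns" "u \<in> set (nbs x)"
  shows "(u, form_of (get u ns)) \<in> touched ns"
proof -
  obtain y where y: "y \<in> set ns" "vid y = u" "vid x \<in> set (nbs y)"
    using assms unfolding nodes_ok_def sym_nodes_def by blast
  then have "get u ns = Some y" using get_Some[OF vids(1)[OF assms(1)]] by blast
  then show ?thesis using y by (force simp: touched_def)
qed

text \<open>\<open>C\<close> is the set of rows eliminated so far. It may be smaller than
  \<open>done_set ns\<close>, since an edge can complete both ends while their rows are treated one
  after the other. For the same reason \<open>x\<close> need agree with the stored node
  \<open>x'\<close> only up to its form: the first elimination has already changed the stored
  forms.\<close>

lemma finish_sound: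
  assumes ns: "nodes_ok T N ns" "set zs \<subseteq> {0}" "forms (verts T) N C (touched ns) (length zs)"
    and C: "C \<subseteq> done_set ns" and x: "x' \<in> set ns" "skeleton x = skeleton x'" "full x \<Longrightarrow> vid x \<notin> C"
    and strict: "strict \<Longrightarrow> full x \<Longrightarrow> \<exists>d \<in> verts T. d \<notin> C \<and> d \<noteq> vid x"
  shows "finish strict x (State ns zs) \<noteq> Contra \<and> (\<forall>ms us. finish strict x (State ns zs) = State ms us \<longrightarrow>
    map skeleton ms = map skeleton ns \<and> set us \<subseteq> {0} \<and>
    forms (verts T) N (if full x then insert (vid x) C else C) (touched ms) (length us))"
proof (cases "full x")
  case False
  then have "finish strict x (State ns zs) = State ns zs"
    by (cases x; cases "cap1 x"; cases "cap0 x") (auto simp: full_def)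
  then show ?thesis using False ns by auto
next
  case True
  have sel: "vid x = vid x'" "nbs x = nbs x'" "full x'"
    using x(2) True by (auto simp: skeleton_def full_def)
  have fin: "finish strict x (State ns zs) = complete strict ns zs (solve (form_sum (nbs x) ns))"
    using True by (cases x) (auto simp: full_def)
  have V: "vid x \<in> verts T" "C \<subseteq> verts T"
    using C x(1) sel(1) vids(2)[OF ns(1)] by (auto simp: done_set_def)
  note nb = nbs_touched[OF ns(1) x(1), folded sel(2)]
  have nb': "distinct (nbs x)" "N (vid x) = set (nbs x)"
    using full_nbs[OF ns(1) x(1) sel(3)] ns(1) x(1) sel by (auto simp: nodes_ok_def node_ok_def)
  show ?thesis
  proof (cases "solve (form_sum (nbs x) ns)")
    case None
    \<comment> \<open>A zero sum would be a dependence that avoids row \<open>d\<close>; so every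
      other row is already in \<open>C\<close>, and neither strictness nor an incomplete vertex is
      possible.\<close>
    have no: "\<not> (\<exists>d \<in> verts T. d \<notin> C \<and> d \<noteq> vid x)"
      using form_sum_nonzero[OF nut V(2,1) x(3)[OF True] _ _ _ ns(3) nb nb'] None by blast
    then have "\<not> strict" using strict True by blast
    moreover have "\<not> incomplete ns"
    proof
      assume "incomplete ns"
      then obtain z where z: "z \<in> set ns" "\<not> full z" by (auto simp: incomplete_iff)
      have "vid z \<notin> done_set ns"
        using z vids(1)[OF ns(1)] by (auto simp: done_set_def distinct_map inj_on_def)
      moreover have "vid z \<in> verts T" using z vids(2)[OF ns(1)] by auto
      moreover have "vid x \<in> done_set ns" using sel x(1) by (auto simp: done_set_def)
      ultimately have "vid z \<in> verts T \<and> vid z \<notin> C \<and> vid z \<noteq> vid x" using C by auto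
      then show False using no by blast
    qed
    ultimately have stuck: "finish strict x (State ns zs) = Stuck"
      unfolding fin None by (cases strict) simp_all
    show ?thesis unfolding stuck by simp
  next
    case (Some t)
    obtain a ss hs where t: "t = (a, ss, hs)" by (cases t)
    have s: "solve (form_sum (nbs x) ns) = Some (a, ss, hs)" using Some t by simp
    have F: "forms (verts T) N (insert (vid x) C) ((\<lambda>(v, f). (v, elim_form a ss hs f)) ` touched ns) (length zs - 1)"
      by (rule forms_elim[OF nut V(2) x(3)[OF True] ns(3) _ nb' s]) (rule nb)
    have F': "forms (verts T) N (insert (vid x) C) (touched (map (elim_upd a ss hs) ns)) (length zs - 1)"
      by (rule forms_mono[OF F]) (force simp: touched_def elim_upd_def split: if_splits)
    have res: "finish strict x (State ns zs) = to_result zs (elim_nodes a ss hs ns)"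
      unfolding fin s by (cases strict) simp_all
    show ?thesis
    proof (cases "elim_nodes a ss hs ns")
      case None
      then obtain y where y: "y \<in> set ns" "nbs y \<noteq> []" "\<not> nonzero (elim_form a ss hs (fm y))"
        using elim_nodes_None[OF None] by blast
      have "(vid y, elim_form a ss hs (fm y)) \<in> (\<lambda>(v, f). (v, elim_form a ss hs f)) ` touched ns"
        using y by (force simp: touched_def)
      moreover have "vid y \<in> verts T" using y vids(2)[OF ns(1)] by auto
      moreover have "insert (vid x) C \<subseteq> verts T" using V by auto
      ultimately have "nonzero (elim_form a ss hs (fm y))"
        using form_nonzero[OF nut _ _ F] by blast
      then show ?thesis using y by blast
    next
      case (Some ms)
      have ms: "ms = map (elim_upd a ss hs) ns" using Some by (rule elim_nodes_Some)
      have st: "finish strict x (State ns zs) = State ms (tl zs)" unfolding res Some by simp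
      have "set (tl zs) \<subseteq> {0}" using ns(2) by (cases zs) auto
      moreover have "map skeleton ms = map skeleton ns" unfolding ms by simp
      moreover have "forms (verts T) N (insert (vid x) C) (touched ms) (length (tl zs))"
        using F' unfolding ms by simp
      ultimately show ?thesis unfolding st using True by simp
    qed
  qed
qed

end

definition sound :: "'v type_list \<Rightarrow> 'v test \<Rightarrow> bool" where
  "sound T Q \<longleftrightarrow> (\<forall>N ns zs. Q ns zs \<longrightarrow> model T N \<longrightarrow> \<not> inv_state T N ns zs)"

lemma add_edge_eq:
  fixes x y :: "'v node" and zs :: form
  defines "x' \<equiv> link (vid x) (vcls x) (cap1 x) (cap0 x) (nbs x) (new_form (nbs x) (fm x) zs) (vid y) (vcls y)"
    and "y' \<equiv> link (vid y) (vcls y) (cap1 y) (cap0 y) (nbs y) (new_form (nbs y) (fm y) (new_zs (nbs x) zs)) (vid x) (vcls x)"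
  shows "add_edge x y ns zs =
    finish False y' (finish True x' (State (repl x' (repl y' ns)) (new_zs (nbs y) (new_zs (nbs x) zs))))"
  unfolding x'_def y'_def by (cases x; cases y) simp

lemma link_sel:
  "vid (link v c i j nb f u d) = v" "vcls (link v c i j nb f u d) = c" "nbs (link v c i j nb f u d) = u # nb"
  "fm (link v c i j nb f u d) = f" "cap1 (link v c i j nb f u d) = (if d then dec i else i)"
  "cap0 (link v c i j nb f u d) = (if d then j else dec j)"
  by (cases d; simp)+

context modelled
begin

lemma node_ok_link:
  assumes x: "node_ok T N x" and u: "u \<in> N (vid x)" "u \<notin> set (nbs x)" "vid x \<in> verts T" "d \<longleftrightarrow> u \<in> ones T"
  shows "node_ok T N (link (vid x) (vcls x) (cap1 x) (cap0 x) (nbs x) f u d)"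
proof -
  note fin = finite_nb[OF u(3)]
  have "cval (if d then dec (cap1 x) else cap1 x) = card (N (vid x) \<inter> ones T - set (u # nbs x))"
  proof (cases d)
    case True
    then have "u \<in> N (vid x) \<inter> ones T - set (nbs x)" using u by simp
    then have "card (N (vid x) \<inter> ones T - set (nbs x) - {u}) = card (N (vid x) \<inter> ones T - set (nbs x)) - 1"
      by (rule card_Diff_singleton)
    moreover have "N (vid x) \<inter> ones T - set (u # nbs x) = N (vid x) \<inter> ones T - set (nbs x) - {u}" by auto
    ultimately show ?thesis using x True by (simp add: node_ok_def cval_dec)
  next
    case False
    then have "N (vid x) \<inter> ones T - set (u # nbs x) = N (vid x) \<inter> ones T - set (nbs x)" using u by auto
    then show ?thesis using x False by (simp add: node_ok_def)
  qed
  moreover have "cval (if d then cap0 x else dec (cap0 x)) = card (N (vid x) - ones T - set (u # nbs x))"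
  proof (cases d)
    case False
    then have "u \<in> N (vid x) - ones T - set (nbs x)" using u by simp
    then have "card (N (vid x) - ones T - set (nbs x) - {u}) = card (N (vid x) - ones T - set (nbs x)) - 1"
      by (rule card_Diff_singleton)
    moreover have "N (vid x) - ones T - set (u # nbs x) = N (vid x) - ones T - set (nbs x) - {u}" by auto
    ultimately show ?thesis using x False by (simp add: node_ok_def cval_dec)
  next
    case True
    then have "N (vid x) - ones T - set (u # nbs x) = N (vid x) - ones T - set (nbs x)" using u by auto
    then show ?thesis using x True by (simp add: node_ok_def)
  qed
  ultimately show ?thesis using x u by (simp add: node_ok_def link_sel)
qed

lemma forms_touch:
  assumes "forms V N C F (length zs)" "set zs \<subseteq> {0}" "nb \<noteq> [] \<Longrightarrow> (v, f) \<in> F"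
  shows "forms V N C (insert (v, new_form nb f zs) F) (length (new_zs nb zs)) \<and> set (new_zs nb zs) \<subseteq> {0}"
  using assms forms_new[OF assms(1) refl assms(2)]
  by (cases nb) (auto simp: insert_absorb)

lemma not_full:
  assumes "nodes_ok T N ns" "x \<in> set ns" "u \<in> N (vid x)" "u \<notin> set (nbs x)"
  shows "\<not> full x"
  using full_nbs[OF assms(1,2)] assms(3,4) by auto

lemma add_edge_sound:
  assumes inv: "inv_state T N ns zs" and x: "x \<in> set ns" and y: "y \<in> set ns"
    and u: "vid y \<in> N (vid x)" "vid y \<notin> set (nbs x)"
  shows "add_edge x y ns zs \<noteq> Contra \<and> (\<forall>ms us. add_edge x y ns zs = State ms us \<longrightarrow> inv_state T N ms us)"
proof -
  define x' where "x' = link (vid x) (vcls x) (cap1 x) (cap0 x) (nbs x) (new_form (nbs x) (fm x) zs) (vid y) (vcls y)"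
  define zs1 where "zs1 = new_zs (nbs x) zs"
  define y' where "y' = link (vid y) (vcls y) (cap1 y) (cap0 y) (nbs y) (new_form (nbs y) (fm y) zs1) (vid x) (vcls x)"
  define zs2 where "zs2 = new_zs (nbs y) zs1"
  define ns1 where "ns1 = repl x' (repl y' ns)"
  have eq: "add_edge x y ns zs = finish False y' (finish True x' (State ns1 zs2))"
    unfolding x'_def y'_def zs1_def zs2_def ns1_def by (rule add_edge_eq)
  have ok: "nodes_ok T N ns" and zs: "set zs \<subseteq> {0}"
    and F: "forms (verts T) N (done_set ns) (touched ns) (length zs)"
    using inv by (auto simp: inv_state_def)
  note dv = vids(1)[OF ok]
  have xv: "vid x \<in> verts T" and yv: "vid y \<in> verts T" using vids(2)[OF ok] x y by auto
  have ne: "vid y \<noteq> vid x" using nut_on_irrefl[OF nut xv] u(1) by auto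
  have eqI: "a = b" if "a \<in> set ns" "b \<in> set ns" "vid a = vid b" for a b
    using dv that by (auto simp: distinct_map inj_on_def)
  have u2: "vid x \<in> N (vid y)" using nut_on_sym[OF nut yv xv] u(1) by simp
  have u3: "vid x \<notin> set (nbs y)"
  proof
    assume "vid x \<in> set (nbs y)"
    then obtain z where "z \<in> set ns" "vid z = vid x" "vid y \<in> set (nbs z)"
      using ok y unfolding nodes_ok_def sym_nodes_def by blast
    then show False using eqI[OF _ x] u(2) by blast
  qed
  have okx: "node_ok T N x" and oky: "node_ok T N y" using ok x y by (auto simp: nodes_ok_def)
  have sel: "vid x' = vid x" "vid y' = vid y" "nbs x' = vid y # nbs x" "nbs y' = vid x # nbs y"
    "fm x' = new_form (nbs x) (fm x) zs" "fm y' = new_form (nbs y) (fm y) zs1"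
    by (simp_all add: x'_def y'_def link_sel)
  have okx': "node_ok T N x'"
    unfolding x'_def by (rule node_ok_link[OF okx u xv]) (use oky in \<open>simp add: node_ok_def\<close>)
  have oky': "node_ok T N y'"
    unfolding y'_def by (rule node_ok_link[OF oky u2 u3 yv]) (use okx in \<open>simp add: node_ok_def\<close>)
  \<comment> \<open>The effect of the two replacements as one pointwise map on the nodes.\<close>
  define h where "h = (\<lambda>z. if vid z = vid x then x' else if vid z = vid y then y' else z)"
  have r1: "repl y' ns = map (\<lambda>z. if vid z = vid y then y' else z) ns"
    using repl_eq[OF dv] sel by simp
  have "map vid (repl y' ns) = map vid ns" unfolding r1 using sel by auto
  then have r2: "ns1 = map (\<lambda>z. if vid z = vid x then x' else z) (repl y' ns)"
    using repl_eq[of "repl y' ns" x'] dv sel unfolding ns1_def by simp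
  have ns1: "ns1 = map h ns"
    unfolding r2 r1 h_def using sel ne by auto
  have hx: "h x = x'" and hy: "h y = y'" using ne by (auto simp: h_def)
  have hvid: "vid (h z) = vid z" for z using sel by (auto simp: h_def)
  have hnbs: "z \<in> set ns \<Longrightarrow> set (nbs z) \<subseteq> set (nbs (h z))" for z
    using eqI[OF _ x, of z] eqI[OF _ y, of z] sel by (auto simp: h_def)
  have hx': "h z = x' \<or> h z = y' \<or> h z = z \<and> vid z \<noteq> vid x \<and> vid z \<noteq> vid y" for z
    by (auto simp: h_def)
  have ok1: "nodes_ok T N ns1"
    unfolding nodes_ok_def
  proof (intro conjI ballI)
    have "map vid ns1 = map vid ns" unfolding ns1 using hvid by simp
    then show "map vid ns1 = map fst T" using ok by (simp add: nodes_ok_def)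
    show "node_ok T N z" if "z \<in> set ns1" for z
      using that okx' oky' ok unfolding ns1 by (auto simp: h_def nodes_ok_def)
    show "sym_nodes ns1"
      unfolding sym_nodes_def
    proof (intro ballI)
      fix z w assume z: "z \<in> set ns1" and w: "w \<in> set (nbs z)"
      then obtain z0 where z0: "z0 \<in> set ns" "z = h z0" unfolding ns1 by auto
      consider "z = x'" "w = vid y" | "z = y'" "w = vid x" | "w \<in> set (nbs z0)"
        using w z0 eqI[OF z0(1) x] eqI[OF z0(1) y] sel by (auto simp: h_def split: if_splits)
      then show "\<exists>y \<in> set ns1. vid y = w \<and> vid z \<in> set (nbs y)"
      proof cases
        case 1
        have "y' \<in> set ns1" unfolding ns1 using y hy by force
        then show ?thesis using 1 sel by auto
      next
        case 2
        have "x' \<in> set ns1" unfolding ns1 using x hx by force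
        then show ?thesis using 2 sel by auto
      next
        case 3
        then obtain z1 where z1: "z1 \<in> set ns" "vid z1 = w" "vid z0 \<in> set (nbs z1)"
          using ok z0(1) unfolding nodes_ok_def sym_nodes_def by blast
        have "vid z \<in> set (nbs (h z1))" using hnbs[of z1] z1 z0(2) hvid by auto
        then show ?thesis unfolding ns1 using z1 hvid by force
      qed
    qed
  qed
  have nfx: "\<not> full x" and nfy: "\<not> full y"
    using not_full[OF ok x u] not_full[OF ok y u2 u3] by auto
  have done_eq: "done_set ns = {vid z | z. z \<in> set ns \<and> full z \<and> vid z \<noteq> vid x \<and> vid z \<noteq> vid y}"
    unfolding done_set_def using eqI[OF _ x] eqI[OF _ y] nfx nfy by blast
  have C: "done_set ns1 = (if full y' then insert (vid y) else id) ((if full x' then insert (vid x) else id) (done_set ns))"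
  proof -
    have "done_set ns1 = {vid (h z) | z. z \<in> set ns \<and> full (h z)}"
      unfolding done_set_def ns1 by auto
    also have "\<dots> = {vid z | z. z \<in> set ns \<and> full (h z)}"
      by (simp only: hvid)
    also have "\<dots> = {vid z | z. z \<in> set ns \<and> full z \<and> vid z \<noteq> vid x \<and> vid z \<noteq> vid y} \<union>
        (if full x' then {vid x} else {}) \<union> (if full y' then {vid y} else {})"
      using x y ne by (auto simp: h_def intro: exI[of _ x] exI[of _ y])
    finally show ?thesis unfolding done_eq by auto
  qed
  have nd: "vid x \<notin> done_set ns" "vid y \<notin> done_set ns" unfolding done_eq by auto
  have t1: "forms (verts T) N (done_set ns) (insert (vid x, fm x') (touched ns)) (length zs1) \<and> set zs1 \<subseteq> {0}"
    unfolding sel zs1_def by (rule forms_touch[OF F zs]) (use x in \<open>auto simp: touched_def\<close>)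
  have t2: "forms (verts T) N (done_set ns) (insert (vid y, fm y') (insert (vid x, fm x') (touched ns))) (length zs2) \<and>
      set zs2 \<subseteq> {0}"
    unfolding sel(6) zs2_def by (rule forms_touch) (use t1 y in \<open>auto simp: touched_def\<close>)
  have "touched ns1 \<subseteq> insert (vid y, fm y') (insert (vid x, fm x') (touched ns))"
    unfolding touched_def ns1 using sel(1,2) by (auto simp: h_def split: if_splits)
  then have F1: "forms (verts T) N (done_set ns) (touched ns1) (length zs2)"
    using t2 forms_mono by blast
  have sub: "done_set ns \<subseteq> done_set ns1" unfolding C by auto
  have x1: "x' \<in> set ns1" and y1: "y' \<in> set ns1" unfolding ns1 using x y hx hy by force+
  \<comment> \<open>The rows eliminated between the two calls of \<open>finish\<close>; the row of
    \<open>y'\<close> can be missing here although \<open>y'\<close> is complete.\<close>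
  define C1 where "C1 = (if full x' then insert (vid x') (done_set ns) else done_set ns)"
  have f1: "finish True x' (State ns1 zs2) \<noteq> Contra \<and> (\<forall>ms us. finish True x' (State ns1 zs2) = State ms us \<longrightarrow>
    map skeleton ms = map skeleton ns1 \<and> set us \<subseteq> {0} \<and> forms (verts T) N C1 (touched ms) (length us))"
    unfolding C1_def
    by (rule finish_sound[OF ok1 _ F1 sub x1]) (use t2 nd sel yv ne in auto)
  show ?thesis
  proof (cases "finish True x' (State ns1 zs2)")
    case (State ms us)
    then have ms: "map skeleton ms = map skeleton ns1" "set us \<subseteq> {0}" "forms (verts T) N C1 (touched ms) (length us)"
      using f1 by auto
    have ok2: "nodes_ok T N ms" by (rule nodes_ok_skeleton[OF ok1 ms(1)])
    have dm: "done_set ms = done_set ns1" by (rule done_set_skeleton[OF ms(1)])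
    have "skeleton y' \<in> set (map skeleton ms)" unfolding ms(1) using y1 by auto
    then obtain y2 where y2: "y2 \<in> set ms" "skeleton y' = skeleton y2" by auto
    have f2: "finish False y' (State ms us) \<noteq> Contra \<and> (\<forall>ms' us'. finish False y' (State ms us) = State ms' us' \<longrightarrow>
      map skeleton ms' = map skeleton ms \<and> set us' \<subseteq> {0} \<and>
      forms (verts T) N (if full y' then insert (vid y') C1 else C1) (touched ms') (length us'))"
      by (rule finish_sound[OF ok2 ms(2,3) _ y2])
        (use nd ne sel in \<open>auto simp: C1_def dm C\<close>)
    have C2: "(if full y' then insert (vid y') C1 else C1) = done_set ns1"
      unfolding C C1_def sel by auto
    show ?thesis
    proof (intro conjI allI impI)
      show "add_edge x y ns zs \<noteq> Contra" unfolding eq State using f2 by blast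
      fix ms' us' assume "add_edge x y ns zs = State ms' us'"
      then have s: "map skeleton ms' = map skeleton ms" "set us' \<subseteq> {0}" "forms (verts T) N (done_set ns1) (touched ms') (length us')"
        using f2 unfolding eq State C2 by auto
      have "nodes_ok T N ms'" by (rule nodes_ok_skeleton[OF ok2 s(1)])
      moreover have "done_set ms' = done_set ns1" using done_set_skeleton[OF s(1)] dm by simp
      ultimately show "inv_state T N ms' us'" using s(2,3) by (simp add: inv_state_def)
    qed
  qed (use f1 in \<open>auto simp: eq\<close>)
qed

end

section \<open>Relabelling of models\<close>

lemma nut_on_cong:
  assumes nut: "nut_on V N" and eq: "\<And>v. v \<in> V \<Longrightarrow> M v = N v"
  shows "nut_on V M"
proof -
  have k: "kernel V M x \<longleftrightarrow> kernel V N x" for x using eq by (simp add: kernel_def)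
  show ?thesis using nut unfolding nut_on_def k by (simp add: eq)
qed

text \<open>For a bijection \<open>p\<close> this is the isomorphic copy of the graph on
  \<open>V\<close>.\<close>

definition pull :: "'a set \<Rightarrow> ('a \<Rightarrow> 'v) \<Rightarrow> ('v \<Rightarrow> 'v set) \<Rightarrow> 'a \<Rightarrow> 'a set" where
  "pull V p N w = {z \<in> V. p z \<in> N (p w)}"

lemma image_pull:
  assumes "bij_betw p V W" "w \<in> V" "N (p w) \<subseteq> W"
  shows "p ` pull V p N w = N (p w)"
  using assms unfolding pull_def bij_betw_def by auto

lemma nut_on_nonempty: "nut_on V N \<Longrightarrow> V \<noteq> {}"
  unfolding nut_on_def by auto

text \<open>On \<open>V\<close>, the kernel vectors of the copy are exactly the compositions of
  kernel vectors of \<open>N\<close> with \<open>p\<close>.\<close>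

lemma nut_on_pull:
  assumes nut: "nut_on W N" and p: "bij_betw p V W"
  shows "nut_on V (pull V p N)"
proof -
  have inj: "inj_on p V" and W: "W = p ` V" using p by (auto simp: bij_betw_def)
  have finV: "finite V" using nut_on_finite[OF nut] inj unfolding W by (simp add: finite_image_iff)
  have sub: "N (p w) \<subseteq> W" if "w \<in> V" for w by (rule nut_on_subset[OF nut]) (use that W in auto)
  have sum_pull: "(\<Sum>u\<in>pull V p N w. x (p u)) = (\<Sum>u\<in>N (p w). x u)" if w: "w \<in> V" for x :: "_ \<Rightarrow> real" and w
  proof -
    have "inj_on p (pull V p N w)" by (rule inj_on_subset[OF inj]) (auto simp: pull_def)
    then show ?thesis
      unfolding image_pull[where N = N, OF p w sub[OF w], symmetric] by (simp add: sum.reindex)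
  qed
  have ker: "kernel V (pull V p N) (x \<circ> p) \<longleftrightarrow> kernel W N x" for x
    unfolding kernel_def W using sum_pull by (simp add: o_def)
  have ext: "\<exists>x'. \<forall>v\<in>V. x v = x' (p v)" for x :: "_ \<Rightarrow> real"
    by (intro exI[of _ "\<lambda>w. x (inv_into V p w)"]) (simp add: inv_into_f_f[OF inj])
  have kercong: "kernel V (pull V p N) x \<longleftrightarrow> kernel V (pull V p N) y" if "\<forall>v\<in>V. x v = y v" for x y
  proof -
    have "(\<Sum>u\<in>pull V p N v. x u) = (\<Sum>u\<in>pull V p N v. y u)" for v
      by (rule sum.cong) (use that in \<open>auto simp: pull_def\<close>)
    then show ?thesis by (simp add: kernel_def)
  qed
  show ?thesis
    unfolding nut_on_def
  proof (intro conjI ballI allI impI)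
    show "finite V" by (rule finV)
    fix v assume v: "v \<in> V"
    show "pull V p N v \<subseteq> V" by (auto simp: pull_def)
    show "v \<notin> pull V p N v" using nut_on_irrefl[OF nut, of "p v"] v W by (auto simp: pull_def)
    fix u assume "u \<in> V" "u \<in> pull V p N v"
    then show "v \<in> pull V p N u" using nut_on_sym[OF nut, of "p u" "p v"] v W by (auto simp: pull_def)
  next
    obtain x where "kernel W N x" "\<And>v. v \<in> W \<Longrightarrow> x v \<noteq> 0" using nut_on_kernel[OF nut] by blast
    moreover have "V \<noteq> {}" using nut_on_nonempty[OF nut] W by blast
    ultimately show "\<exists>x. kernel V (pull V p N) x \<and> (\<exists>v\<in>V. x v \<noteq> 0)"
      using ker[of x] W by (intro exI[of _ "x \<circ> p"]) auto
  next
    fix x v assume x: "kernel V (pull V p N) x \<and> (\<exists>v\<in>V. x v \<noteq> 0)" and v: "v \<in> V"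
    obtain y where y: "\<forall>v\<in>V. x v = y (p v)" using ext by blast
    have "kernel W N y" using x kercong[of x "y \<circ> p"] ker[of y] y by simp
    moreover obtain u where u: "u \<in> V" "x u \<noteq> 0" using x by blast
    ultimately have "y (p v) \<noteq> 0"
      using nut_on_full[OF nut, of y "p u" "p v"] u v y W by auto
    then show "x v \<noteq> 0" using y v by simp
  qed
qed

lemma verts_ones:
  assumes "distinct (map fst T)" "(v, c, k) \<in> set T"
  shows "v \<in> verts T" "v \<in> ones T \<longleftrightarrow> c"
proof -
  show "v \<in> verts T" using assms(2) by (force simp: verts_def)
  have "d = c" if "(v, d, l) \<in> set T" for d l
    using eq_key_imp_eq_value[OF assms(1) assms(2) that] by simp
  then have "c" if "(v, True, l) \<in> set T" for l using that by simp
  then show "v \<in> ones T \<longleftrightarrow> c"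
    using assms(2) unfolding ones_def mem_Collect_eq by (cases c; cases k) auto
qed

lemma in_verts: "v \<in> verts T \<longleftrightarrow> (\<exists>c i j. (v, c, i, j) \<in> set T)"
  by (simp add: verts_def image_iff Bex_def split_paired_Ex)

lemma card_pull:
  assumes p: "bij_betw p V W" and w: "w \<in> V" "N (p w) \<subseteq> W" and S: "S \<subseteq> V"
    and c: "\<And>v. v \<in> V \<Longrightarrow> P v \<longleftrightarrow> Q (p v)"
  shows "card {z \<in> pull V p N w. P z \<and> z \<notin> S} = card {z \<in> N (p w). Q z \<and> z \<notin> p ` S}"
proof (rule bij_betw_same_card[of p], rule bij_betw_imageI)
  have inj: "inj_on p V" using p by (rule bij_betw_imp_inj_on)
  show "inj_on p {z \<in> pull V p N w. P z \<and> z \<notin> S}"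
    by (rule inj_on_subset[OF inj]) (auto simp: pull_def)
  have "z \<in> V \<Longrightarrow> p z \<in> p ` S \<longleftrightarrow> z \<in> S" for z using inj S by (auto simp: inj_on_def)
  then show "p ` {z \<in> pull V p N w. P z \<and> z \<notin> S} = {z \<in> N (p w). Q z \<and> z \<notin> p ` S}"
    unfolding image_pull[where N = N, OF p w, symmetric] using c by (auto simp: pull_def)
qed

lemma model_pull:
  assumes T: "distinct (map fst T)" and nut: "nut_on W N" and p: "bij_betw p (verts T) W"
    and c: "\<And>v c i j. (v, c, i, j) \<in> set T \<Longrightarrow>
      (c \<longleftrightarrow> p v \<in> A) \<and> card (N (p v) \<inter> A) = cval i \<and> card (N (p v) - A) = cval j"
  shows "model T (pull (verts T) p N)"
  unfolding model_def
proof (intro conjI ballI)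
  show "distinct (map fst T)" by (rule T)
  show "nut_on (verts T) (pull (verts T) p N)" by (rule nut_on_pull[OF nut p])
  fix t assume t: "t \<in> set T"
  obtain v c i j where vt: "t = (v, c, i, j)" by (cases t)
  have v: "v \<in> verts T" using t vt by (auto simp: in_verts)
  have sub: "N (p v) \<subseteq> W" by (rule nut_on_subset[OF nut]) (use v p in \<open>auto simp: bij_betw_def\<close>)
  have A: "u \<in> ones T \<longleftrightarrow> p u \<in> A" if u: "u \<in> verts T" for u
  proof -
    obtain c i j where "(u, c, i, j) \<in> set T" using u by (auto simp: in_verts)
    then show ?thesis using c[of u c i j] verts_ones(2)[OF T, of u c "(i, j)"] by simp
  qed
  have 1: "card (pull (verts T) p N v \<inter> ones T) = card (N (p v) \<inter> A)"
    using card_pull[of p "verts T" W v N "{}" "\<lambda>z. z \<in> ones T" "\<lambda>z. z \<in> A", OF p v sub _ A]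
    by (simp add: Int_def)
  have 2: "card (pull (verts T) p N v - ones T) = card (N (p v) - A)"
    using card_pull[of p "verts T" W v N "{}" "\<lambda>z. z \<notin> ones T" "\<lambda>z. z \<notin> A", OF p v sub] A
    by (simp add: set_diff_eq)
  show "case t of (v, c, i, j) \<Rightarrow> card (pull (verts T) p N v \<inter> ones T) = cval i \<and>
      card (pull (verts T) p N v - ones T) = cval j"
    using c[of v c i j] t unfolding vt 1 2 prod.case by blast
qed

definition same_kind :: "'v node \<Rightarrow> 'v node \<Rightarrow> bool" where
  "same_kind x y \<longleftrightarrow> vcls x = vcls y \<and> cap1 x = cap1 y \<and> cap0 x = cap0 y \<and> nbs x = nbs y"

lemma classify_eq: "classify nb c e seen x = (if vcls x = e \<and> room c (cap1 x) (cap0 x) \<and> vid x \<notin> set nb then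
    (if nbs x \<noteq> [] then Some seen else if (vcls x, cap1 x, cap0 x) \<in> set seen then None
     else Some ((vcls x, cap1 x, cap0 x) # seen)) else None)"
proof (cases x)
  case (Node u d k l mb g)
  have "fresh b t s = (if b then None else Some (t # s))" for b t s by (cases b) auto
  then show ?thesis unfolding Node
    by (cases "eqb d e"; cases "room c k l"; cases "u \<in> set nb"; cases mb) simp_all
qed

lemma cands_subset: "y \<in> set (cands nb c e seen ns) \<Longrightarrow>
    y \<in> set ns \<and> vid y \<notin> set nb \<and> vcls y = e \<and> room c (cap1 y) (cap0 y)"
  by (induction ns arbitrary: seen) (auto simp: classify_eq split: option.splits if_splits)

text \<open>A candidate is dropped only if it has no edges and an earlier node of the same kind
  represents it. The statement is used with \<open>seen\<close> empty; the general form carries the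
  induction.\<close>

lemma cands_complete:
  assumes "y \<in> set ns" "vid y \<notin> set nb" "vcls y = e" "room c (cap1 y) (cap0 y)"
  shows "y \<in> set (cands nb c e seen ns) \<or> (nbs y = [] \<and> ((vcls y, cap1 y, cap0 y) \<in> set seen \<or>
     (\<exists>y' \<in> set (cands nb c e seen ns). same_kind y y')))"
  using assms(1)
proof (induction ns arbitrary: seen)
  case (Cons x ns)
  show ?case
  proof (cases "y = x")
    case True
    then show ?thesis using assms by (auto simp: classify_eq)
  next
    case False
    then have y: "y \<in> set ns" using Cons.prems by auto
    show ?thesis
    proof (cases "classify nb c e seen x")
      case None
      then show ?thesis using Cons.IH[OF y, of seen] by auto
    next
      case (Some s)
      then have s: "s = seen \<or> nbs x = [] \<and> s = (vcls x, cap1 x, cap0 x) # seen"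
        by (auto simp: classify_eq split: if_splits)
      show ?thesis using Cons.IH[OF y, of s] Some s by (auto simp: same_kind_def)
    qed
  qed
qed simp

lemma children_eq: "children x e ns = cands (vid x # nbs x) (vcls x) e [] ns"
  by (cases x) simp

definition swap :: "'v \<Rightarrow> 'v \<Rightarrow> 'v \<Rightarrow> 'v" where
  "swap a b = (\<lambda>z. if z = a then b else if z = b then a else z)"

lemma bij_swap: "a \<in> V \<Longrightarrow> b \<in> V \<Longrightarrow> bij_betw (swap a b) V V"
  by (rule bij_betw_byWitness[where f' = "swap a b"]) (auto simp: swap_def)

context modelled
begin

lemma vids_in: "nodes_ok T N ns \<Longrightarrow> z \<in> set ns \<Longrightarrow> vid z \<in> verts T"
  using vids(2)[of ns] by blast

lemma node_ok_nonempty_room: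
  assumes "node_ok T N x" "vid x \<in> verts T"
  shows "room e (cap1 x) (cap0 x) \<longleftrightarrow> (\<exists>u \<in> N (vid x). u \<notin> set (nbs x) \<and> (u \<in> ones T \<longleftrightarrow> e))"
proof -
  note fin = finite_nb[OF assms(2)]
  have 1: "cval (cap1 x) > 0 \<longleftrightarrow> (\<exists>u \<in> N (vid x). u \<notin> set (nbs x) \<and> u \<in> ones T)"
    using assms(1) fin unfolding node_ok_def by (auto simp: card_gt_0_iff)
  have 0: "cval (cap0 x) > 0 \<longleftrightarrow> (\<exists>u \<in> N (vid x). u \<notin> set (nbs x) \<and> u \<notin> ones T)"
    using assms(1) fin unfolding node_ok_def by (auto simp: card_gt_0_iff)
  show ?thesis unfolding cval_room using 0 1 by (cases e) auto
qed

text \<open>Neither \<open>y\<close> nor \<open>y'\<close> lies on a recorded edge, so the swap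
  fixes all recorded edges. The neighbourhood of a complete vertex consists of recorded edges only;
  hence the eliminated rows are unchanged and the same forms are valid in the swapped model.\<close>

lemma fresh_swap:
  assumes inv: "inv_state T N ns zs" and y: "y \<in> set ns" "y' \<in> set ns" "nbs y = []" "same_kind y y'"
  defines "p \<equiv> swap (vid y) (vid y')"
  shows "model T (pull (verts T) p N) \<and> inv_state T (pull (verts T) p N) ns zs"
proof -
  let ?N = "pull (verts T) p N"
  have ok: "nodes_ok T N ns" using inv by (simp add: inv_state_def)
  note dv = vids(1)[OF ok] and vv = vids(2)[OF ok] and vi = vids_in[OF ok]
  have nok: "z \<in> set ns \<Longrightarrow> node_ok T N z" for z using ok by (simp add: nodes_ok_def)
  have bij: "bij_betw p (verts T) (verts T)"
    unfolding p_def by (rule bij_swap) (use y vi in auto)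
  have eqI: "a = b" if "a \<in> set ns" "b \<in> set ns" "vid a = vid b" for a b
    using dv that by (auto simp: distinct_map inj_on_def)
  have ex: "\<exists>z'\<in>set ns. vid z' = p (vid z) \<and> same_kind z z'" if z: "z \<in> set ns" for z
  proof (cases "z = y \<or> z = y'")
    case True
    then show ?thesis using y by (auto simp: p_def swap_def same_kind_def)
  next
    case False
    then have "p (vid z) = vid z" using eqI[OF z] y by (auto simp: p_def swap_def)
    then show ?thesis using z by (auto simp: same_kind_def)
  qed
  have fixn: "p u = u" if z: "z \<in> set ns" and u: "u \<in> set (nbs z)" for z u
  proof -
    obtain w where w: "w \<in> set ns" "vid w = u" "vid z \<in> set (nbs w)"
      using ok z u unfolding nodes_ok_def sym_nodes_def by blast
    then have "w \<noteq> y" "w \<noteq> y'" using y by (auto simp: same_kind_def)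
    then show ?thesis using w(2) eqI[OF w(1)] y by (auto simp: p_def swap_def)
  qed
  have on: "v \<in> ones T \<longleftrightarrow> p v \<in> ones T" if v: "v \<in> verts T" for v
  proof -
    obtain z where z: "z \<in> set ns" "vid z = v" using v unfolding vv[symmetric] by blast
    obtain z' where z': "z' \<in> set ns" "vid z' = p v" "same_kind z z'" using ex[OF z(1)] z(2) by auto
    show ?thesis using nok[OF z(1)] nok[OF z'(1)] z z' by (simp add: node_ok_def same_kind_def)
  qed
  have cards: "cval (cap1 z) = card (?N (vid z) \<inter> ones T - set (nbs z)) \<and>
      cval (cap0 z) = card (?N (vid z) - ones T - set (nbs z)) \<and> set (nbs z) \<subseteq> ?N (vid z)"
    if z: "z \<in> set ns" for z
  proof -
    obtain z' where z': "z' \<in> set ns" "vid z' = p (vid z)" "same_kind z z'" using ex[OF z] by auto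
    have v: "vid z \<in> verts T" "p (vid z) \<in> verts T" using z z'(2) vi[OF z] vi[OF z'(1)] by auto
    have S: "set (nbs z) \<subseteq> verts T"
      using nok[OF z] nut_on_subset[OF nut v(1)] by (auto simp: node_ok_def)
    have pS: "p ` set (nbs z) = set (nbs z)" using fixn[OF z] by auto
    note sub = nut_on_subset[OF nut v(2)]
    have 1: "card (?N (vid z) \<inter> ones T - set (nbs z)) = card (N (p (vid z)) \<inter> ones T - set (nbs z))"
      using card_pull[of p "verts T" "verts T" "vid z" N "set (nbs z)" "\<lambda>z. z \<in> ones T" "\<lambda>z. z \<in> ones T", OF bij v(1) sub S on]
      unfolding pS by (simp add: Int_def set_diff_eq conj_assoc)
    have 0: "card (?N (vid z) - ones T - set (nbs z)) = card (N (p (vid z)) - ones T - set (nbs z))"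
      using card_pull[of p "verts T" "verts T" "vid z" N "set (nbs z)" "\<lambda>z. z \<notin> ones T" "\<lambda>z. z \<notin> ones T", OF bij v(1) sub S] on
      unfolding pS by (simp add: set_diff_eq conj_assoc)
    have "set (nbs z) \<subseteq> N (p (vid z))" using nok[OF z'(1)] z'(2,3) by (simp add: node_ok_def same_kind_def)
    then have "set (nbs z) \<subseteq> ?N (vid z)" using S fixn[OF z] by (auto simp: pull_def)
    then show ?thesis using nok[OF z'(1)] z'(2,3) unfolding 0 1 by (simp add: node_ok_def same_kind_def)
  qed
  have ok': "nodes_ok T ?N ns"
    using ok cards by (auto simp: nodes_ok_def node_ok_def)
  have mod: "model T ?N"
  proof (rule model_pull[OF dist nut bij])
    fix v c i j assume t: "(v, c, i, j) \<in> set T"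
    have v: "v \<in> verts T" and c: "v \<in> ones T \<longleftrightarrow> c" using verts_ones[OF dist t] by auto
    obtain z where z: "z \<in> set ns" "vid z = v" using v unfolding vv[symmetric] by blast
    obtain z' where z': "z' \<in> set ns" "vid z' = p v" "same_kind z z'" using ex[OF z(1)] z(2) by auto
    have t': "card (N v \<inter> ones T) = cval i" "card (N v - ones T) = cval j"
      using model t unfolding model_def by auto
    have fin: "finite (N v)" "finite (N (p v))" using finite_nb v z'(2) vi[OF z'(1)] by auto
    have "card (N (p v) \<inter> ones T) = card (N v \<inter> ones T) \<and> card (N (p v) - ones T) = card (N v - ones T)"
    proof (cases "p v = v")
      case False
      then have "vid z = vid y \<or> vid z = vid y'" using z(2) by (auto simp: p_def swap_def split: if_splits)
      then have "z = y \<or> z = y'" using eqI[OF z(1) y(1)] eqI[OF z(1) y(2)] by blast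
      then have "nbs z = []" "nbs z' = []" using y z'(3) by (auto simp: same_kind_def)
      then show ?thesis using nok[OF z(1)] nok[OF z'(1)] z z' by (simp add: node_ok_def same_kind_def)
    qed simp
    then show "(c \<longleftrightarrow> p v \<in> ones T) \<and> card (N (p v) \<inter> ones T) = cval i \<and> card (N (p v) - ones T) = cval j"
      using t' c on[OF v] by simp
  qed
  interpret m: modelled T ?N by unfold_locales (rule mod)
  have "N u = ?N u" if ud: "u \<in> done_set ns" for u
  proof -
    obtain z where z: "z \<in> set ns" "full z" "vid z = u" using ud by (auto simp: done_set_def)
    show ?thesis using full_nbs[OF ok z(1,2)] m.full_nbs[OF ok' z(1,2)] z(3) by simp
  qed
  then have "forms (verts T) ?N (done_set ns) (touched ns) (length zs)"
    using forms_cong[of "done_set ns" N ?N] inv by (auto simp: inv_state_def)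
  then show ?thesis using mod ok' inv by (simp add: inv_state_def)
qed

text \<open>The true neighbour in the model may have been pruned as a candidate; then it is swapped
  with the retained candidate of its kind. Therefore the model can change along a branch, and only
  the existence of some model is preserved.\<close>

lemma children_sound:
  assumes inv: "inv_state T N ns zs" and x: "x \<in> set ns" and r: "room e (cap1 x) (cap0 x)"
  shows "\<exists>y \<in> set (children x e ns). \<exists>M. model T M \<and> inv_state T M ns zs \<and> y \<in> set ns \<and>
    vid y \<in> M (vid x) \<and> vid y \<notin> set (nbs x)"
proof -
  have ok: "nodes_ok T N ns" using inv by (simp add: inv_state_def)
  note dv = vids(1)[OF ok] and vv = vids(2)[OF ok] and vi = vids_in[OF ok]
  have nok: "z \<in> set ns \<Longrightarrow> node_ok T N z" for z using ok by (simp add: nodes_ok_def)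
  have xv: "vid x \<in> verts T" using x by (rule vi)
  obtain u where u: "u \<in> N (vid x)" "u \<notin> set (nbs x)" "u \<in> ones T \<longleftrightarrow> e"
    using node_ok_nonempty_room[OF nok[OF x] xv, of e] r by blast
  have uv: "u \<in> verts T" using nut_on_subset[OF nut xv] u(1) by auto
  obtain y where y: "y \<in> set ns" "vid y = u" using uv unfolding vv[symmetric] by blast
  have ne: "vid x \<noteq> u" using nut_on_irrefl[OF nut xv] u(1) by auto
  have u2: "vid x \<in> N u" using nut_on_sym[OF nut uv xv] u(1) by simp
  have u3: "vid x \<notin> set (nbs y)"
  proof
    assume "vid x \<in> set (nbs y)"
    then obtain z where "z \<in> set ns" "vid z = vid x" "u \<in> set (nbs z)"
      using ok y unfolding nodes_ok_def sym_nodes_def by blast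
    then show False using dv x u(2) by (auto simp: distinct_map inj_on_def)
  qed
  have cy: "vcls y = e" using nok[OF y(1)] y(2) u(3) by (simp add: node_ok_def)
  have ry: "room (vcls x) (cap1 y) (cap0 y)"
  proof -
    have "vid x \<in> ones T \<longleftrightarrow> vcls x" using nok[OF x] by (simp add: node_ok_def)
    then have "\<exists>u \<in> N (vid y). u \<notin> set (nbs y) \<and> (u \<in> ones T \<longleftrightarrow> vcls x)"
      using u2 u3 unfolding y(2) by blast
    then show ?thesis
      using node_ok_nonempty_room[OF nok[OF y(1)], of "vcls x"] uv y(2) by simp
  qed
  have "vid y \<notin> set (vid x # nbs x)" using ne u(2) y(2) by simp
  from cands_complete[OF y(1) this cy ry, of "[]"] consider "y \<in> set (children x e ns)"
    | y' where "nbs y = []" "y' \<in> set (children x e ns)" "same_kind y y'"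
    unfolding children_eq by auto
  then show ?thesis
  proof cases
    case 1
    show ?thesis by (rule bexI[OF exI[of _ N] 1]) (use inv model u y in simp)
  next
    case 2
    have y': "y' \<in> set ns" "vid y' \<noteq> vid x" "vid y' \<notin> set (nbs x)"
      using cands_subset[OF 2(2)[unfolded children_eq]] by auto
    let ?M = "pull (verts T) (swap (vid y) (vid y')) N"
    have "model T ?M \<and> inv_state T ?M ns zs" by (rule fresh_swap[OF inv y(1) y'(1) 2(1,3)])
    moreover have "vid y' \<in> ?M (vid x)"
      using y' vi[OF y'(1)] vi[OF y(1)] u(1) y(2) ne by (auto simp: pull_def swap_def)
    ultimately show ?thesis by (intro bexI[OF exI[of _ ?M] 2(2)]) (use y' in simp)
  qed
qed

lemma on_children:
  assumes inv: "inv_state T N ns zs" and x: "x \<in> set ns" and r: "room e (cap1 x) (cap0 x)"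
  shows "\<exists>y \<in> set (children x e ns). add_edge x y ns zs \<noteq> Contra \<and>
    (\<forall>ms us. add_edge x y ns zs = State ms us \<longrightarrow> (\<exists>M. model T M \<and> inv_state T M ms us))"
proof -
  obtain y M where y: "y \<in> set (children x e ns)" "model T M" "inv_state T M ns zs" "y \<in> set ns"
    "vid y \<in> M (vid x)" "vid y \<notin> set (nbs x)"
    using children_sound[OF assms] by blast
  interpret m: modelled T M by unfold_locales (rule y(2))
  have "add_edge x y ns zs \<noteq> Contra \<and> (\<forall>ms us. add_edge x y ns zs = State ms us \<longrightarrow> inv_state T M ms us)"
    by (rule m.add_edge_sound[OF y(3) x y(4,5,6)])
  then show ?thesis by (intro bexI[OF _ y(1)]) (use y(2) in auto)
qed

end

section \<open>Soundness of searches and certificates\<close>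

lemma every_iff: "every Q ns zs x ys \<longleftrightarrow> (\<forall>y \<in> set ys. on_result Q (add_edge x y ns zs))"
  by (induction ys) auto

lemma pick1_Cons: "pick1 (x # ns) = (if cap1 x = C0 \<or> nbs x = [] then pick1 ns else Some (x, True))"
  by (cases x; cases "cap1 x"; cases "nbs x") simp_all
lemma pick2_Cons: "pick2 (x # ns) = (if \<not> vcls x \<or> cap0 x = C0 \<or> nbs x = [] then pick2 ns else Some (x, False))"
  by (cases x; cases "vcls x"; cases "cap0 x"; cases "nbs x") simp_all
lemma pick3_Cons: "pick3 (x # ns) = (if \<not> vcls x \<or> full x then pick3 ns else Some (x, cap1 x \<noteq> C0))"
  by (cases x; cases "vcls x"; cases "cap1 x"; cases "cap0 x") (simp_all add: full_def)
lemma pick4_Cons: "pick4 (x # ns) = (if cap0 x = C1 \<and> nbs x \<noteq> [] then Some (x, False) else pick4 ns)"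
  by (cases x; cases "cap0 x"; cases "nbs x") simp_all
lemma pick5_Cons: "pick5 (x # ns) = (if cap0 x = C0 \<or> nbs x = [] then pick5 ns else Some (x, False))"
  by (cases x; cases "cap0 x"; cases "nbs x") simp_all
lemma pick6_Cons: "pick6 (x # ns) = (if full x then pick6 ns else Some (x, cap1 x \<noteq> C0))"
  by (cases x; cases "cap1 x"; cases "cap0 x") (simp_all add: full_def)

lemma room_iff: "room e i j \<longleftrightarrow> (if e then i else j) \<noteq> C0"
  unfolding cval_room by (cases e; cases i; cases j) auto

lemma pick_sound:
  assumes "pick ns = Some (x, e)" shows "x \<in> set ns" "room e (cap1 x) (cap0 x)"
proof -
  have orelse: "orelse a b = Some r \<Longrightarrow> a = Some r \<or> b = Some r" for a b :: "'b option" and r by (cases a) auto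
  have "\<forall>x e. pick1 ns = Some (x, e) \<longrightarrow> x \<in> set ns \<and> room e (cap1 x) (cap0 x)"
    by (induction ns) (simp_all add: pick1_Cons room_iff)
  moreover have "\<forall>x e. pick2 ns = Some (x, e) \<longrightarrow> x \<in> set ns \<and> room e (cap1 x) (cap0 x)"
    by (induction ns) (simp_all add: pick2_Cons room_iff)
  moreover have "\<forall>x e. pick3 ns = Some (x, e) \<longrightarrow> x \<in> set ns \<and> room e (cap1 x) (cap0 x)"
    by (induction ns) (auto simp: pick3_Cons room_iff full_def)
  moreover have "\<forall>x e. pick4 ns = Some (x, e) \<longrightarrow> x \<in> set ns \<and> room e (cap1 x) (cap0 x)"
    by (induction ns) (auto simp: pick4_Cons room_iff)
  moreover have "\<forall>x e. pick5 ns = Some (x, e) \<longrightarrow> x \<in> set ns \<and> room e (cap1 x) (cap0 x)"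
    by (induction ns) (simp_all add: pick5_Cons room_iff)
  moreover have "\<forall>x e. pick6 ns = Some (x, e) \<longrightarrow> x \<in> set ns \<and> room e (cap1 x) (cap0 x)"
    by (induction ns) (auto simp: pick6_Cons room_iff full_def)
  ultimately show "x \<in> set ns" "room e (cap1 x) (cap0 x)"
    using assms unfolding pick_def by (auto dest!: orelse)
qed

lemma search_sound: "sound T (search k)"
proof (induction k)
  case (Go k)
  show ?case
    unfolding sound_def
  proof (intro allI impI notI)
    fix N ns zs
    assume s: "search (Go k) ns zs" and m: "model T N" and inv: "inv_state T N ns zs"
    interpret modelled T N by unfold_locales (rule m)
    obtain x e where p: "pick ns = Some (x, e)" using s by (cases "pick ns") auto
    have ev: "every (search k) ns zs x (children x e ns)" using s p by simp
    obtain y where y: "y \<in> set (children x e ns)" "add_edge x y ns zs \<noteq> Contra"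
      "\<And>ms us. add_edge x y ns zs = State ms us \<Longrightarrow> \<exists>M. model T M \<and> inv_state T M ms us"
      using on_children[OF inv pick_sound[OF p]] by blast
    have "on_result (search k) (add_edge x y ns zs)" using ev y(1) unfolding every_iff by blast
    then show False
      using y(2,3) Go by (cases "add_edge x y ns zs") (auto simp: sound_def)
  qed
qed (simp add: sound_def)

lemma every2_sound:
  "every2 Qs ns zs x ys \<Longrightarrow> y \<in> set ys \<Longrightarrow> add_edge x y ns zs = Contra \<or>
    (\<exists>Q \<in> set Qs. \<exists>ms us. add_edge x y ns zs = State ms us \<and> Q ms us)"
proof (induction ys arbitrary: Qs)
  case (Cons z ys)
  show ?case
  proof (cases "add_edge x z ns zs")
    case Contra
    then show ?thesis using Cons by auto
  next
    case Stuck
    then show ?thesis using Cons.prems by auto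
  next
    case (State ms us)
    then obtain Q Qs' where Q: "Qs = Q # Qs'" "Q ms us" "every2 Qs' ns zs x ys"
      using Cons.prems by (cases Qs) auto
    show ?thesis using Cons.IH[OF Q(3)] Cons.prems(2) Q State by auto
  qed
qed simp

lemma split_sound:
  assumes "\<And>Q. Q \<in> set Qs \<Longrightarrow> sound T Q"
  shows "sound T (\<lambda>ns zs. split Qs ns zs (get v ns) e)"
  unfolding sound_def
proof (intro allI impI notI)
  fix N ns zs
  assume s: "split Qs ns zs (get v ns) e" and m: "model T N" and inv: "inv_state T N ns zs"
  interpret modelled T N by unfold_locales (rule m)
  obtain x where x: "get v ns = Some x" using s by (cases "get v ns") auto
  have r: "room e (cap1 x) (cap0 x)" and ev: "every2 Qs ns zs x (children x e ns)"
    using s unfolding x by (cases x, auto)+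
  have xs: "x \<in> set ns" using get_SomeD[OF x] by blast
  obtain y where y: "y \<in> set (children x e ns)" "add_edge x y ns zs \<noteq> Contra"
    "\<And>ms us. add_edge x y ns zs = State ms us \<Longrightarrow> \<exists>M. model T M \<and> inv_state T M ms us"
    using on_children[OF inv xs r] by blast
  from every2_sound[OF ev y(1)] y(2,3) assms show False
    unfolding sound_def by blast
qed

text \<open>The first argument \<open>U\<close> stays fixed while the recursion shortens
  \<open>ts\<close>; both are the full type list in the application.\<close>

lemma preserves_image:
  assumes "preserves U ts ws" "distinct (map fst ts)" "distinct ws"
  shows "inj_on (image (map fst ts) ws) (fst ` set ts) \<and> image (map fst ts) ws ` (fst ` set ts) = set ws \<and>
    (\<forall>(v, k) \<in> set ts. (image (map fst ts) ws v, k) \<in> set U)"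
  using assms
proof (induction U ts ws rule: preserves.induct)
  case (2 U v k ts w ws)
  let ?f = "image (map fst ts) ws"
  have IH: "inj_on ?f (fst ` set ts)" "?f ` (fst ` set ts) = set ws" "\<forall>(v, k) \<in> set ts. (?f v, k) \<in> set U"
    using 2 by auto
  define g where "g = image (v # map fst ts) (w # ws)"
  have v: "v \<notin> fst ` set ts" and w: "w \<notin> set ws" and wU: "(w, k) \<in> set U" using 2 by auto
  have gv: "g v = w" by (simp add: g_def)
  have g: "g u = ?f u" if "u \<in> fst ` set ts" for u using that v by (auto simp: g_def)
  have im: "g ` (fst ` set ts) = set ws"
    unfolding IH(2)[symmetric] by (rule image_cong[OF refl g])
  have inj: "inj_on g (fst ` set ts)"
    using IH(1) inj_on_cong[of "fst ` set ts" g ?f] g by blast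
  have "\<forall>(u, l) \<in> set ts. (g u, l) \<in> set U"
    using IH(3) g by force
  then show ?case
    unfolding list.map fst_conv g_def[symmetric] using inj im w wU v gv by auto
qed auto

lemma embeds_iff: "embeds vs ws ns es \<longleftrightarrow>
    (\<forall>(a, b) \<in> set es. has_edge (image vs ws b) (get (image vs ws a) ns))"
  by (induction vs ws ns es rule: embeds.induct) auto

lemma embeds_any_iff: "embeds_any vs ws ns rs \<longleftrightarrow> (\<exists>es \<in> set rs. embeds vs ws ns es)"
  by (induction rs) auto

lemma image_notin: "u \<notin> set vs \<Longrightarrow> image vs ws u = u"
  by (induction vs ws u rule: image.induct) auto

lemma distinct_list_iff [simp]: "distinct_list xs \<longleftrightarrow> distinct xs"
  by (induction xs) auto

lemma has_edge_iff: "has_edge u r \<longleftrightarrow> (\<exists>x. r = Some x \<and> u \<in> set (nbs x))"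
  by (cases "(u, r)" rule: has_edge.cases) auto

text \<open>If the state contains the image of a refuted edge list under \<open>p\<close>, then
  pulling the model back along \<open>p\<close> gives a model of the same types that contains the
  edge list itself.\<close>

lemma ref_sound:
  assumes "\<And>r. r \<in> set rs \<Longrightarrow> refuted T r"
  shows "sound T (cover T rs (Ref ws))"
  unfolding sound_def
proof (intro allI impI notI)
  fix N ns zs
  assume s: "cover T rs (Ref ws) ns zs" and m: "model T N" and inv: "inv_state T N ns zs"
  interpret modelled T N by unfold_locales (rule m)
  define p where "p = image (map fst T) ws"
  obtain es where es: "es \<in> set rs" "embeds (map fst T) ws ns es" and pr: "preserves T T ws" "distinct ws"
    using s by (auto simp: embeds_any_iff)
  have ok: "nodes_ok T N ns" using inv by (simp add: inv_state_def)
  note dv = vids(1)[OF ok] and vv = vids(2)[OF ok] and vi = vids_in[OF ok]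
  note pi = preserves_image[OF pr(1) dist pr(2), folded p_def verts_def]
  have p: "inj_on p (verts T)" using pi by blast
  have pT: "(p v, k) \<in> set T" if "(v, k) \<in> set T" for v k using pi that by blast
  have "p ` verts T \<subseteq> verts T"
  proof
    fix w assume "w \<in> p ` verts T"
    then obtain v c i j where "w = p v" "(v, c, i, j) \<in> set T" by (auto simp: in_verts)
    then have "(w, c, i, j) \<in> set T" using pT by simp
    then show "w \<in> verts T" by (auto simp: in_verts)
  qed
  then have "p ` verts T = verts T"
    using endo_inj_surj[OF nut_on_finite[OF nut] _ p] by blast
  then have bij: "bij_betw p (verts T) (verts T)" using p by (simp add: bij_betw_def)
  have mod: "model T (pull (verts T) p N)"
  proof (rule model_pull[OF dist nut bij, of "ones T"])
    fix v c i j assume "(v, c, i, j) \<in> set T"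
    then have t: "(p v, c, i, j) \<in> set T" by (rule pT)
    then show "(c \<longleftrightarrow> p v \<in> ones T) \<and> card (N (p v) \<inter> ones T) = cval i \<and> card (N (p v) - ones T) = cval j"
      using model verts_ones(2)[OF dist t] unfolding model_def by auto
  qed
  have "b \<in> pull (verts T) p N a" if ab: "(a, b) \<in> set es" for a b
  proof -
    obtain x where x: "get (p a) ns = Some x" "p b \<in> set (nbs x)"
      using es(2) ab unfolding embeds_iff has_edge_iff p_def by blast
    have xs: "x \<in> set ns" "vid x = p a" using get_SomeD[OF x(1)] by auto
    have pb: "p b \<in> N (p a)" using ok xs(1) x(2) unfolding nodes_ok_def node_ok_def xs(2)[symmetric] by blast
    have "p a \<in> verts T" using xs(2) vi[OF xs(1)] by simp
    then have "p b \<in> verts T" using pb nut_on_subset[OF nut] by blast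
    \<comment> \<open>\<open>image\<close> fixes every label outside \<open>T\<close>; so a label
      \<open>b\<close> outside would give \<open>p b = b\<close> outside as well.\<close>
    then have "b \<in> verts T"
      using image_notin[of b "map fst T" ws] by (cases "b \<in> verts T") (simp_all add: p_def verts_def)
    then show ?thesis using pb by (simp add: pull_def)
  qed
  then show False using assms[OF es(1)] mod unfolding refuted_def by blast
qed

lemma cover_sound:
  assumes "\<And>r. r \<in> set rs \<Longrightarrow> refuted T r"
  shows "sound T (cover T rs c)"
proof (induction c)
  case Search
  then show ?case by (simp add: search_sound)
next
  case (Ref ws)
  then show ?case using assms by (rule ref_sound)
next
  case (Split v e cs)
  have "sound T (\<lambda>ns zs. split (map (cover T rs) cs) ns zs (get v ns) e)"
    by (rule split_sound) (use Split in auto)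
  then show ?case by simp
qed

lemma (in modelled) add_pair_sound:
  assumes inv: "inv_state T N ns zs" and e: "b \<in> N a"
  shows "add_pair (get a ns) (get b ns) ns zs \<noteq> Contra \<and>
    (\<forall>ms us. add_pair (get a ns) (get b ns) ns zs = State ms us \<longrightarrow> inv_state T N ms us)"
proof (cases "get a ns")
  case None
  then show ?thesis by simp
next
  case (Some x)
  note x = this
  show ?thesis
  proof (cases "get b ns")
    case None
    then show ?thesis using x by simp
  next
    case (Some y)
    have xs: "x \<in> set ns" "vid x = a" and ys: "y \<in> set ns" "vid y = b"
      using get_SomeD[OF x] get_SomeD[OF Some] by auto
    have "add_pair (get a ns) (get b ns) ns zs = guard (has_edge b (Some x)) (add_edge x y ns zs)"
      unfolding x Some using ys(2) by (cases y) simp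
    moreover have "add_edge x y ns zs \<noteq> Contra \<and>
      (\<forall>ms us. add_edge x y ns zs = State ms us \<longrightarrow> inv_state T N ms us)" if "b \<notin> set (nbs x)"
      by (rule add_edge_sound[OF inv xs(1) ys(1)]) (use e that xs ys in auto)
    ultimately show ?thesis
      by (cases "b \<in> set (nbs x)") (auto simp: has_edge_iff)
  qed
qed

lemma (in modelled) build_sound:
  assumes "\<forall>(a, b) \<in> set es. b \<in> N a" "r \<noteq> Contra" "\<forall>ns zs. r = State ns zs \<longrightarrow> inv_state T N ns zs"
  shows "build es r \<noteq> Contra \<and> (\<forall>ns zs. build es r = State ns zs \<longrightarrow> inv_state T N ns zs)"
  using assms
proof (induction es r rule: build.induct)
  case (4 a b es ns zs)
  have b: "b \<in> N a" and inv: "inv_state T N ns zs" using 4(2,4) by simp_all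
  have es: "\<forall>(a, b) \<in> set es. b \<in> N a" using 4(2) by simp
  note ap = add_pair_sound[OF inv b]
  show ?case
    unfolding build.simps by (rule 4(1)[OF es conjunct1[OF ap] conjunct2[OF ap]])
qed simp_all

lemma (in modelled) inv_init: "inv_state T N (map init_node T) []"
proof -
  have [simp]: "vid (init_node t) = fst t" "nbs (init_node t) = []" for t by (cases t; simp)+
  have "node_ok T N (init_node t)" if t: "t \<in> set T" for t
  proof -
    obtain v c i j where vt: "t = (v, c, i, j)" by (cases t)
    show ?thesis using model verts_ones(2)[OF dist] t unfolding vt model_def by (auto simp: node_ok_def)
  qed
  then show ?thesis
    by (auto simp: inv_state_def nodes_ok_def sym_nodes_def touched_def forms_def)
qed

text \<open>Replaying the edges keeps the invariant in every model that contains them, so a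
  contradiction met while building is already a refutation.\<close>

theorem check_sound:
  assumes "check T rs c es" "\<forall>r \<in> set rs. refuted T r"
  shows "refuted T es"
  unfolding refuted_def
proof
  assume "\<exists>N. model T N \<and> (\<forall>(a, b) \<in> set es. b \<in> N a)"
  then obtain N where N: "model T N" "\<forall>(a, b) \<in> set es. b \<in> N a" by blast
  interpret modelled T N by unfold_locales (rule N(1))
  let ?r = "build es (State (map init_node T) [])"
  have r: "?r \<noteq> Contra \<and> (\<forall>ns zs. ?r = State ns zs \<longrightarrow> inv_state T N ns zs)"
    by (rule build_sound[OF N(2)]) (use inv_init in auto)
  moreover have "on_result (cover T rs c) ?r" using assms(1) by (simp add: check_def)
  moreover have "sound T (cover T rs c)" by (rule cover_sound) (use assms(2) in blast)
  ultimately show False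
    using N(1) by (cases ?r) (auto simp: sound_def)
qed

subsection \<open>Parity classes\<close>

text \<open>With the sets O and A of the overview, \<open>a\<close>, \<open>b\<close>,
  \<open>c\<close>, \<open>d\<close> are the sizes of O \<inter> A, O - A, A - O and the remainder;
  the labels start with A - O. A vertex in A has two neighbours in O and one outside, any other
  vertex has three outside.\<close>

definition types :: "nat \<Rightarrow> nat \<Rightarrow> nat \<Rightarrow> nat \<Rightarrow> vx type_list" where
  "types a b c d = zip [A0, A1, A2, A3, A4, A5, A6, A7, A8, A9, B0, B1, B2, B3, B4, B5]
     (replicate c (False, C2, C1) @ replicate a (True, C2, C1) @ replicate b (True, C0, C3) @ replicate d (False, C0, C3))"

text \<open>Off-diagonal terms come in equal pairs and the diagonal is even.\<close>

lemma even_symmetric_sum: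
  fixes f :: "'a \<Rightarrow> 'a \<Rightarrow> int"
  assumes "finite V" "\<And>u v. u \<in> V \<Longrightarrow> v \<in> V \<Longrightarrow> f u v = f v u" "\<And>v. v \<in> V \<Longrightarrow> even (f v v)"
  shows "even (\<Sum>u\<in>V. \<Sum>v\<in>V. f u v)"
  using assms
proof (induction V)
  case (insert w V)
  have "(\<Sum>u\<in>V. f u w) = (\<Sum>v\<in>V. f w v)" by (rule sum.cong) (use insert.prems in auto)
  then have "(\<Sum>u\<in>insert w V. \<Sum>v\<in>insert w V. f u v) = f w w + 2 * (\<Sum>v\<in>V. f w v) + (\<Sum>u\<in>V. \<Sum>v\<in>V. f u v)"
    using insert.hyps by (simp add: sum.distrib)
  moreover have "even (\<Sum>u\<in>V. \<Sum>v\<in>V. f u v)" by (rule insert.IH) (use insert.prems in auto)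
  ultimately show ?case using insert.prems by simp
qed simp

lemma even_quadratic_form:
  fixes w :: "'a \<Rightarrow> int"
  assumes "nut_on V N"
  shows "even (\<Sum>u\<in>V. \<Sum>v\<in>V. w u * (of_bool (v \<in> N u) * w v))"
  using nut_on_finite[OF assms] nut_on_sym[OF assms] nut_on_irrefl[OF assms]
  by (intro even_symmetric_sum) auto

lemma sum_neighbours:
  fixes w :: "'a \<Rightarrow> 'b :: comm_semiring_1"
  assumes "nut_on V N" "u \<in> V"
  shows "(\<Sum>v\<in>V. of_bool (v \<in> N u) * w v) = (\<Sum>v\<in>N u. w v)"
proof -
  have "(\<Sum>v\<in>V. of_bool (v \<in> N u) * w v) = (\<Sum>v\<in>V \<inter> N u. w v)"
    unfolding sum.inter_restrict[OF nut_on_finite[OF assms(1)]] by (rule sum.cong) simp_all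
  then show ?thesis using nut_on_subset[OF assms] by (simp add: Int_absorb1)
qed

text \<open>At the all-one vector the quadratic form is 3 times the order.\<close>

lemma even_order:
  assumes nut: "nut_on V N" and cubic: "\<And>v. v \<in> V \<Longrightarrow> card (N v) = 3"
  shows "even (card V)"
proof -
  have "(\<Sum>u\<in>V. \<Sum>v\<in>V. 1 * (of_bool (v \<in> N u) * (1::int))) = (\<Sum>u\<in>V. 3)"
  proof (rule sum.cong[OF refl])
    fix u assume u: "u \<in> V"
    then show "(\<Sum>v\<in>V. 1 * (of_bool (v \<in> N u) * (1::int))) = 3"
      using sum_neighbours[OF nut u, of "\<lambda>_. 1 :: int"] cubic by simp
  qed
  then show ?thesis using even_quadratic_form[OF nut, of "\<lambda>_. 1"] by simp
qed

text \<open>Descent: as long as all entries on \<open>V\<close> are even, halve them; the sum of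
  their absolute values decreases.\<close>

lemma primitive_kernel:
  fixes x :: "'a \<Rightarrow> int"
  assumes "finite V" "\<forall>v\<in>V. (\<Sum>u\<in>N v. x u) = 0" "\<forall>v\<in>V. N v \<subseteq> V" "\<exists>v\<in>V. x v \<noteq> 0"
  shows "\<exists>x :: 'a \<Rightarrow> int. (\<forall>v\<in>V. (\<Sum>u\<in>N v. x u) = 0) \<and> (\<exists>v\<in>V. odd (x v))"
  using assms(2,4)
proof (induction "\<Sum>v\<in>V. nat \<bar>x v\<bar>" arbitrary: x rule: less_induct)
  case less
  show ?case
  proof (cases "\<exists>v\<in>V. odd (x v)")
    case True
    then show ?thesis using less.prems by blast
  next
    case False
    define y where "y v = x v div 2" for v
    have xy: "x v = 2 * y v" if "v \<in> V" for v using False that by (auto simp: y_def)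
    have y0: "(\<Sum>u\<in>N v. y u) = 0" if v: "v \<in> V" for v
    proof -
      have "(\<Sum>u\<in>N v. x u) = (\<Sum>u\<in>N v. 2 * y u)" by (rule sum.cong) (use xy v assms(3) in auto)
      then have "2 * (\<Sum>u\<in>N v. y u) = 0" using less.prems(1) v by (simp add: sum_distrib_left)
      then show ?thesis by simp
    qed
    obtain v where v: "v \<in> V" "x v \<noteq> 0" using less.prems(2) by blast
    then have y1: "y v \<noteq> 0" using xy by auto
    have "(\<Sum>v\<in>V. nat \<bar>y v\<bar>) < (\<Sum>v\<in>V. nat \<bar>x v\<bar>)"
      by (rule sum_strict_mono_ex1[OF assms(1)]) (use xy v y1 in \<open>auto simp: abs_mult intro!: bexI[of _ v]\<close>)
    from less.hyps[OF this] y0 y1 v(1) show ?thesis by blast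
  qed
qed

text \<open>Naming the vertices in the order of \<open>L\<close> by the first labels of
  \<open>vs\<close> turns a concrete graph into a model.\<close>

lemma refuted_zip:
  assumes nut: "nut_on (set L) N" and L: "distinct L" and vs: "distinct vs" "length L \<le> length vs"
    and ks: "length ks = length L"
    and kinds: "\<And>v c i j. (v, c, i, j) \<in> set (zip L ks) \<Longrightarrow>
      (c \<longleftrightarrow> v \<in> A) \<and> card (N v \<inter> A) = cval i \<and> card (N v - A) = cval j"
  shows "\<not> refuted (zip vs ks) []"
proof -
  define ws where "ws = take (length L) vs"
  have ws: "distinct ws" "length ws = length L" using vs by (simp_all add: ws_def)
  have T: "zip vs ks = zip ws ks" by (rule nth_equalityI) (use vs ks in \<open>auto simp: ws_def\<close>)
  define p where "p v = the (map_of (zip ws L) v)" for v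
  have p: "p (ws ! i) = L ! i" if "i < length L" for i
    using map_of_zip_nth[of ws L i] ws that by (simp add: p_def)
  have fst: "map fst (zip ws ks) = ws" using ws ks by simp
  have verts: "verts (zip ws ks) = set ws" using arg_cong[OF fst, of set] by (simp add: verts_def)
  have mp: "map p ws = L" by (rule nth_equalityI) (use ws p in auto)
  have "inj_on p (set ws)" using L ws mp by (metis distinct_map)
  moreover have "p ` set ws = set L" using mp by (metis set_map)
  ultimately have bij: "bij_betw p (verts (zip ws ks)) (set L)" unfolding verts by (simp add: bij_betw_def)
  have "model (zip ws ks) (pull (verts (zip ws ks)) p N)"
  proof (rule model_pull[OF _ nut bij, of A])
    show "distinct (map fst (zip ws ks))" unfolding fst by (rule ws)
    fix v c i j assume "(v, c, i, j) \<in> set (zip ws ks)"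
    then obtain m where m: "m < length ws" "v = ws ! m" "(c, i, j) = ks ! m" "m < length ks" by (auto simp: set_zip)
    then have "(p v, c, i, j) \<in> set (zip L ks)" using p ws by (auto simp: set_zip)
    then show "(c \<longleftrightarrow> p v \<in> A) \<and> card (N (p v) \<inter> A) = cval i \<and> card (N (p v) - A) = cval j" by (rule kinds)
  qed
  then show ?thesis unfolding T refuted_def by auto
qed

text \<open>In this lemma and the next, \<open>A\<close> is the odd support and \<open>B\<close> the
  set of vertices with an odd neighbour, so they are O and A of the overview. A zero sum over three
  neighbours has 0 or 2 odd terms; the second claim counts the arcs between \<open>A\<close> and
  \<open>B\<close> from both ends.\<close>

lemma class_counts:
  fixes x :: "'a \<Rightarrow> int"
  assumes nut: "nut_on V N" and cubic: "\<And>v. v \<in> V \<Longrightarrow> card (N v) = 3"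
    and ker: "\<forall>v\<in>V. (\<Sum>u\<in>N v. x u) = 0" and odd: "\<exists>v\<in>V. odd (x v)"
  defines "A \<equiv> {v \<in> V. odd (x v)}"
  defines "B \<equiv> {v \<in> V. N v \<inter> A \<noteq> {}}"
  shows "\<And>v. v \<in> V \<Longrightarrow> card (N v \<inter> A) = (if v \<in> B then 2 else 0)"
    and "3 * card A = 2 * card B" "A \<noteq> {}" "4 dvd card (A \<inter> B)"
proof -
  note fin = nut_on_finite[OF nut]
  have finA: "finite A" using fin by (simp add: A_def)
  have finN: "finite (N v)" if "v \<in> V" for v using nut_on_subset[OF nut that] fin by (rule finite_subset)
  show 1: "card (N v \<inter> A) = (if v \<in> B then 2 else 0)" if v: "v \<in> V" for v
  proof -
    have "{u \<in> N v. odd (x u)} = N v \<inter> A" using nut_on_subset[OF nut v] by (auto simp: A_def)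
    moreover have "even (card {u \<in> N v. odd (x u)})"
      using even_sum_iff[OF finN[OF v], of x] ker v by simp
    moreover have "card (N v \<inter> A) \<le> 3" using card_mono[OF finN[OF v], of "N v \<inter> A"] cubic[OF v] by simp
    moreover have "card (N v \<inter> A) = 0 \<longleftrightarrow> N v \<inter> A = {}" using finN[OF v] by simp
    moreover have "even m \<Longrightarrow> m \<le> 3 \<Longrightarrow> m = 0 \<or> m = 2" for m :: nat by presburger
    ultimately show ?thesis using v by (auto simp: B_def)
  qed
  show "A \<noteq> {}" using odd by (auto simp: A_def)
  have deg: "(\<Sum>u\<in>A. of_bool (u \<in> N v)) = card (N v \<inter> A)" for v
    using finA by (simp add: Int_commute Int_def)
  have "3 * card A = (\<Sum>u\<in>A. card (N u \<inter> V))"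
    using cubic nut_on_subset[OF nut] by (simp add: A_def Int_absorb2)
  also have "\<dots> = (\<Sum>u\<in>A. \<Sum>v\<in>V. of_bool (v \<in> N u))"
    using fin by (simp add: Int_commute Int_def)
  also have "\<dots> = (\<Sum>v\<in>V. \<Sum>u\<in>A. of_bool (v \<in> N u))" by (rule sum.swap)
  also have "\<dots> = (\<Sum>v\<in>V. \<Sum>u\<in>A. of_bool (u \<in> N v))"
    by (intro sum.cong refl) (use nut_on_sym[OF nut] in \<open>auto simp: A_def\<close>)
  also have "\<dots> = (\<Sum>v\<in>V. if v \<in> B then 2 else 0)" unfolding deg by (rule sum.cong) (use 1 in auto)
  also have "\<dots> = 2 * card B"
    using fin by (simp add: sum.If_cases B_def Int_def)
  finally show "3 * card A = 2 * card B" .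
  \<comment> \<open>Splitting x into its residue z modulo 2 and twice its half w.\<close>
  define z :: "'a \<Rightarrow> int" where "z v = of_bool (odd (x v))" for v
  define w where "w v = x v div 2" for v
  have xz: "z v = x v - 2 * w v" for v
    by (cases "odd (x v)") (auto simp: z_def w_def odd_two_times_div_two_succ[symmetric] elim: oddE)
  let ?q = "\<lambda>f g :: 'a \<Rightarrow> int. \<Sum>u\<in>V. f u * (\<Sum>v\<in>N u. g v)"
  have q: "?q f g = (\<Sum>u\<in>V. \<Sum>v\<in>V. f u * (of_bool (v \<in> N u) * g v))" for f g
    unfolding sum_distrib_left[symmetric] by (rule sum.cong[OF refl]) (simp only: sum_neighbours[OF nut])
  have qx: "?q f x = 0" for f using ker by simp
  have "?q x w = ?q w x"
    unfolding q by (subst sum.swap) (intro sum.cong refl, use nut_on_sym[OF nut] in \<open>auto simp: mult_ac\<close>)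
  then have "(\<Sum>u\<in>V. x u * (2 * (\<Sum>v\<in>N u. w v))) = 0"
    using qx[of w] sum_distrib_left[of 2 "\<lambda>u. x u * (\<Sum>v\<in>N u. w v)" V] by (simp add: mult.left_commute)
  \<comment> \<open>After z = x - 2w is expanded, the mixed terms vanish: one has x on the right,
    the other equals such a term by symmetry.\<close>
  then have "?q z z = 4 * ?q w w"
    unfolding xz using qx[of x] qx[of w]
    by (simp add: left_diff_distrib sum_subtractf sum_distrib_left[symmetric] right_diff_distrib mult.assoc)
  moreover have "even (?q w w)" unfolding q by (rule even_quadratic_form[OF nut])
  ultimately have "8 dvd ?q z z" by auto
  \<comment> \<open>A vertex of \<open>A\<close> contributes its number of neighbours in
    \<open>A\<close>, which is 2 in \<open>B\<close> and 0 elsewhere.\<close>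
  moreover have "?q z z = 2 * int (card (A \<inter> B))"
  proof -
    have "?q z z = (\<Sum>u\<in>V. if u \<in> A \<inter> B then 2 else 0)"
    proof (rule sum.cong[OF refl])
      fix u assume u: "u \<in> V"
      have "(\<Sum>v\<in>N u. z v) = int (card (N u \<inter> A))"
        using nut_on_subset[OF nut u] finN[OF u] by (auto simp: z_def A_def Int_def intro!: arg_cong[of _ _ card])
      then show "z u * (\<Sum>v\<in>N u. z v) = (if u \<in> A \<inter> B then 2 else 0)"
        using 1[OF u] u by (auto simp: z_def A_def)
    qed
    also have "\<dots> = 2 * int (card (V \<inter> (A \<inter> B)))" using fin by (simp add: sum.If_cases Int_def)
    also have "V \<inter> (A \<inter> B) = A \<inter> B" by (auto simp: A_def)
    finally show ?thesis .
  qed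
  ultimately show "4 dvd card (A \<inter> B)" by presburger
qed

lemma zip_rep: "(v, t) \<in> set (zip l (replicate m s)) \<Longrightarrow> v \<in> set l \<and> t = s"
  using set_zip_leftD[of v t l "replicate m s"] set_zip_rightD[of v t l "replicate m s"] by auto

text \<open>\<open>k\<close> is half the size of the odd support and \<open>c\<close> the size of
  the overlap; the differences are the sizes of the other three classes, and the inequalities say
  that these are natural numbers.\<close>

lemma not_refuted:
  fixes x :: "'a \<Rightarrow> int"
  assumes nut: "nut_on V N" and cubic: "\<And>v. v \<in> V \<Longrightarrow> card (N v) = 3" and n: "card V \<le> 16"
    and ker: "\<forall>v\<in>V. (\<Sum>u\<in>N v. x u) = 0" and odd: "\<exists>v\<in>V. odd (x v)"
  shows "\<exists>k c. k > 0 \<and> 4 dvd c \<and> c \<le> 2 * k \<and> 5 * k \<le> card V + c \<and>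
    \<not> refuted (types c (2 * k - c) (3 * k - c) (card V + c - 5 * k)) []"
proof -
  define A where "A = {v \<in> V. odd (x v)}"
  define B where "B = {v \<in> V. N v \<inter> A \<noteq> {}}"
  note cc = class_counts[OF nut cubic ker odd, folded A_def, folded B_def]
  note fin = nut_on_finite[OF nut]
  have sub: "A \<subseteq> V" "B \<subseteq> V" by (auto simp: A_def B_def)
  have f: "finite A" "finite B" using sub fin finite_subset by blast+
  define k where "k = card A div 2"
  define c where "c = card (A \<inter> B)"
  have "even (card A)" using cc(2) by presburger
  then have k: "card A = 2 * k" "card B = 3 * k" using cc(2) by (auto simp: k_def)
  have AB: "card (A - B) = 2 * k - c" "card (B - A) = 3 * k - c" "c \<le> 2 * k"
    unfolding c_def k[symmetric] using card_Diff_subset_Int[of A B] card_Diff_subset_Int[of B A] f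
    by (simp_all add: Int_commute card_mono)
  have "card (A \<union> B) + c = 5 * k" using card_Un_Int[OF f] k by (simp add: c_def)
  moreover have "card (V - (A \<union> B)) = card V - card (A \<union> B)" "card (A \<union> B) \<le> card V"
    using sub f by (simp_all add: card_Diff_subset card_mono[OF fin])
  ultimately have rest: "card (V - (A \<union> B)) = card V + c - 5 * k" "5 * k \<le> card V + c" by simp_all
  have kpos: "k > 0" using cc(3) k f by (metis card_0_eq gr0I mult_0_right)
  have enum: "\<exists>l. set l = S \<and> distinct l \<and> length l = card S" if "finite S" for S :: "'a set"
    using finite_distinct_list[OF that] distinct_card by metis
  obtain l1 where l1: "set l1 = B - A" "distinct l1" "length l1 = card (B - A)" using enum[of "B - A"] f by blast
  obtain l2 where l2: "set l2 = A \<inter> B" "distinct l2" "length l2 = card (A \<inter> B)" using enum[of "A \<inter> B"] f by blast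
  obtain l3 where l3: "set l3 = A - B" "distinct l3" "length l3 = card (A - B)" using enum[of "A - B"] f by blast
  obtain l4 where l4: "set l4 = V - (A \<union> B)" "distinct l4" "length l4 = card (V - (A \<union> B))"
    using enum[of "V - (A \<union> B)"] fin by blast
  define L where "L = l1 @ l2 @ l3 @ l4"
  have L: "set L = V" "distinct L" using l1 l2 l3 l4 sub by (auto simp: L_def)
  have lenL: "length L = card V" using distinct_card[OF L(2)] L(1) by simp
  define ks where "ks = replicate (3 * k - c) (False, C2, C1) @ replicate c (True, C2, C1) @
     replicate (2 * k - c) (True, C0, C3) @ replicate (card V + c - 5 * k) (False, C0, C3)"
  have lens: "length l1 = 3 * k - c" "length l2 = c" "length l3 = 2 * k - c" "length l4 = card V + c - 5 * k"
    using l1(3) l2(3) l3(3) l4(3) AB rest by (simp_all add: c_def)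
  have zipL: "zip L ks = zip l1 (replicate (3 * k - c) (False, C2, C1)) @ zip l2 (replicate c (True, C2, C1)) @
     zip l3 (replicate (2 * k - c) (True, C0, C3)) @ zip l4 (replicate (card V + c - 5 * k) (False, C0, C3))"
    unfolding L_def ks_def using lens by (simp add: zip_append)
  have split: "card (N v - A) = 3 - card (N v \<inter> A)" if v: "v \<in> V" for v
    using card_Diff_subset_Int[of "N v" A] cubic[OF v] f by simp
  have "\<not> refuted (types c (2 * k - c) (3 * k - c) (card V + c - 5 * k)) []"
    unfolding types_def ks_def[symmetric]
  proof (rule refuted_zip[where L = L and A = A])
    show "nut_on (set L) N" using nut L by simp
    show "length ks = length L" unfolding L_def ks_def using lens by simp
    show "length L \<le> length [A0, A1, A2, A3, A4, A5, A6, A7, A8, A9, B0, B1, B2, B3, B4, B5]"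
      using n lenL by simp
    fix v d i j assume "(v, d, i, j) \<in> set (zip L ks)"
    then consider "v \<in> B - A" "(d, i, j) = (False, C2, C1)" | "v \<in> A \<inter> B" "(d, i, j) = (True, C2, C1)"
      | "v \<in> A - B" "(d, i, j) = (True, C0, C3)" | "v \<in> V - (A \<union> B)" "(d, i, j) = (False, C0, C3)"
      unfolding zipL set_append Un_iff l1(1)[symmetric] l2(1)[symmetric] l3(1)[symmetric] l4(1)[symmetric]
      by (auto dest!: zip_rep)
    then show "(d \<longleftrightarrow> v \<in> A) \<and> card (N v \<inter> A) = cval i \<and> card (N v - A) = cval j"
    proof cases
      case 1
      then show ?thesis using cc(1)[of v] split[of v] sub by auto
    next
      case 2
      then show ?thesis using cc(1)[of v] split[of v] sub by auto
    next
      case 3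
      then show ?thesis using cc(1)[of v] split[of v] sub by auto
    next
      case 4
      then show ?thesis using cc(1)[of v] split[of v] sub by auto
    qed
  qed (use L in auto)
  then show ?thesis using kpos cc(4) AB(3) rest(2) unfolding c_def[symmetric] by blast
qed

subsection \<open>Excluded class sizes\<close>

text \<open>Literals are unfolded to successors so that \<open>replicate\<close> can be computed by
  rewriting.\<close>

lemma nat_literals:
  "1 = Suc 0" "2 = Suc 1" "3 = Suc 2" "4 = Suc 3" "5 = Suc 4" "6 = Suc 5" "7 = Suc 6" "8 = Suc 7"
  "9 = Suc 8" "10 = Suc 9" "11 = Suc 10"
  by simp_all

lemmas types_rules = types_def nat_literals replicate.simps zip_Cons_Cons zip.simps(1)

definition refs :: "'v type_list \<Rightarrow> ('v \<times> 'v) list list \<Rightarrow> bool" where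
  "refs T rs \<longleftrightarrow> (\<forall>r \<in> set rs. refuted T r)"

lemma refs_Nil: "refs T []" and refs_Cons: "refuted T r \<Longrightarrow> refs T rs \<Longrightarrow> refs T (r # rs)"
  by (simp_all add: refs_def)

lemma check_refuted: "refs T rs \<Longrightarrow> check T rs c es \<Longrightarrow> refuted T es"
  using check_sound unfolding refs_def by blast

text \<open>These class sizes are settled by one search from the empty graph, without any branching
  certificate.\<close>

lemma refuted_0_2_3_1: "refuted (types 0 2 3 1) []"
  by (rule check_refuted[OF refs_Nil, where c = Search]) (simp only: eval_rules types_rules)

lemma refuted_4_0_2_0: "refuted (types 4 0 2 0) []"
  by (rule check_refuted[OF refs_Nil, where c = Search]) (simp only: eval_rules types_rules)

lemma refuted_0_2_3_3: "refuted (types 0 2 3 3) []"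
  by (rule check_refuted[OF refs_Nil, where c = Search]) (simp only: eval_rules types_rules)

lemma refuted_4_0_2_2: "refuted (types 4 0 2 2) []"
  by (rule check_refuted[OF refs_Nil, where c = Search]) (simp only: eval_rules types_rules)

lemma refuted_0_2_3_5: "refuted (types 0 2 3 5) []"
  by (rule check_refuted[OF refs_Nil, where c = Search]) (simp only: eval_rules types_rules)

lemma refuted_4_0_2_4: "refuted (types 4 0 2 4) []"
  by (rule check_refuted[OF refs_Nil, where c = Search]) (simp only: eval_rules types_rules)

lemma refuted_0_4_6_0: "refuted (types 0 4 6 0) []"
  by (rule check_refuted[OF refs_Nil, where c = Search]) (simp only: eval_rules types_rules)

lemma refuted_0_2_3_9: "refuted (types 0 2 3 9) []"
  by (rule check_refuted[OF refs_Nil, where c = Search]) (simp only: eval_rules types_rules)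

lemma refuted_4_0_2_8: "refuted (types 4 0 2 8) []"
  by (rule check_refuted[OF refs_Nil, where c = Search]) (simp only: eval_rules types_rules)

lemma refuted_4_2_5_3: "refuted (types 4 2 5 3) []"
  by (rule check_refuted[OF refs_Nil, where c = Search]) (simp only: eval_rules types_rules)

lemma refuted_0_2_3_11: "refuted (types 0 2 3 11) []"
  by (rule check_refuted[OF refs_Nil, where c = Search]) (simp only: eval_rules types_rules)

lemma refuted_4_0_2_10: "refuted (types 4 0 2 10) []"
  by (rule check_refuted[OF refs_Nil, where c = Search]) (simp only: eval_rules types_rules)

lemma refuted_4_2_5_5: "refuted (types 4 2 5 5) []"
  by (rule check_refuted[OF refs_Nil, where c = Search]) (simp only: eval_rules types_rules)

text \<open>The edge list is a partial graph, refuted once and cited later by \<open>Ref\<close>. If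
  O and A are disjoint, the edges between them form a subdivided cubic multigraph on the vertices of
  O: each vertex of A subdivides one edge. Here O is \<open>A6\<close>, ..., \<open>A9\<close>, and
  \<open>A0\<close> and \<open>A2\<close> subdivide parallel edges.\<close>

lemma refuted_0_4_6_4_1: "refuted (types 0 4 6 4) [(A0,A6),(A0,A7),(A1,A6),(A1,A8),(A2,A6),(A2,A7)]"
  by (rule check_refuted[OF refs_Nil, where c = "Search"]) (simp only: eval_rules types_rules)

lemma refuted_0_4_6_4_2: "refuted (types 0 4 6 4) [(A0,A1),(A0,A6),(A0,A7),(A1,A6),(A1,A8),(A2,A6),(A2,A9),(A3,A7),(A3,A8),(A4,A7),(A4,A9),(A5,A8),(A5,A9)]"
  by (rule check_refuted[OF refs_Nil, where c = "Search"]) (simp only: eval_rules types_rules)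

lemma refuted_0_4_6_4_3: "refuted (types 0 4 6 4) [(A0,A6),(A0,A7),(A0,B0),(A1,A6),(A1,A8),(A1,B1),(A2,A4),(A2,A6),(A2,A9),(A3,A7),(A3,A8),(A4,A7),(A4,A9),(A5,A8),(A5,A9)]"
  by (rule check_refuted[OF refs_Nil, where c = "Search"]) (simp only: eval_rules types_rules)

lemma refuted_0_4_6_4_4: "refuted (types 0 4 6 4) [(A0,A6),(A0,A7),(A0,B0),(A1,A6),(A1,A8),(A1,B1),(A2,A6),(A2,A9),(A2,B0),(A3,A7),(A3,A8),(A4,A7),(A4,A9),(A5,A8),(A5,A9)]"
  by (rule check_refuted[OF refs_Nil, where c = "Search"]) (simp only: eval_rules types_rules)

lemma refuted_0_4_6_4_5: "refuted (types 0 4 6 4) [(A0,A6),(A0,A7),(A0,B0),(A1,A6),(A1,A8),(A1,B1),(A2,A6),(A2,A9),(A2,B2),(A3,A4),(A3,A7),(A3,A8),(A4,A7),(A4,A9),(A5,A8),(A5,A9)]"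
  by (rule check_refuted[OF refs_Nil, where c = "Search"]) (simp only: eval_rules types_rules)

lemma refuted_0_4_6_4_6: "refuted (types 0 4 6 4) [(A0,A6),(A0,A7),(A0,B0),(A1,A6),(A1,A8),(A1,B1),(A2,A6),(A2,A9),(A2,B2),(A3,A7),(A3,A8),(A3,B0),(A4,A7),(A4,A9),(A5,A8),(A5,A9)]"
  by (rule check_refuted[OF refs_Nil, where c = "Search"]) (simp only: eval_rules types_rules)

text \<open>These edges can be completed only to a subdivided K4. The certificate then branches on
  the third neighbours of the subdividing vertices, and symmetries of K4 identify many of the
  branches.\<close>

lemma refuted_0_4_6_4_7: "refuted (types 0 4 6 4) [(A0,A6),(A0,A7),(A1,A6),(A1,A8),(A2,A6),(A2,A9),(A3,A7),(A3,A8)]"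
  by (rule check_refuted[OF refs_Cons[OF refuted_0_4_6_4_2 refs_Cons[OF refuted_0_4_6_4_3 refs_Cons[OF refuted_0_4_6_4_4 refs_Cons[OF refuted_0_4_6_4_5 refs_Cons[OF refuted_0_4_6_4_6 refs_Nil]]]]], where c = "Split A7 False [Split A4 True [Search, Split A8 False [Split A5 True [Split A0 False [Ref [A0,A1,A2,A3,A4,A5,A6,A7,A8,A9,B0,B1,B2,B3], Ref [A0,A2,A1,A4,A3,A5,A6,A7,A9,A8,B0,B1,B2,B3], Ref [A0,A3,A4,A1,A2,A5,A7,A6,A8,A9,B0,B1,B2,B3], Ref [A0,A4,A3,A2,A1,A5,A7,A6,A9,A8,B0,B1,B2,B3], Search, Split A1 False [Search, Search, Search, Search, Search, Split A2 False [Search, Ref [A0,A1,A2,A3,A4,A5,A6,A7,A8,A9,B0,B1,B2,B3], Ref [A1,A0,A2,A3,A5,A4,A6,A8,A7,A9,B1,B0,B2,B3], Ref [A0,A1,A2,A3,A4,A5,A6,A7,A8,A9,B0,B1,B2,B3], Ref [A1,A0,A2,A3,A5,A4,A6,A8,A7,A9,B1,B0,B2,B3], Split A3 False [Ref [A0,A1,A2,A3,A4,A5,A6,A7,A8,A9,B0,B1,B2,B3], Ref [A1,A0,A2,A3,A5,A4,A6,A8,A7,A9,B1,B0,B2,B3], Ref [A0,A1,A2,A3,A4,A5,A6,A7,A8,A9,B0,B1,B2,B3], Ref [A1,A0,A2,A3,A5,A4,A6,A8,A7,A9,B1,B0,B2,B3], Search, Search]]]]]]]]"]) (simp only: eval_rules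 types_rules)

lemma refuted_0_4_6_4: "refuted (types 0 4 6 4) []"
  by (rule check_refuted[OF refs_Cons[OF refuted_0_4_6_4_1 refs_Cons[OF refuted_0_4_6_4_7 refs_Nil]], where c = "Split A6 False [Split A0 True [Split A6 False [Split A1 True [Search, Split A6 False [Split A2 True [Ref [A0,A1,A2,A3,A4,A5,A6,A7,A8,A9,B0,B1,B2,B3], Ref [A1,A0,A2,A3,A4,A5,A6,A8,A7,A9,B0,B1,B2,B3], Split A7 False [Split A3 True [Ref [A0,A1,A2,A3,A4,A5,A6,A7,A8,A9,B0,B1,B2,B3], Ref [A0,A2,A1,A3,A4,A5,A6,A7,A9,A8,B0,B1,B2,B3]]]]]]]]]"]) (simp only: eval_rules types_rules)

text \<open>Here O lies inside A: it induces a 2-regular graph on \<open>A4\<close>, ...,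
  \<open>B1\<close>, and each of \<open>A0\<close>, ..., \<open>A3\<close> is joined to two of these
  eight vertices. The partial graphs record a path in O and the vertices attached to it; this one
  has a triangle.\<close>

lemma refuted_8_0_4_2_1: "refuted (types 8 0 4 2) [(A0,A4),(A0,A5),(A4,A5),(A4,A6)]"
  by (rule check_refuted[OF refs_Nil, where c = "Search"]) (simp only: eval_rules types_rules)

lemma refuted_8_0_4_2_2: "refuted (types 8 0 4 2) [(A0,A4),(A0,A7),(A1,A5),(A1,A8),(A2,A6),(A2,A9),(A4,A5),(A4,A6),(A5,A7)]"
  by (rule check_refuted[OF refs_Nil, where c = "Search"]) (simp only: eval_rules types_rules)

lemma refuted_8_0_4_2_3: "refuted (types 8 0 4 2) [(A0,A4),(A0,A7),(A1,A5),(A1,A8),(A2,A6),(A2,A9),(A4,A5),(A4,A6),(A7,A8)]"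
  by (rule check_refuted[OF refs_Nil, where c = "Split A7 True [Search, Search, Search, Search]"]) (simp only: eval_rules types_rules)

lemma refuted_8_0_4_2_4: "refuted (types 8 0 4 2) [(A0,A4),(A0,A7),(A1,A5),(A1,A8),(A2,A6),(A2,A9),(A3,B0),(A3,B1),(A4,A5),(A4,A6),(A5,A7),(A7,B0)]"
  by (rule check_refuted[OF refs_Nil, where c = "Search"]) (simp only: eval_rules types_rules)

lemma refuted_8_0_4_2_5: "refuted (types 8 0 4 2) [(A0,A4),(A0,A7),(A1,A5),(A1,A8),(A2,A6),(A2,A9),(A3,B0),(A3,B1),(A4,A5),(A4,A6),(A7,A8),(A7,B0)]"
  by (rule check_refuted[OF refs_Nil, where c = "Search"]) (simp only: eval_rules types_rules)

lemma refuted_8_0_4_2: "refuted (types 8 0 4 2) []"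
  by (rule check_refuted[OF refs_Cons[OF refuted_8_0_4_2_1 refs_Cons[OF refuted_8_0_4_2_2 refs_Cons[OF refuted_8_0_4_2_3 refs_Cons[OF refuted_8_0_4_2_4 refs_Cons[OF refuted_8_0_4_2_5 refs_Nil]]]]], where c = "Split A4 True [Split A4 True [Split A4 False [Split A0 True [Ref [A0,A1,A2,A3,A4,A5,A6,A7,A8,A9,B0,B1,B2,B3], Ref [A0,A1,A2,A3,A4,A6,A5,A7,A8,A9,B0,B1,B2,B3], Split A5 False [Split A1 True [Search, Split A6 False [Split A2 True [Split A7 True [Ref [A0,A1,A2,A3,A4,A5,A6,A7,A8,A9,B0,B1,B2,B3], Ref [A0,A2,A1,A3,A4,A6,A5,A7,A9,A8,B0,B1,B2,B3], Ref [A0,A1,A2,A3,A4,A5,A6,A7,A8,A9,B0,B1,B2,B3], Ref [A0,A2,A1,A3,A4,A6,A5,A7,A9,A8,B0,B1,B2,B3], Split B0 False [Split A3 True [Split A7 True [Ref [A0,A1,A2,A3,A4,A5,A6,A7,A8,A9,B0,B1,B2,B3], Ref [A0,A2,A1,A3,A4,A6,A5,A7,A9,A8,B0,B1,B2,B3], Ref [A0,A1,A2,A3,A4,A5,A6,A7,A8,A9,B0,B1,B2,B3], Ref [A0,A2,A1,A3,A4,A6,A5,A7,A9,A8,B0,B1,B2,B3], Search]]]]]]]]]]]]"]) (simp only: eval_rules types_rules)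

text \<open>The four vertices of O \<inter> A are \<open>A8\<close>, \<open>A9\<close>,
  \<open>B0\<close>, \<open>B1\<close>; each has two neighbours in O, so they induce a
  4-cycle.\<close>

lemma refuted_4_4_8_0_1: "refuted (types 4 4 8 0) [(A0,A8),(A0,A9),(A8,A9),(A8,B0)]"
  by (rule check_refuted[OF refs_Nil, where c = "Search"]) (simp only: eval_rules types_rules)

lemma refuted_4_4_8_0_2: "refuted (types 4 4 8 0) [(A0,A8),(A0,B2),(A1,A9),(A1,B3),(A2,B0),(A2,B4),(A3,B2),(A3,B3),(A8,A9),(A8,B0)]"
  by (rule check_refuted[OF refs_Nil, where c = "Search"]) (simp only: eval_rules types_rules)

lemma refuted_4_4_8_0: "refuted (types 4 4 8 0) []"
  by (rule check_refuted[OF refs_Cons[OF refuted_4_4_8_0_1 refs_Cons[OF refuted_4_4_8_0_2 refs_Nil]], where c = "Split A8 True [Split A8 True [Split A8 False [Split A0 True [Ref [A0,A1,A2,A3,A4,A5,A6,A7,A8,A9,B0,B1,B2,B3,B4,B5], Ref [A0,A1,A2,A3,A4,A5,A6,A7,A8,B0,A9,B1,B2,B3,B4,B5], Search, Split A9 False [Split A1 True [Search, Search, Search, Split B0 False [Split A2 True [Search, Search, Search, Split B2 False [Split A3 True [Search, Ref [A0,A1,A2,A3,A4,A5,A6,A7,A8,A9,B0,B1,B2,B3,B4,B5], Ref [A0,A2,A1,A3,A4,A5,A6,A7,A8,B0,A9,B1,B2,B4,B3,B5], Search]]]]]]]]]]"]) (simp only: eval_rules types_rules)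

text \<open>As for sizes (8, 0, 4, 2), with two further vertices away from O; here O has the
  triangle \<open>A4\<close>, \<open>A5\<close>, \<open>A6\<close> as a component.\<close>

lemma refuted_8_0_4_4_1: "refuted (types 8 0 4 4) [(A0,A4),(A0,A5),(A1,A6),(A1,A7),(A4,A5),(A4,A6),(A5,A6)]"
  by (rule check_refuted[OF refs_Nil, where c = "Search"]) (simp only: eval_rules types_rules)

lemma refuted_8_0_4_4_2: "refuted (types 8 0 4 4) [(A0,A4),(A0,A5),(A4,A5),(A4,A6)]"
  by (rule check_refuted[OF refs_Cons[OF refuted_8_0_4_4_1 refs_Nil], where c = "Split A6 False [Split A1 True [Split A5 True [Ref [A0,A1,A2,A3,A4,A5,A6,A7,A8,A9,B0,B1,B2,B3,B4,B5], Search, Split A8 False [Split A2 True [Split A6 True [Search, Search, Search, Split B0 False [Split A3 True [Split A7 True [Search, Search, Search, Search]]]]]]]]]"]) (simp only: eval_rules types_rules)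

lemma refuted_8_0_4_4_3: "refuted (types 8 0 4 4) [(A0,A4),(A0,A7),(A1,A5),(A1,A6),(A2,A8),(A2,A9),(A4,A5),(A4,A6),(A5,A8),(A6,A7)]"
  by (rule check_refuted[OF refs_Nil, where c = "Search"]) (simp only: eval_rules types_rules)

lemma refuted_8_0_4_4_4: "refuted (types 8 0 4 4) [(A0,A4),(A0,A7),(A1,A5),(A1,A6),(A2,A8),(A2,A9),(A4,A5),(A4,A6),(A5,A8),(A6,A9)]"
  by (rule check_refuted[OF refs_Nil, where c = "Search"]) (simp only: eval_rules types_rules)

lemma refuted_8_0_4_4_5: "refuted (types 8 0 4 4) [(A0,A4),(A0,A7),(A1,A5),(A1,A6),(A2,A8),(A2,A9),(A4,A5),(A4,A6),(A5,A8)]"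
  by (rule check_refuted[OF refs_Cons[OF refuted_8_0_4_4_3 refs_Cons[OF refuted_8_0_4_4_4 refs_Nil]], where c = "Split A6 True [Ref [A0,A1,A2,A3,A4,A5,A6,A7,A8,A9,B0,B1,B2,B3,B4,B5], Ref [A0,A1,A2,A3,A4,A5,A6,A7,A8,A9,B0,B1,B2,B3,B4,B5], Search]"]) (simp only: eval_rules types_rules)

lemma refuted_8_0_4_4_6: "refuted (types 8 0 4 4) [(A0,A4),(A0,A7),(A1,A5),(A1,A8),(A2,A6),(A2,A9),(A3,B0),(A3,B1),(A4,A5),(A4,A6),(A7,A8),(A7,B0)]"
  by (rule check_refuted[OF refs_Nil, where c = "Split A5 True [Search, Search, Search, Search, Search]"]) (simp only: eval_rules types_rules)

lemma refuted_8_0_4_4_7: "refuted (types 8 0 4 4) [(A0,A4),(A0,A7),(A1,A5),(A1,A8),(A2,A6),(A2,A9),(A4,A5),(A4,A6),(A7,A8)]"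
  by (rule check_refuted[OF refs_Cons[OF refuted_8_0_4_4_3 refs_Cons[OF refuted_8_0_4_4_4 refs_Cons[OF refuted_8_0_4_4_6 refs_Nil]]], where c = "Split A7 True [Ref [A1,A0,A2,A3,A5,A4,A7,A8,A6,A9,B0,B1,B2,B3,B4,B5], Ref [A2,A0,A1,A3,A6,A4,A7,A9,A5,A8,B0,B1,B2,B3,B4,B5], Search, Split B0 False [Split A3 True [Ref [A0,A1,A2,A3,A4,A5,A6,A7,A8,A9,B0,B1,B2,B3,B4,B5]]]]"]) (simp only: eval_rules types_rules)

lemma refuted_8_0_4_4_8: "refuted (types 8 0 4 4) [(A0,A4),(A0,A7),(A1,A5),(A1,A8),(A2,A6),(A2,A9),(A3,B0),(A3,B1),(A4,A5),(A4,A6),(A5,A7),(A7,B0)]"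
  by (rule check_refuted[OF refs_Nil, where c = "Search"]) (simp only: eval_rules types_rules)

lemma refuted_8_0_4_4_9: "refuted (types 8 0 4 4) [(A0,A4),(A0,A7),(A1,A5),(A1,A8),(A2,A6),(A2,A9),(A3,B0),(A3,B1),(A4,A5),(A4,A6),(A5,B0),(A7,B0),(A7,B1)]"
  by (rule check_refuted[OF refs_Nil, where c = "Search"]) (simp only: eval_rules types_rules)

lemma refuted_8_0_4_4_10: "refuted (types 8 0 4 4) [(A0,A4),(A0,A7),(A1,A5),(A1,A8),(A2,A6),(A2,A9),(A3,B0),(A3,B1),(A4,A5),(A4,A6),(A7,B0),(A7,B1),(A8,B0)]"
  by (rule check_refuted[OF refs_Nil, where c = "Search"]) (simp only: eval_rules types_rules)

lemma refuted_8_0_4_4: "refuted (types 8 0 4 4) []"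
  by (rule check_refuted[OF refs_Cons[OF refuted_8_0_4_4_2 refs_Cons[OF refuted_8_0_4_4_1 refs_Cons[OF refuted_8_0_4_4_5 refs_Cons[OF refuted_8_0_4_4_7 refs_Cons[OF refuted_8_0_4_4_8 refs_Cons[OF refuted_8_0_4_4_6 refs_Cons[OF refuted_8_0_4_4_9 refs_Cons[OF refuted_8_0_4_4_10 refs_Nil]]]]]]]], where c = "Split A4 True [Split A4 True [Split A4 False [Split A0 True [Ref [A0,A1,A2,A3,A4,A5,A6,A7,A8,A9,B0,B1,B2,B3,B4,B5], Ref [A0,A1,A2,A3,A4,A6,A5,A7,A8,A9,B0,B1,B2,B3,B4,B5], Split A5 False [Split A1 True [Split A5 True [Ref [A1,A0,A2,A3,A5,A6,A4,A7,A8,A9,B0,B1,B2,B3,B4,B5], Search, Split A8 False [Split A2 True [Ref [A0,A1,A2,A3,A4,A5,A6,A7,A8,A9,B0,B1,B2,B3,B4,B5]]]], Split A6 False [Split A2 True [Split A7 True [Ref [A1,A0,A2,A3,A5,A4,A7,A8,A6,A9,B0,B1,B2,B3,B4,B5], Ref [A2,A0,A1,A3,A6,A4,A7,A9,A5,A8,B0,B1,B2,B3,B4,B5], Ref [A0,A1,A2,A3,A4,A5,A6,A7,A8,A9,B0,B1,B2,B3,B4,B5], Ref [A0,A2,A1,A3,A4,A6,A5,A7,A9,A8,B0,B1,B2,B3,B4,B5], Split B0 False [Split A3 True [Split A7 True [Ref [A0,A1,A2,A3,A4,A5,A6,A7,A8,A9,B0,B1,B2,B3,B4,B5], Ref [A0,A2,A1,A3,A4,A6,A5,A7,A9,A8,B0,B1,B2,B3,B4,B5],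 Ref [A0,A1,A2,A3,A4,A5,A6,A7,A8,A9,B0,B1,B2,B3,B4,B5], Ref [A0,A2,A1,A3,A4,A6,A5,A7,A9,A8,B0,B1,B2,B3,B4,B5], Split B0 True [Ref [A0,A1,A2,A3,A4,A5,A6,A7,A8,A9,B0,B1,B2,B3,B4,B5], Ref [A0,A2,A1,A3,A4,A6,A5,A7,A9,A8,B0,B1,B2,B3,B4,B5], Ref [A0,A1,A2,A3,A4,A5,A6,A7,A8,A9,B0,B1,B2,B3,B4,B5], Ref [A0,A2,A1,A3,A4,A6,A5,A7,A9,A8,B0,B1,B2,B3,B4,B5], Search]]]]]]]]]]]]]"]) (simp only: eval_rules types_rules)

text \<open>O and A are disjoint: \<open>A0\<close>, ..., \<open>A8\<close> subdivide the edges of a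
  cubic multigraph on \<open>A9\<close>, \<open>B0\<close>, ..., \<open>B4\<close>. The cases below
  follow the shape of this multigraph.\<close>

lemma refuted_0_6_9_1_1: "refuted (types 0 6 9 1) [(A0,A9),(A0,B0),(A1,A9),(A1,B0),(A2,A9),(A2,B1),(A3,B0),(A3,B1),(A4,B1),(A4,B2),(A5,B2),(A5,B3),(A6,B2),(A6,B3)]"
  by (rule check_refuted[OF refs_Nil, where c = "Search"]) (simp only: eval_rules types_rules)

lemma refuted_0_6_9_1_2: "refuted (types 0 6 9 1) [(A0,A2),(A0,A9),(A0,B0),(A1,A9),(A1,B0),(A2,A9),(A2,B1),(A3,B0),(A3,B1),(A4,B1),(A4,B2),(A5,B2),(A5,B3),(A6,B2),(A6,B4),(A7,B3),(A7,B4),(A8,B3),(A8,B4)]"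
  by (rule check_refuted[OF refs_Nil, where c = "Search"]) (simp only: eval_rules types_rules)

lemma refuted_0_6_9_1_3: "refuted (types 0 6 9 1) [(A0,A5),(A0,A9),(A0,B0),(A1,A9),(A1,B0),(A2,A9),(A2,B1),(A3,B0),(A3,B1),(A4,B1),(A4,B2),(A5,B2),(A5,B3),(A6,B2),(A6,B4),(A7,B3),(A7,B4),(A8,B3),(A8,B4)]"
  by (rule check_refuted[OF refs_Nil, where c = "Search"]) (simp only: eval_rules types_rules)

lemma refuted_0_6_9_1_4: "refuted (types 0 6 9 1) [(A0,A7),(A0,A9),(A0,B0),(A1,A9),(A1,B0),(A2,A9),(A2,B1),(A3,B0),(A3,B1),(A4,B1),(A4,B2),(A5,B2),(A5,B3),(A6,B2),(A6,B4),(A7,B3),(A7,B4),(A8,B3),(A8,B4)]"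
  by (rule check_refuted[OF refs_Nil, where c = "Search"]) (simp only: eval_rules types_rules)

lemma refuted_0_6_9_1_5: "refuted (types 0 6 9 1) [(A0,A9),(A0,B0),(A1,A9),(A1,B0),(A2,A9),(A2,B1),(A3,B0),(A3,B1),(A4,B1),(A4,B2),(A5,B2),(A5,B3),(A6,B2),(A6,B4)]"
  by (rule check_refuted[OF refs_Cons[OF refuted_0_6_9_1_2 refs_Cons[OF refuted_0_6_9_1_3 refs_Cons[OF refuted_0_6_9_1_4 refs_Nil]]], where c = "Split B3 False [Split A7 True [Split B3 False [Split A8 True [Split A0 False [Search, Ref [A0,A1,A2,A3,A4,A5,A6,A7,A8,A9,B0,B1,B2,B3,B4,B5], Ref [A0,A1,A3,A2,A4,A5,A6,A7,A8,B0,A9,B1,B2,B3,B4,B5], Search, Ref [A0,A1,A2,A3,A4,A5,A6,A7,A8,A9,B0,B1,B2,B3,B4,B5], Ref [A0,A1,A2,A3,A4,A6,A5,A7,A8,A9,B0,B1,B2,B4,B3,B5], Ref [A0,A1,A2,A3,A4,A5,A6,A7,A8,A9,B0,B1,B2,B3,B4,B5], Ref [A0,A1,A2,A3,A4,A5,A6,A8,A7,A9,B0,B1,B2,B3,B4,B5], Search]]]]]"]) (simp only: eval_rules types_rules)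

lemma refuted_0_6_9_1_6: "refuted (types 0 6 9 1) [(A0,A9),(A0,B0),(A1,A9),(A1,B0),(A2,A9),(A2,B1),(A3,B0),(A3,B1),(A4,B1),(A4,B2)]"
  by (rule check_refuted[OF refs_Cons[OF refuted_0_6_9_1_1 refs_Cons[OF refuted_0_6_9_1_5 refs_Nil]], where c = "Split B2 False [Split A5 True [Split B2 False [Split A6 True [Ref [A0,A1,A2,A3,A4,A5,A6,A7,A8,A9,B0,B1,B2,B3,B4,B5], Ref [A0,A1,A2,A3,A4,A5,A6,A7,A8,A9,B0,B1,B2,B3,B4,B5]]]]]"]) (simp only: eval_rules types_rules)

lemma refuted_0_6_9_1_7: "refuted (types 0 6 9 1) [(A0,A9),(A0,B0),(A1,A9),(A1,B0),(A2,A9),(A2,B1),(A3,B0),(A3,B2),(A4,B1),(A4,B3),(A5,B1),(A5,B2)]"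
  by (rule check_refuted[OF refs_Nil, where c = "Search"]) (simp only: eval_rules types_rules)

lemma refuted_0_6_9_1_8: "refuted (types 0 6 9 1) [(A0,A2),(A0,A9),(A0,B0),(A1,A9),(A1,B0),(A2,A9),(A2,B1),(A3,B0),(A3,B2),(A4,B1),(A4,B3),(A5,B1),(A5,B4),(A6,B2),(A6,B3),(A7,B2),(A7,B4),(A8,B3),(A8,B4)]"
  by (rule check_refuted[OF refs_Nil, where c = "Search"]) (simp only: eval_rules types_rules)

lemma refuted_0_6_9_1_9: "refuted (types 0 6 9 1) [(A0,A4),(A0,A9),(A0,B0),(A1,A9),(A1,B0),(A2,A9),(A2,B1),(A3,B0),(A3,B2),(A4,B1),(A4,B3),(A5,B1),(A5,B4),(A6,B2),(A6,B3),(A7,B2),(A7,B4),(A8,B3),(A8,B4)]"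
  by (rule check_refuted[OF refs_Nil, where c = "Search"]) (simp only: eval_rules types_rules)

lemma refuted_0_6_9_1_10: "refuted (types 0 6 9 1) [(A0,A9),(A0,B0),(A1,A9),(A1,B0),(A2,A9),(A2,B1),(A3,B0),(A3,B2),(A4,B1),(A4,B3),(A5,B1),(A5,B4),(A6,B2),(A6,B3),(A7,B2),(A7,B4),(A8,B3),(A8,B4)]"
  by (rule check_refuted[OF refs_Cons[OF refuted_0_6_9_1_8 refs_Cons[OF refuted_0_6_9_1_9 refs_Nil]], where c = "Split A0 False [Search, Ref [A0,A1,A2,A3,A4,A5,A6,A7,A8,A9,B0,B1,B2,B3,B4,B5], Ref [A0,A1,A3,A2,A6,A7,A4,A5,A8,B0,A9,B2,B1,B3,B4,B5], Ref [A0,A1,A2,A3,A4,A5,A6,A7,A8,A9,B0,B1,B2,B3,B4,B5], Ref [A0,A1,A2,A3,A5,A4,A7,A6,A8,A9,B0,B1,B2,B4,B3,B5], Ref [A0,A1,A3,A2,A6,A7,A4,A5,A8,B0,A9,B2,B1,B3,B4,B5], Ref [A0,A1,A3,A2,A7,A6,A5,A4,A8,B0,A9,B2,B1,B4,B3,B5], Search, Search]"]) (simp only: eval_rules types_rules)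

lemma refuted_0_6_9_1_11: "refuted (types 0 6 9 1) [(A0,A9),(A0,B0),(A1,A9),(A1,B0),(A2,A9),(A2,B1),(A3,B0),(A3,B2),(A4,B1),(A4,B3),(A5,B1),(A5,B4),(A6,B2),(A6,B3)]"
  by (rule check_refuted[OF refs_Cons[OF refuted_0_6_9_1_10 refs_Nil], where c = "Split B2 False [Split A7 True [Search, Split B3 False [Split A8 True [Ref [A0,A1,A2,A3,A4,A5,A6,A7,A8,A9,B0,B1,B2,B3,B4,B5]]]]]"]) (simp only: eval_rules types_rules)

text \<open>The multigraph has a double edge between \<open>A9\<close> and
  \<open>B0\<close>.\<close>

lemma refuted_0_6_9_1_12: "refuted (types 0 6 9 1) [(A0,A9),(A0,B0),(A1,A9),(A1,B0),(A2,A9),(A2,B1)]"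
  by (rule check_refuted[OF refs_Cons[OF refuted_0_6_9_1_6 refs_Cons[OF refuted_0_6_9_1_7 refs_Cons[OF refuted_0_6_9_1_11 refs_Nil]]], where c = "Split B0 False [Split A3 True [Split B1 False [Split A4 True [Ref [A0,A1,A2,A3,A4,A5,A6,A7,A8,A9,B0,B1,B2,B3,B4,B5]]], Split B1 False [Split A4 True [Search, Split B1 False [Split A5 True [Ref [A0,A1,A2,A3,A4,A5,A6,A7,A8,A9,B0,B1,B2,B3,B4,B5], Search, Split B2 False [Split A6 True [Ref [A0,A1,A2,A3,A4,A5,A6,A7,A8,A9,B0,B1,B2,B3,B4,B5], Ref [A0,A1,A2,A3,A5,A4,A6,A7,A8,A9,B0,B1,B2,B4,B3,B5]]]]]]]]]"]) (simp only: eval_rules types_rules)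

lemma refuted_0_6_9_1_13: "refuted (types 0 6 9 1) [(A0,A9),(A0,B0),(A1,A9),(A1,B1),(A2,A9),(A2,B2),(A3,B0),(A3,B1),(A4,B0),(A4,B2),(A5,B1),(A5,B3)]"
  by (rule check_refuted[OF refs_Cons[OF refuted_0_6_9_1_10 refs_Nil], where c = "Split B2 False [Split A6 True [Search, Split B3 False [Split A7 True [Split B3 False [Split A8 True [Ref [A7,A8,A5,A6,A1,A3,A2,A4,A0,B3,B4,B1,B2,A9,B0,B5]]]]]]]"]) (simp only: eval_rules types_rules)

lemma refuted_0_6_9_1_14: "refuted (types 0 6 9 1) [(A0,A9),(A0,B0),(A1,A9),(A1,B1),(A2,A9),(A2,B2),(A3,B0),(A3,B1),(A4,B0),(A4,B3),(A5,B1),(A5,B4),(A6,B2),(A6,B3),(A7,B2),(A7,B3)]"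
  by (rule check_refuted[OF refs_Nil, where c = "Search"]) (simp only: eval_rules types_rules)

lemma refuted_0_6_9_1_15: "refuted (types 0 6 9 1) [(A0,A1),(A0,A9),(A0,B0),(A1,A9),(A1,B1),(A2,A9),(A2,B2),(A3,B0),(A3,B1),(A4,B0),(A4,B3),(A5,B1),(A5,B4),(A6,B2),(A6,B3),(A7,B2),(A7,B4),(A8,B3),(A8,B4)]"
  by (rule check_refuted[OF refs_Nil, where c = "Search"]) (simp only: eval_rules types_rules)

lemma refuted_0_6_9_1_16: "refuted (types 0 6 9 1) [(A0,A2),(A0,A9),(A0,B0),(A1,A9),(A1,B1),(A2,A9),(A2,B2),(A3,B0),(A3,B1),(A4,B0),(A4,B3),(A5,B1),(A5,B4),(A6,B2),(A6,B3),(A7,B2),(A7,B4),(A8,B3),(A8,B4)]"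
  by (rule check_refuted[OF refs_Nil, where c = "Search"]) (simp only: eval_rules types_rules)

lemma refuted_0_6_9_1_17: "refuted (types 0 6 9 1) [(A0,A7),(A0,A9),(A0,B0),(A1,A9),(A1,B1),(A2,A9),(A2,B2),(A3,B0),(A3,B1),(A4,B0),(A4,B3),(A5,B1),(A5,B4),(A6,B2),(A6,B3),(A7,B2),(A7,B4),(A8,B3),(A8,B4)]"
  by (rule check_refuted[OF refs_Nil, where c = "Search"]) (simp only: eval_rules types_rules)

text \<open>The multigraph is the triangular prism with triangles \<open>A9\<close>,
  \<open>B0\<close>, \<open>B1\<close> and \<open>B2\<close>, \<open>B3\<close>,
  \<open>B4\<close>.\<close>

lemma refuted_0_6_9_1_18: "refuted (types 0 6 9 1) [(A0,A9),(A0,B0),(A1,A9),(A1,B1),(A2,A9),(A2,B2),(A3,B0),(A3,B1),(A4,B0),(A4,B3),(A5,B1),(A5,B4),(A6,B2),(A6,B3),(A7,B2),(A7,B4)]"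
  by (rule check_refuted[OF refs_Cons[OF refuted_0_6_9_1_15 refs_Cons[OF refuted_0_6_9_1_16 refs_Cons[OF refuted_0_6_9_1_17 refs_Nil]]], where c = "Split B3 False [Split A8 True [Split A0 False [Ref [A0,A1,A2,A3,A4,A5,A6,A7,A8,A9,B0,B1,B2,B3,B4,B5], Ref [A0,A1,A2,A3,A4,A5,A6,A7,A8,A9,B0,B1,B2,B3,B4,B5], Ref [A0,A3,A4,A1,A2,A5,A6,A8,A7,B0,A9,B1,B3,B2,B4,B5], Ref [A0,A3,A4,A1,A2,A5,A6,A8,A7,B0,A9,B1,B3,B2,B4,B5], Search, Search, Ref [A0,A1,A2,A3,A4,A5,A6,A7,A8,A9,B0,B1,B2,B3,B4,B5], Ref [A0,A3,A4,A1,A2,A5,A6,A8,A7,B0,A9,B1,B3,B2,B4,B5], Split A1 False [Search, Search, Search, Search, Search, Search, Search, Search]]]]"]) (simp only: eval_rules types_rules)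

lemma refuted_0_6_9_1_19: "refuted (types 0 6 9 1) [(A0,A9),(A0,B0),(A1,A9),(A1,B1),(A2,A9),(A2,B2),(A3,B0),(A3,B1),(A4,B0),(A4,B3),(A5,B1),(A5,B4),(A6,B2),(A6,B3)]"
  by (rule check_refuted[OF refs_Cons[OF refuted_0_6_9_1_14 refs_Cons[OF refuted_0_6_9_1_18 refs_Nil]], where c = "Split B2 False [Split A7 True [Ref [A0,A1,A2,A3,A4,A5,A6,A7,A8,A9,B0,B1,B2,B3,B4,B5], Ref [A0,A1,A2,A3,A4,A5,A6,A7,A8,A9,B0,B1,B2,B3,B4,B5]]]"]) (simp only: eval_rules types_rules)

lemma refuted_0_6_9_1_20: "refuted (types 0 6 9 1) [(A0,A9),(A0,B0),(A1,A9),(A1,B1),(A2,A9),(A2,B2),(A3,B0),(A3,B1),(A4,B0),(A4,B3)]"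
  by (rule check_refuted[OF refs_Cons[OF refuted_0_6_9_1_13 refs_Cons[OF refuted_0_6_9_1_19 refs_Nil]], where c = "Split B1 False [Split A5 True [Ref [A1,A0,A2,A3,A5,A4,A6,A7,A8,A9,B1,B0,B2,B3,B4,B5], Ref [A3,A0,A4,A1,A5,A2,A6,A7,A8,B0,B1,A9,B3,B2,B4,B5], Split B2 False [Split A6 True [Ref [A0,A1,A2,A3,A4,A5,A6,A7,A8,A9,B0,B1,B2,B3,B4,B5], Ref [A1,A0,A2,A3,A5,A4,A6,A7,A8,A9,B1,B0,B2,B4,B3,B5]]]]]"]) (simp only: eval_rules types_rules)

text \<open>The multigraph has a triangle \<open>A9\<close>, \<open>B0\<close>,
  \<open>B1\<close>.\<close>

lemma refuted_0_6_9_1_21: "refuted (types 0 6 9 1) [(A0,A9),(A0,B0),(A1,A9),(A1,B1),(A2,A9),(A2,B2),(A3,B0),(A3,B1)]"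
  by (rule check_refuted[OF refs_Cons[OF refuted_0_6_9_1_6 refs_Cons[OF refuted_0_6_9_1_13 refs_Cons[OF refuted_0_6_9_1_20 refs_Nil]]], where c = "Split B0 False [Split A4 True [Ref [A3,A4,A0,A1,A2,A5,A6,A7,A8,B0,B1,A9,B2,B3,B4,B5], Split B1 False [Split A5 True [Search, Ref [A0,A1,A2,A3,A4,A5,A6,A7,A8,A9,B0,B1,B2,B3,B4,B5]]], Ref [A0,A1,A2,A3,A4,A5,A6,A7,A8,A9,B0,B1,B2,B3,B4,B5]]]"]) (simp only: eval_rules types_rules)

lemma refuted_0_6_9_1_22: "refuted (types 0 6 9 1) [(A0,A9),(A0,B0),(A1,A9),(A1,B1),(A2,A9),(A2,B2),(A3,B0),(A3,B3),(A4,B0),(A4,B3),(A5,B1),(A5,B2),(A6,B1),(A6,B4)]"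
  by (rule check_refuted[OF refs_Cons[OF refuted_0_6_9_1_14 refs_Cons[OF refuted_0_6_9_1_10 refs_Nil]], where c = "Split B2 False [Split A7 True [Ref [A2,A1,A0,A5,A7,A6,A3,A4,A8,A9,B2,B1,B0,B3,B4,B5], Split B3 False [Split A8 True [Ref [A3,A4,A0,A8,A1,A2,A6,A7,A5,B0,B3,A9,B4,B1,B2,B5]]]]]"]) (simp only: eval_rules types_rules)

lemma refuted_0_6_9_1_23: "refuted (types 0 6 9 1) [(A0,A9),(A0,B0),(A1,A9),(A1,B1),(A2,A9),(A2,B2),(A3,B0),(A3,B3),(A4,B0),(A4,B3),(A5,B1),(A5,B4),(A6,B1),(A6,B3)]"
  by (rule check_refuted[OF refs_Nil, where c = "Search"]) (simp only: eval_rules types_rules)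

lemma refuted_0_6_9_1_24: "refuted (types 0 6 9 1) [(A0,A9),(A0,B0),(A1,A9),(A1,B1),(A2,A9),(A2,B2),(A3,B0),(A3,B3),(A4,B0),(A4,B4),(A5,B1),(A5,B2),(A6,B1),(A6,B3)]"
  by (rule check_refuted[OF refs_Cons[OF refuted_0_6_9_1_18 refs_Nil], where c = "Split B2 False [Split A7 True [Search, Ref [A1,A2,A0,A5,A6,A7,A3,A4,A8,A9,B1,B2,B0,B3,B4,B5]]]"]) (simp only: eval_rules types_rules)

text \<open>Joining \<open>A6\<close> to \<open>B4\<close> leaves only the complete bipartite graph
  with parts of size 3, which is searched directly.\<close>

lemma refuted_0_6_9_1_25: "refuted (types 0 6 9 1) [(A0,A9),(A0,B0),(A1,A9),(A1,B1),(A2,A9),(A2,B2),(A3,B0),(A3,B3),(A4,B0),(A4,B4),(A5,B1),(A5,B3)]"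
  by (rule check_refuted[OF refs_Cons[OF refuted_0_6_9_1_24 refs_Cons[OF refuted_0_6_9_1_23 refs_Nil]], where c = "Split B1 False [Split A6 True [Ref [A0,A1,A2,A3,A4,A6,A5,A7,A8,A9,B0,B1,B2,B3,B4,B5], Ref [A1,A0,A2,A5,A6,A4,A3,A7,A8,A9,B1,B0,B2,B3,B4,B5], Search]]"]) (simp only: eval_rules types_rules)

lemma refuted_0_6_9_1: "refuted (types 0 6 9 1) []"
  by (rule check_refuted[OF refs_Cons[OF refuted_0_6_9_1_12 refs_Cons[OF refuted_0_6_9_1_21 refs_Cons[OF refuted_0_6_9_1_20 refs_Cons[OF refuted_0_6_9_1_1 refs_Cons[OF refuted_0_6_9_1_22 refs_Cons[OF refuted_0_6_9_1_7 refs_Cons[OF refuted_0_6_9_1_23 refs_Cons[OF refuted_0_6_9_1_5 refs_Cons[OF refuted_0_6_9_1_24 refs_Cons[OF refuted_0_6_9_1_25 refs_Nil]]]]]]]]]], where c = "Split A9 False [Split A0 True [Split A9 False [Split A1 True [Split A9 False [Split A2 True [Ref [A0,A1,A2,A3,A4,A5,A6,A7,A8,A9,B0,B1,B2,B3,B4,B5]]], Split A9 False [Split A2 True [Ref [A0,A2,A1,A3,A4,A5,A6,A7,A8,A9,B0,B1,B2,B3,B4,B5], Ref [A1,A2,A0,A3,A4,A5,A6,A7,A8,A9,B1,B0,B2,B3,B4,B5], Split B0 False [Split A3 True [Ref [A0,A1,A2,A3,A4,A5,A6,A7,A8,A9,B0,B1,B2,B3,B4,B5], Ref [A0,A2,A1,A3,A4,A5,A6,A7,A8,A9,B0,B2,B1,B3,B4,B5],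 Split B0 False [Split A4 True [Ref [A0,A1,A2,A4,A3,A5,A6,A7,A8,A9,B0,B1,B2,B3,B4,B5], Ref [A0,A2,A1,A4,A3,A5,A6,A7,A8,A9,B0,B2,B1,B3,B4,B5], Split B1 False [Split A5 True [Split B1 False [Split A6 True [Ref [A5,A6,A1,A2,A0,A3,A4,A7,A8,B1,B2,A9,B0,B3,B4,B5], Search, Ref [A0,A1,A2,A3,A4,A5,A6,A7,A8,A9,B0,B1,B2,B3,B4,B5]]], Ref [A3,A4,A0,A5,A2,A1,A6,A7,A8,B0,B3,A9,B1,B2,B4,B5], Split B1 False [Split A6 True [Ref [A0,A1,A2,A3,A4,A6,A5,A7,A8,A9,B0,B1,B2,B3,B4,B5], Ref [A0,A1,A2,A3,A4,A5,A6,A7,A8,A9,B0,B1,B2,B3,B4,B5], Search]]]], Split B1 False [Split A5 True [Split B1 False [Split A6 True [Ref [A5,A6,A1,A2,A0,A3,A4,A7,A8,B1,B2,A9,B0,B3,B4,B5], Ref [A0,A1,A2,A3,A4,A5,A6,A7,A8,A9,B0,B1,B2,B3,B4,B5], Ref [A0,A1,A2,A4,A3,A5,A6,A7,A8,A9,B0,B1,B2,B4,B3,B5]]], Ref [A0,A1,A2,A3,A4,A5,A6,A7,A8,A9,B0,B1,B2,B3,B4,B5], Ref [A0,A1,A2,A4,A3,A5,A6,A7,A8,A9,B0,B1,B2,B4,B3,B5]]]]]]]]]]]]]"]) (simp only: eval_rules types_rules)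

text \<open>The subdivided multigraphs are those of sizes (0, 4, 6, 4); two more vertices away from
  O leave more choices for the third neighbours.\<close>

lemma refuted_0_4_6_6_1: "refuted (types 0 4 6 6) [(A0,A6),(A0,A7),(A1,A6),(A1,A8),(A2,A6),(A2,A7)]"
  by (rule check_refuted[OF refs_Nil, where c = "Search"]) (simp only: eval_rules types_rules)

lemma refuted_0_4_6_6_2: "refuted (types 0 4 6 6) [(A0,A1),(A0,A6),(A0,A7),(A1,A6),(A1,A8),(A2,A3),(A2,A6),(A2,A9),(A3,A7),(A3,A8),(A4,A7),(A4,A9),(A5,A8),(A5,A9)]"
  by (rule check_refuted[OF refs_Nil, where c = "Search"]) (simp only: eval_rules types_rules)

lemma refuted_0_4_6_6_3: "refuted (types 0 4 6 6) [(A0,A1),(A0,A6),(A0,A7),(A1,A6),(A1,A8),(A2,A4),(A2,A6),(A2,A9),(A3,A7),(A3,A8),(A4,A7),(A4,A9),(A5,A8),(A5,A9)]"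
  by (rule check_refuted[OF refs_Nil, where c = "Search"]) (simp only: eval_rules types_rules)

lemma refuted_0_4_6_6_4: "refuted (types 0 4 6 6) [(A0,A1),(A0,A6),(A0,A7),(A1,A6),(A1,A8),(A2,A6),(A2,A9),(A2,B0),(A3,A4),(A3,A7),(A3,A8),(A4,A7),(A4,A9),(A5,A8),(A5,A9)]"
  by (rule check_refuted[OF refs_Nil, where c = "Search"]) (simp only: eval_rules types_rules)

lemma refuted_0_4_6_6_5: "refuted (types 0 4 6 6) [(A0,A1),(A0,A6),(A0,A7),(A1,A6),(A1,A8),(A2,A6),(A2,A9),(A2,B0),(A3,A7),(A3,A8),(A4,A7),(A4,A9),(A5,A8),(A5,A9)]"
  by (rule check_refuted[OF refs_Cons[OF refuted_0_4_6_6_4 refs_Nil], where c = "Split A3 False [Ref [A0,A1,A2,A3,A4,A5,A6,A7,A8,A9,B0,B1,B2,B3,B4,B5], Ref [A1,A0,A2,A3,A5,A4,A6,A8,A7,A9,B0,B1,B2,B3,B4,B5], Search, Search]"]) (simp only: eval_rules types_rules)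

lemma refuted_0_4_6_6_6: "refuted (types 0 4 6 6) [(A0,A1),(A0,A6),(A0,A7),(A1,A6),(A1,A8),(A2,A6),(A2,A9),(A3,A7),(A3,A8),(A4,A7),(A4,A9),(A5,A8),(A5,A9)]"
  by (rule check_refuted[OF refs_Cons[OF refuted_0_4_6_6_2 refs_Cons[OF refuted_0_4_6_6_3 refs_Cons[OF refuted_0_4_6_6_5 refs_Nil]]], where c = "Split A2 False [Ref [A0,A1,A2,A3,A4,A5,A6,A7,A8,A9,B0,B1,B2,B3,B4,B5], Ref [A0,A1,A2,A3,A4,A5,A6,A7,A8,A9,B0,B1,B2,B3,B4,B5], Ref [A1,A0,A2,A3,A5,A4,A6,A8,A7,A9,B0,B1,B2,B3,B4,B5], Ref [A0,A1,A2,A3,A4,A5,A6,A7,A8,A9,B0,B1,B2,B3,B4,B5]]"]) (simp only: eval_rules types_rules)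

lemma refuted_0_4_6_6_7: "refuted (types 0 4 6 6) [(A0,A5),(A0,A6),(A0,A7),(A1,A6),(A1,A8),(A1,B0),(A2,A4),(A2,A6),(A2,A9),(A3,A7),(A3,A8),(A4,A7),(A4,A9),(A5,A8),(A5,A9)]"
  by (rule check_refuted[OF refs_Nil, where c = "Search"]) (simp only: eval_rules types_rules)

lemma refuted_0_4_6_6_8: "refuted (types 0 4 6 6) [(A0,A5),(A0,A6),(A0,A7),(A1,A6),(A1,A8),(A1,B0),(A2,A6),(A2,A9),(A2,B0),(A3,A7),(A3,A8),(A4,A7),(A4,A9),(A5,A8),(A5,A9)]"
  by (rule check_refuted[OF refs_Nil, where c = "Search"]) (simp only: eval_rules types_rules)

lemma refuted_0_4_6_6_9: "refuted (types 0 4 6 6) [(A0,A5),(A0,A6),(A0,A7),(A1,A6),(A1,A8),(A1,B0),(A2,A6),(A2,A9),(A2,B1),(A3,A7),(A3,A8),(A4,A7),(A4,A9),(A5,A8),(A5,A9)]"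
  by (rule check_refuted[OF refs_Nil, where c = "Search"]) (simp only: eval_rules types_rules)

lemma refuted_0_4_6_6_10: "refuted (types 0 4 6 6) [(A0,A5),(A0,A6),(A0,A7),(A1,A6),(A1,A8),(A1,B0),(A2,A6),(A2,A9),(A3,A7),(A3,A8),(A4,A7),(A4,A9),(A5,A8),(A5,A9)]"
  by (rule check_refuted[OF refs_Cons[OF refuted_0_4_6_6_7 refs_Cons[OF refuted_0_4_6_6_8 refs_Cons[OF refuted_0_4_6_6_9 refs_Nil]]], where c = "Split A2 False [Search, Ref [A0,A1,A2,A3,A4,A5,A6,A7,A8,A9,B0,B1,B2,B3,B4,B5], Ref [A0,A1,A2,A3,A4,A5,A6,A7,A8,A9,B0,B1,B2,B3,B4,B5], Ref [A0,A1,A2,A3,A4,A5,A6,A7,A8,A9,B0,B1,B2,B3,B4,B5]]"]) (simp only: eval_rules types_rules)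

lemma refuted_0_4_6_6_11: "refuted (types 0 4 6 6) [(A0,A6),(A0,A7),(A0,B0),(A1,A3),(A1,A6),(A1,A8),(A2,A5),(A2,A6),(A2,A9),(A3,A7),(A3,A8),(A4,A7),(A4,A9),(A5,A8),(A5,A9)]"
  by (rule check_refuted[OF refs_Nil, where c = "Search"]) (simp only: eval_rules types_rules)

lemma refuted_0_4_6_6_12: "refuted (types 0 4 6 6) [(A0,A6),(A0,A7),(A0,B0),(A1,A3),(A1,A6),(A1,A8),(A2,A6),(A2,A9),(A2,B0),(A3,A7),(A3,A8),(A4,A7),(A4,A9),(A5,A8),(A5,A9)]"
  by (rule check_refuted[OF refs_Nil, where c = "Search"]) (simp only: eval_rules types_rules)

lemma refuted_0_4_6_6_13: "refuted (types 0 4 6 6) [(A0,A6),(A0,A7),(A0,B0),(A1,A3),(A1,A6),(A1,A8),(A2,A6),(A2,A9),(A2,B1),(A3,A7),(A3,A8),(A4,A7),(A4,A9),(A5,A8),(A5,A9)]"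
  by (rule check_refuted[OF refs_Nil, where c = "Search"]) (simp only: eval_rules types_rules)

lemma refuted_0_4_6_6_14: "refuted (types 0 4 6 6) [(A0,A6),(A0,A7),(A0,B0),(A1,A6),(A1,A8),(A1,B0),(A2,A6),(A2,A9),(A2,B1),(A3,A4),(A3,A7),(A3,A8),(A4,A7),(A4,A9),(A5,A8),(A5,A9)]"
  by (rule check_refuted[OF refs_Nil, where c = "Search"]) (simp only: eval_rules types_rules)

lemma refuted_0_4_6_6_15: "refuted (types 0 4 6 6) [(A0,A6),(A0,A7),(A0,B0),(A1,A6),(A1,A8),(A1,B0),(A2,A6),(A2,A9),(A2,B1),(A3,A7),(A3,A8),(A4,A7),(A4,A9),(A5,A8),(A5,A9)]"
  by (rule check_refuted[OF refs_Cons[OF refuted_0_4_6_6_14 refs_Nil], where c = "Split A3 False [Ref [A0,A1,A2,A3,A4,A5,A6,A7,A8,A9,B0,B1,B2,B3,B4,B5], Ref [A1,A0,A2,A3,A5,A4,A6,A8,A7,A9,B0,B1,B2,B3,B4,B5], Search, Search]"]) (simp only: eval_rules types_rules)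

lemma refuted_0_4_6_6_16: "refuted (types 0 4 6 6) [(A0,A6),(A0,A7),(A0,B0),(A1,A6),(A1,A8),(A1,B1),(A2,A6),(A2,A9),(A2,B2),(A3,A4),(A3,A7),(A3,A8),(A4,A7),(A4,A9),(A5,A8),(A5,A9)]"
  by (rule check_refuted[OF refs_Nil, where c = "Search"]) (simp only: eval_rules types_rules)

lemma refuted_0_4_6_6_17: "refuted (types 0 4 6 6) [(A0,A6),(A0,A7),(A0,B0),(A1,A6),(A1,A8),(A1,B1),(A2,A6),(A2,A9),(A2,B2),(A3,A7),(A3,A8),(A3,B0),(A4,A7),(A4,A9),(A5,A8),(A5,A9)]"
  by (rule check_refuted[OF refs_Nil, where c = "Search"]) (simp only: eval_rules types_rules)

lemma refuted_0_4_6_6_18: "refuted (types 0 4 6 6) [(A0,A6),(A0,A7),(A0,B0),(A1,A6),(A1,A8),(A1,B1),(A2,A6),(A2,A9),(A2,B2),(A3,A7),(A3,A8),(A3,B3),(A4,A7),(A4,A9),(A4,B4),(A5,A8),(A5,A9),(A5,B1)]"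
  by (rule check_refuted[OF refs_Nil, where c = "Search"]) (simp only: eval_rules types_rules)

lemma refuted_0_4_6_6_19: "refuted (types 0 4 6 6) [(A0,A6),(A0,A7),(A1,A6),(A1,A8),(A2,A6),(A2,A9),(A3,A7),(A3,A8)]"
  by (rule check_refuted[OF refs_Cons[OF refuted_0_4_6_6_6 refs_Cons[OF refuted_0_4_6_6_2 refs_Cons[OF refuted_0_4_6_6_10 refs_Cons[OF refuted_0_4_6_6_5 refs_Cons[OF refuted_0_4_6_6_11 refs_Cons[OF refuted_0_4_6_6_12 refs_Cons[OF refuted_0_4_6_6_13 refs_Cons[OF refuted_0_4_6_6_7 refs_Cons[OF refuted_0_4_6_6_8 refs_Cons[OF refuted_0_4_6_6_15 refs_Cons[OF refuted_0_4_6_6_9 refs_Cons[OF refuted_0_4_6_6_16 refs_Cons[OF refuted_0_4_6_6_17 refs_Cons[OF refuted_0_4_6_6_18 refs_Nil]]]]]]]]]]]]]], where c = "Split A7 False [Split A4 True [Search, Split A8 False [Split A5 True [Split A0 False [Ref [A0,A1,A2,A3,A4,A5,A6,A7,A8,A9,B0,B1,B2,B3,B4,B5], Ref [A0,A2,A1,A4,A3,A5,A6,A7,A9,A8,B0,B1,B2,B3,B4,B5], Ref [A0,A3,A4,A1,A2,A5,A7,A6,A8,A9,B0,B1,B2,B3,B4,B5], Ref [A0,A4,A3,A2,A1,A5,A7,A6,A9,A8,B0,B1,B2,B3,B4,B5], Split A1 False [Ref [A1,A2,A0,A5,A3,A4,A6,A8,A9,A7,B0,B1,B2,B3,B4,B5],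 Ref [A1,A3,A5,A0,A2,A4,A8,A6,A7,A9,B0,B1,B2,B3,B4,B5], Search, Ref [A0,A1,A2,A3,A4,A5,A6,A7,A8,A9,B0,B1,B2,B3,B4,B5]], Split A1 False [Ref [A1,A2,A0,A5,A3,A4,A6,A8,A9,A7,B0,B1,B2,B3,B4,B5], Split A2 False [Search, Ref [A0,A1,A2,A3,A4,A5,A6,A7,A8,A9,B0,B1,B2,B3,B4,B5], Ref [A0,A1,A2,A3,A4,A5,A6,A7,A8,A9,B0,B1,B2,B3,B4,B5], Ref [A0,A1,A2,A3,A4,A5,A6,A7,A8,A9,B0,B1,B2,B3,B4,B5]], Ref [A1,A0,A2,A3,A5,A4,A6,A8,A7,A9,B0,B1,B2,B3,B4,B5], Split A2 False [Ref [A2,A0,A1,A4,A5,A3,A6,A9,A7,A8,B0,B1,B2,B3,B4,B5], Ref [A0,A2,A1,A4,A3,A5,A6,A7,A9,A8,B0,B1,B2,B3,B4,B5], Ref [A2,A1,A0,A5,A4,A3,A6,A9,A8,A7,B0,B1,B2,B3,B4,B5], Ref [A2,A1,A0,A5,A4,A3,A6,A9,A8,A7,B1,B0,B2,B3,B4,B5]], Split A2 False [Ref [A2,A0,A1,A4,A5,A3,A6,A9,A7,A8,B0,B1,B2,B3,B4,B5], Ref [A0,A2,A1,A4,A3,A5,A6,A7,A9,A8,B0,B1,B2,B3,B4,B5], Ref [A1,A2,A0,A5,A3,A4,A6,A8,A9,A7,B0,B1,B2,B3,B4,B5], Ref [A0,A1,A2,A3,A4,A5,A6,A7,A8,A9,B0,B1,B2,B3,B4,B5]],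 Split A2 False [Ref [A2,A0,A1,A4,A5,A3,A6,A9,A7,A8,B0,B1,B2,B3,B4,B5], Ref [A0,A2,A1,A4,A3,A5,A6,A7,A9,A8,B0,B1,B2,B3,B4,B5], Ref [A1,A2,A0,A5,A3,A4,A6,A8,A9,A7,B1,B0,B2,B3,B4,B5], Ref [A0,A2,A1,A4,A3,A5,A6,A7,A9,A8,B0,B1,B2,B3,B4,B5], Ref [A1,A2,A0,A5,A3,A4,A6,A8,A9,A7,B1,B0,B2,B3,B4,B5], Split A3 False [Ref [A0,A1,A2,A3,A4,A5,A6,A7,A8,A9,B0,B1,B2,B3,B4,B5], Ref [A1,A0,A2,A3,A5,A4,A6,A8,A7,A9,B1,B0,B2,B3,B4,B5], Ref [A0,A1,A2,A3,A4,A5,A6,A7,A8,A9,B0,B1,B2,B3,B4,B5], Ref [A1,A0,A2,A3,A5,A4,A6,A8,A7,A9,B1,B0,B2,B3,B4,B5], Search, Split A4 False [Search, Search, Search, Search, Search, Split A5 False [Search, Ref [A0,A1,A2,A3,A4,A5,A6,A7,A8,A9,B0,B1,B2,B3,B4,B5], Ref [A0,A2,A1,A4,A3,A5,A6,A7,A9,A8,B0,B2,B1,B4,B3,B5], Ref [A0,A3,A4,A1,A2,A5,A7,A6,A8,A9,B0,B3,B4,B1,B2,B5], Ref [A0,A4,A3,A2,A1,A5,A7,A6,A9,A8,B0,B4,B3,B2,B1,B5], Search]]]]]]]]]]"]) (simp only: eval_rules types_rules)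

lemma refuted_0_4_6_6: "refuted (types 0 4 6 6) []"
  by (rule check_refuted[OF refs_Cons[OF refuted_0_4_6_6_1 refs_Cons[OF refuted_0_4_6_6_19 refs_Nil]], where c = "Split A6 False [Split A0 True [Split A6 False [Split A1 True [Search, Split A6 False [Split A2 True [Ref [A0,A1,A2,A3,A4,A5,A6,A7,A8,A9,B0,B1,B2,B3,B4,B5], Ref [A1,A0,A2,A3,A4,A5,A6,A8,A7,A9,B0,B1,B2,B3,B4,B5], Split A7 False [Split A3 True [Ref [A0,A1,A2,A3,A4,A5,A6,A7,A8,A9,B0,B1,B2,B3,B4,B5], Ref [A0,A2,A1,A3,A4,A5,A6,A7,A9,A8,B0,B1,B2,B3,B4,B5]]]]]]]]]"]) (simp only: eval_rules types_rules)

subsection \<open>Nullity\<close>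

text \<open>Conjugating t - A by the matrix P with columns x, e_1, ... makes the first column divisible by t.\<close>

lemma order_char_poly_iff:
  fixes A :: "real mat" and x :: "nat \<Rightarrow> real"
  assumes A: "A \<in> carrier_mat (Suc m) (Suc m)"
    and sym: "\<And>i j. i \<le> m \<Longrightarrow> j \<le> m \<Longrightarrow> A $$ (i, j) = A $$ (j, i)"
    and ker: "\<And>i. i \<le> m \<Longrightarrow> (\<Sum>k\<le>m. A $$ (i, k) * x k) = 0" and x0: "x 0 \<noteq> 0"
  defines "E \<equiv> mat m m (\<lambda>(i, j). - A $$ (Suc i, Suc j))"
  shows "Polynomial.order 0 (char_poly A) = 1 \<longleftrightarrow> det E \<noteq> 0"
proof -
  let ?n = "Suc m" and ?X = "[:0, 1:] :: real poly"
  define M where "M = char_poly_matrix A"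
  \<comment> \<open>Since A x = 0, the first column of \<open>M * P\<close> is t times x. In the
    product with the transpose of \<open>P\<close>, the matrix \<open>D\<close> carries this factor
    t of the first column and \<open>R\<close> is the cofactor.\<close>
  define P where "P = mat ?n ?n (\<lambda>(i, j). if j = 0 then [:x i:] else if i = j then 1 else 0)"
  define D where "D = mat ?n ?n (\<lambda>(i, j). if i = j then (if i = 0 then ?X else 1) else 0)"
  define s where "s = (\<Sum>k\<le>m. x k * x k)"
  define R where "R = mat ?n ?n (\<lambda>(i, j). if j = 0 then (if i = 0 then [:s:] else [:x i:])
    else if i = 0 then [:0, x j:] else M $$ (i, j))"
  have cM: "M \<in> carrier_mat ?n ?n" unfolding M_def using A by simp
  have cP: "P \<in> carrier_mat ?n ?n" and cD: "D \<in> carrier_mat ?n ?n" and cR: "R \<in> carrier_mat ?n ?n"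
    by (simp_all add: P_def D_def R_def)
  have M: "M $$ (i, j) = (if i = j then ?X else 0) + [:- A $$ (i, j):]" if "i \<le> m" "j \<le> m" for i j
    using A that by (simp add: M_def char_poly_matrix_def)
  have s: "s > 0"
    unfolding s_def by (rule sum_pos2[of _ 0]) (use x0 in \<open>auto simp: zero_less_mult_iff\<close>)
  have prod_entry: "(B * C) $$ (i, j) = (\<Sum>k\<le>m. B $$ (i, k) * C $$ (k, j))"
    if "B \<in> carrier_mat ?n ?n" "C \<in> carrier_mat ?n ?n" "i \<le> m" "j \<le> m" for B C :: "real poly mat" and i j
    using that by (simp add: scalar_prod_def atLeast0LessThan lessThan_Suc_atMost)
  have pC: "[:\<Sum>k\<in>K. f k:] = (\<Sum>k\<in>K. [:f k:])" for f :: "nat \<Rightarrow> real" and K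
  proof (induction K rule: infinite_finite_induct)
    case (insert k K)
    then show ?case by (simp flip: insert.IH)
  qed simp_all
  have MP: "(M * P) $$ (i, j) = (if j = 0 then [:0, x i:] else M $$ (i, j))" if i: "i \<le> m" and j: "j \<le> m" for i j
  proof (cases "j = 0")
    case True
    have "(M * P) $$ (i, j) = (\<Sum>k\<le>m. M $$ (i, k) * [:x k:])"
      unfolding prod_entry[OF cM cP i j] by (rule sum.cong) (use True in \<open>auto simp: P_def\<close>)
    also have "\<dots> = (\<Sum>k\<le>m. (if i = k then [:0, x k:] else 0) + [:- (A $$ (i, k) * x k):])"
      by (rule sum.cong) (use i in \<open>auto simp: M\<close>)
    also have "\<dots> = [:0, x i:] + [:- (\<Sum>k\<le>m. A $$ (i, k) * x k):]"
      using i by (simp add: sum.distrib pC sum_negf[symmetric])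
    finally show ?thesis using True ker[OF i] by simp
  next
    case False
    have "(M * P) $$ (i, j) = (\<Sum>k\<le>m. if k = j then M $$ (i, k) else 0)"
      unfolding prod_entry[OF cM cP i j] by (rule sum.cong) (use False j in \<open>auto simp: P_def\<close>)
    then show ?thesis using False j by simp
  qed
  have cMP: "M * P \<in> carrier_mat ?n ?n" and cPT: "transpose_mat P \<in> carrier_mat ?n ?n" using cM cP by simp_all
  have "transpose_mat P * (M * P) = R * D"
  proof (rule eq_matI)
    fix i j assume "i < dim_row (R * D)" "j < dim_col (R * D)"
    then have i: "i \<le> m" and j: "j \<le> m" using cR cD by auto
    have RD: "(R * D) $$ (i, j) = R $$ (i, j) * (if j = 0 then ?X else 1)"
    proof -
      have "(R * D) $$ (i, j) = (\<Sum>k\<le>m. if k = j then R $$ (i, k) * (if j = 0 then ?X else 1) else 0)"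
        unfolding prod_entry[OF cR cD i j] by (rule sum.cong) (use j in \<open>auto simp: D_def\<close>)
      then show ?thesis using j by simp
    qed
    have L: "(transpose_mat P * (M * P)) $$ (i, j) = (\<Sum>k\<le>m. P $$ (k, i) * (M * P) $$ (k, j))"
      unfolding prod_entry[OF cPT cMP i j] by (rule sum.cong) (use i cP in auto)
    show "(transpose_mat P * (M * P)) $$ (i, j) = (R * D) $$ (i, j)"
    proof (cases "i = 0")
      case False
      have "(transpose_mat P * (M * P)) $$ (i, j) = (\<Sum>k\<le>m. if k = i then (M * P) $$ (k, j) else 0)"
        unfolding L by (rule sum.cong) (use False i in \<open>auto simp: P_def\<close>)
      then have "(transpose_mat P * (M * P)) $$ (i, j) = (M * P) $$ (i, j)" using i by simp
      then show ?thesis unfolding RD MP[OF i j] using False i j by (simp add: R_def)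
    next
      case True
      have L0: "(transpose_mat P * (M * P)) $$ (i, j) = (\<Sum>k\<le>m. [:x k:] * (M * P) $$ (k, j))"
        unfolding L by (rule sum.cong) (use True in \<open>auto simp: P_def\<close>)
      show ?thesis
      proof (cases "j = 0")
        case True
        have "(\<Sum>k\<le>m. [:x k:] * (M * P) $$ (k, j)) = (\<Sum>k\<le>m. [:0, 1:] * [:x k * x k:])"
          by (rule sum.cong) (use True MP j in auto)
        then show ?thesis unfolding L0 RD sum_distrib_left[symmetric] pC[symmetric]
          using True \<open>i = 0\<close> by (simp add: R_def s_def)
      next
        case False
        have "(\<Sum>k\<le>m. [:x k:] * (M * P) $$ (k, j)) =
            (\<Sum>k\<le>m. (if k = j then [:0, x k:] else 0) + [:- (A $$ (j, k) * x k):])"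
          by (rule sum.cong) (use False j sym in \<open>auto simp: MP M\<close>)
        also have "\<dots> = [:0, x j:] + [:- (\<Sum>k\<le>m. A $$ (j, k) * x k):]"
          using j by (simp add: sum.distrib pC sum_negf[symmetric])
        finally show ?thesis unfolding L0 RD using False \<open>i = 0\<close> i j ker[OF j] by (simp add: R_def)
      qed
    qed
  qed (use cM cP cR cD in auto)
  then have "det P * (det M * det P) = det R * det D"
    using det_mult[OF cPT cMP] det_mult[OF cM cP] det_mult[OF cR cD] det_transpose[OF cP] by simp
  moreover have "det P = [:x 0:]"
  proof -
    have "det P = (\<Prod>i\<in>{0..<?n}. P $$ (i, i))"
      using det_lower_triangular[OF _ cP] cP by (simp add: P_def prod_list_diag_prod)
    also have "\<dots> = (\<Prod>i\<in>{0..<?n}. if i = 0 then [:x 0:] else 1)"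
      by (rule prod.cong) (auto simp: P_def)
    finally show ?thesis by (simp add: prod.delta)
  qed
  moreover have "det D = ?X"
  proof -
    have "det D = (\<Prod>i\<in>{0..<?n}. D $$ (i, i))"
      using det_lower_triangular[OF _ cD] cD by (simp add: D_def prod_list_diag_prod)
    also have "\<dots> = (\<Prod>i\<in>{0..<?n}. if i = 0 then ?X else 1)"
      by (rule prod.cong) (auto simp: D_def)
    finally show ?thesis by (simp add: prod.delta)
  qed
  \<comment> \<open>Hence 0 is a simple root exactly if \<open>det R\<close> does not vanish at
    0.\<close>
  ultimately have eq: "Polynomial.smult (x 0 * x 0) (char_poly A) = ?X * det R"
    by (simp add: char_poly_def M_def mult_ac)
  have nz: "char_poly A \<noteq> 0" using degree_monic_char_poly[OF A] by auto
  then have R0: "det R \<noteq> 0" using eq x0 by auto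
  have "Polynomial.order 0 (char_poly A) = Polynomial.order 0 (Polynomial.smult (x 0 * x 0) (char_poly A))" using x0 by (simp add: order_smult)
  also have "\<dots> = Polynomial.order 0 ?X + Polynomial.order 0 (det R)" unfolding eq by (rule order_mult) (use R0 in simp)
  also have "Polynomial.order 0 ?X = 1" using order_power_n_n[of "0 :: real" 1] by simp
  finally have "Polynomial.order 0 (char_poly A) = 1 \<longleftrightarrow> poly (det R) 0 \<noteq> 0"
    using order_root[of "det R" 0] R0 by simp
  also have "poly (det R) 0 = det (map_mat (\<lambda>p. poly p 0) R)"
  proof -
    have "comm_ring_hom (\<lambda>p :: real poly. poly p 0)" by unfold_locales simp_all
    then show ?thesis by (rule comm_ring_hom.hom_det[symmetric])
  qed
  \<comment> \<open>At t = 0 the first row of \<open>R\<close> is (s, 0, ..., 0) with s the squared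
    norm of x, so only \<open>E\<close> decides.\<close>
  also have "map_mat (\<lambda>p. poly p 0) R =
      four_block_mat (mat 1 1 (\<lambda>_. s)) (0\<^sub>m 1 m) (mat m 1 (\<lambda>(i, j). x (Suc i))) E"
    by (rule eq_matI) (auto simp: R_def E_def M)
  also have "det \<dots> = det (mat 1 1 (\<lambda>_. s)) * det E"
    by (rule det_four_block_mat_upper_right_zero) (auto simp: E_def intro: mat_carrier)
  also have "det (mat 1 1 (\<lambda>_. s)) = s" by (subst det_single) simp_all
  finally show ?thesis using s by simp
qed

text \<open>\<open>E\<close> is - A without row and column 0, so its null vectors correspond to
  kernel vectors of A that vanish at 0. The deleted row causes no loss, because by symmetry the rows
  satisfy the relation with coefficients x, in which row 0 has the nonzero coefficient
  \<open>x 0\<close>.\<close>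

lemma order_char_poly_eq_1:
  fixes A :: "real mat" and x :: "nat \<Rightarrow> real"
  assumes A: "A \<in> carrier_mat n n" and n: "n > 0"
    and sym: "\<And>i j. i < n \<Longrightarrow> j < n \<Longrightarrow> A $$ (i, j) = A $$ (j, i)"
    and ker: "\<And>i. i < n \<Longrightarrow> (\<Sum>k<n. A $$ (i, k) * x k) = 0" and x0: "x 0 \<noteq> 0"
  shows "Polynomial.order 0 (char_poly A) = 1 \<longleftrightarrow>
    (\<forall>y. (\<forall>i<n. (\<Sum>k<n. A $$ (i, k) * y k) = 0) \<and> y 0 = 0 \<longrightarrow> (\<forall>i<n. y i = 0))"
proof -
  obtain m where m: "n = Suc m" using n by (cases n) auto
  define E where "E = mat m m (\<lambda>(i, j). - A $$ (Suc i, Suc j))"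
  have cE: "E \<in> carrier_mat m m" by (simp add: E_def)
  have "Polynomial.order 0 (char_poly A) = 1 \<longleftrightarrow> det E \<noteq> 0"
    unfolding E_def by (rule order_char_poly_iff[where x = x])
      (use A sym ker x0 m in \<open>auto simp: lessThan_Suc_atMost less_Suc_eq_le\<close>)
  also have "\<dots> \<longleftrightarrow> \<not> (\<exists>v. v \<in> carrier_vec m \<and> v \<noteq> 0\<^sub>v m \<and> E *\<^sub>v v = 0\<^sub>v m)"
    using det_0_iff_vec_prod_zero[OF cE] by simp
  also have "\<dots> \<longleftrightarrow> (\<forall>y. (\<forall>i<n. (\<Sum>k<n. A $$ (i, k) * y k) = 0) \<and> y 0 = 0 \<longrightarrow> (\<forall>i<n. y i = 0))"
  proof -
    have E: "(E *\<^sub>v v) $ i = - (\<Sum>k<m. A $$ (Suc i, Suc k) * v $ k)" if "v \<in> carrier_vec m" "i < m" for v i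
      using that by (simp add: E_def scalar_prod_def atLeast0LessThan sum_negf)
    have *: "\<exists>v. v \<in> carrier_vec m \<and> v \<noteq> 0\<^sub>v m \<and> E *\<^sub>v v = 0\<^sub>v m"
      if y: "\<forall>i<n. (\<Sum>k<n. A $$ (i, k) * y k) = 0" "y 0 = 0" and i: "i < n" "y i \<noteq> 0" for y i
    proof (intro exI conjI)
      let ?v = "vec m (\<lambda>i. y (Suc i))"
      show "?v \<in> carrier_vec m" by simp
      obtain j where j: "i = Suc j" using i(2) y(2) by (cases i) auto
      have "?v $ j \<noteq> 0\<^sub>v m $ j" using i j m by simp
      then show "?v \<noteq> 0\<^sub>v m" by metis
      show "E *\<^sub>v ?v = 0\<^sub>v m"
      proof (rule eq_vecI)
        fix i assume i: "i < dim_vec (0\<^sub>v m)"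
        have "(\<Sum>k<n. A $$ (Suc i, k) * y k) = 0" using y(1) i m by auto
        then have "(\<Sum>k<m. A $$ (Suc i, Suc k) * y (Suc k)) = 0"
          unfolding m sum.lessThan_Suc_shift using y(2) by simp
        then show "(E *\<^sub>v ?v) $ i = 0\<^sub>v m $ i" using i by (simp add: E)
      qed (simp add: E_def)
    qed
    have "False" if v: "v \<in> carrier_vec m" "v \<noteq> 0\<^sub>v m" "E *\<^sub>v v = 0\<^sub>v m"
      and y: "\<forall>y. (\<forall>i<n. (\<Sum>k<n. A $$ (i, k) * y k) = 0) \<and> y 0 = 0 \<longrightarrow> (\<forall>i<n. y i = 0)" for v
    proof -
      define z where "z k = (case k of 0 \<Rightarrow> 0 | Suc k \<Rightarrow> v $ k)" for k
      have row: "(\<Sum>k<n. A $$ (i, k) * z k) = (\<Sum>k<m. A $$ (i, Suc k) * v $ k)" for i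
        unfolding m sum.lessThan_Suc_shift by (simp add: z_def)
      have z1: "(\<Sum>k<n. A $$ (Suc i, k) * z k) = 0" if "i < m" for i
        unfolding row using E[OF v(1) that] v(3) that by simp
      \<comment> \<open>The right side vanishes as A x = 0; on the left only the term of row 0 can
        survive, so row 0 holds too.\<close>
      have "(\<Sum>i<n. x i * (\<Sum>k<n. A $$ (i, k) * z k)) = (\<Sum>k<n. z k * (\<Sum>i<n. A $$ (k, i) * x i))"
        unfolding sum_distrib_left by (subst sum.swap) (intro sum.cong refl, use sym in \<open>simp add: mult_ac\<close>)
      also have "\<dots> = 0" using ker by simp
      finally have "(\<Sum>i<n. x i * (\<Sum>k<n. A $$ (i, k) * z k)) = 0" .
      moreover have "(\<Sum>i<n. x i * (\<Sum>k<n. A $$ (i, k) * z k)) = x 0 * (\<Sum>k<n. A $$ (0, k) * z k)"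
        using z1 unfolding m sum.lessThan_Suc_shift[of "\<lambda>i. x i * (\<Sum>k<Suc m. A $$ (i, k) * z k)"] by simp
      ultimately have z0: "(\<Sum>k<n. A $$ (0, k) * z k) = 0" using x0 by simp
      have "(\<Sum>k<n. A $$ (i, k) * z k) = 0" if "i < n" for i
        using z0 z1 that m by (cases i) auto
      then have "\<forall>i<n. z i = 0" using y by (simp add: z_def)
      then have "v $ k = 0" if "k < m" for k using that m by (auto simp: z_def dest!: spec[of _ "Suc k"])
      then have "v = 0\<^sub>v m" using v(1) by (intro eq_vecI) auto
      then show False using v(2) by simp
    qed
    then show ?thesis using * by blast
  qed
  finally show ?thesis .
qed

section \<open>From digraphs to neighbourhood functions\<close>

definition nbhd :: "nat pair_pre_digraph \<Rightarrow> nat \<Rightarrow> nat set" where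
  "nbhd G v = {u. (v, u) \<in> parcs G}"

lemma simple_graph_on_verts: "simple_graph_on n G \<Longrightarrow> pverts G = {..<n}"
  unfolding simple_graph_on_def atLeast0LessThan by (rule conjunct2)

lemma (in pair_graph) arc_reverse: "(u, v) \<in> parcs G \<Longrightarrow> (v, u) \<in> parcs G"
  using pair_sym_arcs unfolding symmetric_def with_proj_simps by (rule symD)

lemma (in pair_graph) arc_ends_distinct: "(u, u) \<notin> parcs G"
  using pair_no_loops[of "(u, u)"] unfolding fst_conv snd_conv by blast

lemma simple_graph_nbhd:
  assumes "simple_graph_on n G"
  shows "nbhd G v \<subseteq> {..<n}" "v \<notin> nbhd G v" "u \<in> nbhd G v \<longleftrightarrow> v \<in> nbhd G u"
proof -
  have G: "pair_graph G" using assms unfolding simple_graph_on_def by (rule conjunct1)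
  then have wf: "pair_wf_digraph G" by (simp add: pair_graph_def pair_digraph_def pair_loopfree_digraph_def)
  show "nbhd G v \<subseteq> {..<n}"
    using pair_wf_digraph.in_arcsD2[OF wf, of v]
    unfolding nbhd_def simple_graph_on_verts[OF assms, symmetric] by blast
  show "v \<notin> nbhd G v" using pair_graph.arc_ends_distinct[OF G] unfolding nbhd_def by blast
  show "u \<in> nbhd G v \<longleftrightarrow> v \<in> nbhd G u"
    using pair_graph.arc_reverse[OF G] unfolding nbhd_def by blast
qed

lemma cubic_graph_iff:
  assumes "simple_graph_on n G"
  shows "cubic_graph G \<longleftrightarrow> (\<forall>v<n. card (nbhd G v) = 3)"
proof -
  have V: "pverts G = {..<n}" by (rule simple_graph_on_verts[OF assms])
  have "out_degree (with_proj G) v = card (nbhd G v)" for v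
  proof -
    have "out_arcs (with_proj G) v = Pair v ` nbhd G v"
      by (auto simp: out_arcs_def nbhd_def)
    then show ?thesis unfolding out_degree_def by (simp add: card_image inj_on_def)
  qed
  then show ?thesis unfolding cubic_graph_def V by (simp add: Ball_def)
qed

lemma adjacency_carrier: "simple_graph_on n G \<Longrightarrow> adjacency_matrix G \<in> carrier_mat n n"
  by (simp add: adjacency_matrix_def simple_graph_on_verts)

lemma adjacency_entry:
  "simple_graph_on n G \<Longrightarrow> i < n \<Longrightarrow> j < n \<Longrightarrow> adjacency_matrix G $$ (i, j) = of_bool (j \<in> nbhd G i)"
  by (simp add: adjacency_matrix_def simple_graph_on_verts nbhd_def)

lemma sum_nbhd:
  fixes x :: "nat \<Rightarrow> 'a :: comm_semiring_1"
  assumes "simple_graph_on n G"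
  shows "(\<Sum>k<n. of_bool (k \<in> nbhd G i) * x k) = (\<Sum>k\<in>nbhd G i. x k)"
proof -
  have "(\<Sum>k<n. of_bool (k \<in> nbhd G i) * x k) = (\<Sum>k\<in>{..<n} \<inter> nbhd G i. x k)"
    unfolding sum.inter_restrict[OF finite_lessThan] by (rule sum.cong) simp_all
  then show ?thesis using simple_graph_nbhd(1)[OF assms] by (simp add: Int_absorb1)
qed

lemma sum_adjacency:
  assumes "simple_graph_on n G" "i < n"
  shows "(\<Sum>k<n. adjacency_matrix G $$ (i, k) * x k) = (\<Sum>k\<in>nbhd G i. x k)"
  unfolding sum_nbhd[OF assms(1), symmetric]
  by (rule sum.cong) (use adjacency_entry[OF assms] in auto)

lemma mat_kernel_iff:
  assumes G: "simple_graph_on n G" and x: "x \<in> carrier_vec n"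
  shows "x \<in> mat_kernel (adjacency_matrix G) \<longleftrightarrow> kernel {..<n} (nbhd G) (\<lambda>i. x $ i)"
proof -
  note A = adjacency_carrier[OF G]
  have "(adjacency_matrix G *\<^sub>v x) $ i = (\<Sum>k\<in>nbhd G i. x $ k)" if "i < n" for i
    using A x that sum_adjacency[OF G that, of "\<lambda>k. x $ k"] by (simp add: scalar_prod_def atLeast0LessThan)
  moreover have "dim_vec (adjacency_matrix G *\<^sub>v x) = n" using A by simp
  ultimately have "adjacency_matrix G *\<^sub>v x = 0\<^sub>v n \<longleftrightarrow> kernel {..<n} (nbhd G) (\<lambda>i. x $ i)"
    unfolding kernel_def vec_eq_iff by auto
  then show ?thesis using A x by (auto simp: mat_kernel_def)
qed

lemma core_vertex_iff:
  assumes G: "simple_graph_on n G" and v: "v < n"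
  shows "core_vertex G v \<longleftrightarrow> (\<exists>x. kernel {..<n} (nbhd G) x \<and> x v \<noteq> 0)"
proof -
  have V: "pverts G = {..<n}" by (rule simple_graph_on_verts[OF G])
  have cong: "kernel {..<n} (nbhd G) (\<lambda>i. vec n x $ i)" if x: "kernel {..<n} (nbhd G) x" for x
  proof -
    have "(\<Sum>u\<in>nbhd G w. vec n x $ u) = (\<Sum>u\<in>nbhd G w. x u)" for w
      by (rule sum.cong) (use simple_graph_nbhd(1)[OF G, of w] in auto)
    then show ?thesis using x by (simp only: kernel_def)
  qed
  have "mat_kernel (adjacency_matrix G) \<subseteq> carrier_vec n"
    using adjacency_carrier[OF G] by (auto simp: mat_kernel_def)
  then have "core_vertex G v \<longleftrightarrow> (\<exists>x \<in> carrier_vec n. kernel {..<n} (nbhd G) (\<lambda>i. x $ i) \<and> x $ v \<noteq> 0)"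
    unfolding core_vertex_def V using v mat_kernel_iff[OF G] by (auto simp: subset_iff)
  also have "\<dots> \<longleftrightarrow> (\<exists>x. kernel {..<n} (nbhd G) x \<and> x v \<noteq> 0)"
  proof
    assume "\<exists>x. kernel {..<n} (nbhd G) x \<and> x v \<noteq> 0"
    then obtain x where x: "kernel {..<n} (nbhd G) x" "x v \<noteq> 0" by blast
    show "\<exists>x \<in> carrier_vec n. kernel {..<n} (nbhd G) (\<lambda>i. x $ i) \<and> x $ v \<noteq> 0"
      by (rule bexI[of _ "vec n x"]) (use cong[OF x(1)] x(2) v in simp_all)
  qed blast
  finally show ?thesis .
qed

lemma nullity_eq_1:
  assumes G: "simple_graph_on n G" and x: "kernel {..<n} (nbhd G) x" "x 0 \<noteq> 0" and n: "n > 0"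
  shows "nullity G = 1 \<longleftrightarrow> (\<forall>y. kernel {..<n} (nbhd G) y \<and> y 0 = 0 \<longrightarrow> (\<forall>i<n. y i = 0))"
proof -
  note sum = sum_adjacency[OF G]
  have "nullity G = 1 \<longleftrightarrow> (\<forall>y. (\<forall>i<n. (\<Sum>k<n. adjacency_matrix G $$ (i, k) * y k) = 0) \<and> y 0 = 0 \<longrightarrow> (\<forall>i<n. y i = 0))"
    unfolding nullity_def
  proof (rule order_char_poly_eq_1[OF adjacency_carrier[OF G] n])
    show "adjacency_matrix G $$ (i, j) = adjacency_matrix G $$ (j, i)" if "i < n" "j < n" for i j
      using adjacency_entry[OF G] that simple_graph_nbhd(3)[OF G] by auto
    show "(\<Sum>k<n. adjacency_matrix G $$ (i, k) * x k) = 0" if "i < n" for i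
      unfolding sum[OF that] using x(1) that by (simp add: kernel_def)
    show "x 0 \<noteq> 0" by (rule x)
  qed
  then show ?thesis using sum by (simp add: kernel_def Ball_def)
qed

lemma kernel_diff:
  assumes "kernel V N x" "kernel V N y"
  shows "kernel V N (\<lambda>i. y i - c * x i)"
proof -
  have "(\<Sum>i\<in>N v. y i - c * x i) = (\<Sum>i\<in>N v. y i) - c * (\<Sum>i\<in>N v. x i)" for v
    by (simp add: sum_subtractf sum_distrib_left)
  then show ?thesis using assms unfolding kernel_def by simp
qed

text \<open>With nullity one, a kernel vector is determined by its value at 0 and so is a multiple
  of one vector x. The core condition at each vertex then forces x to be nowhere zero.\<close>

lemma nut_graph_imp_nut_on:
  assumes G: "simple_graph_on n G" and n: "n > 0" and nut: "nut_graph G"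
  shows "nut_on {..<n} (nbhd G)"
proof -
  have V: "pverts G = {..<n}" by (rule simple_graph_on_verts[OF G])
  let ?k = "kernel {..<n} (nbhd G)"
  have n1: "nullity G = 1" using nut unfolding nut_graph_def by (rule conjunct2)
  have cv: "\<forall>v \<in> {..<n}. core_vertex G v"
    using nut unfolding nut_graph_def core_graph_def V by (elim conjE)
  have core: "\<exists>x. ?k x \<and> x v \<noteq> 0" if v: "v < n" for v
    unfolding core_vertex_iff[OF G v, symmetric] using cv v by (simp only: Ball_def lessThan_iff)
  obtain x where x: "?k x" "x 0 \<noteq> 0" using core[OF n] by (elim exE conjE)
  have mult: "y i = y 0 / x 0 * x i" if y: "?k y" and i: "i < n" for y i
  proof -
    have z: "\<forall>y. ?k y \<and> y 0 = 0 \<longrightarrow> (\<forall>i<n. y i = 0)"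
      using n1 unfolding nullity_eq_1[OF G x n] .
    define d where "d i = y i - y 0 / x 0 * x i" for i
    have "?k d" unfolding d_def by (rule kernel_diff[OF x(1) y])
    moreover have "d 0 = 0" using x(2) by (simp add: d_def)
    ultimately have "d i = 0" using z i by blast
    then show ?thesis by (simp add: d_def)
  qed
  have full: "x i \<noteq> 0" if i: "i < n" for i
  proof
    assume x0: "x i = 0"
    obtain y where y: "?k y" "y i \<noteq> 0" using core[OF i] by (elim exE conjE)
    show False using mult[OF y(1) i] y(2) unfolding x0 by simp
  qed
  have nz: "y v \<noteq> 0" if y: "?k y" and u: "u < n" "y u \<noteq> 0" and v: "v < n" for y u v
  proof
    assume v0: "y v = 0"
    have "y 0 / x 0 * x v = 0" using mult[OF y v] v0 by simp
    then have "y 0 / x 0 = 0" using full[OF v] by (simp only: mult_eq_0_iff) simp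
    then show False using mult[OF y u(1)] u(2) by (simp only: mult_zero_left)
  qed
  show ?thesis
    unfolding nut_on_def
  proof (intro conjI)
    show "finite {..<n}" by simp
    show "\<forall>v\<in>{..<n}. nbhd G v \<subseteq> {..<n} \<and> v \<notin> nbhd G v"
      by (intro ballI conjI simple_graph_nbhd[OF G])
    show "\<forall>u\<in>{..<n}. \<forall>v\<in>{..<n}. u \<in> nbhd G v \<longrightarrow> v \<in> nbhd G u"
      using simple_graph_nbhd(3)[OF G] by blast
    show "\<exists>x. ?k x \<and> (\<exists>v\<in>{..<n}. x v \<noteq> 0)"
      by (rule exI[of _ x], rule conjI[OF x(1)], rule bexI[of _ 0], rule x(2)) (simp add: n)
    show "\<forall>x. ?k x \<and> (\<exists>v\<in>{..<n}. x v \<noteq> 0) \<longrightarrow> (\<forall>v\<in>{..<n}. x v \<noteq> 0)"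
      using nz by (simp only: Bex_def Ball_def lessThan_iff) blast
  qed
qed

lemma nut_on_imp_nut_graph:
  assumes G: "simple_graph_on n G" and n: "n > 0" and nut: "nut_on {..<n} (nbhd G)"
  shows "nut_graph G"
proof -
  have V: "pverts G = {..<n}" by (rule simple_graph_on_verts[OF G])
  obtain x where x: "kernel {..<n} (nbhd G) x" "\<And>v. v \<in> {..<n} \<Longrightarrow> x v \<noteq> 0"
    using nut_on_kernel[OF nut] by blast
  have x0: "x 0 \<noteq> 0" using x(2) n by simp
  have "nullity G = 1"
    unfolding nullity_eq_1[OF G x(1) x0 n]
  proof (intro allI impI, rule ccontr)
    fix y i assume y: "kernel {..<n} (nbhd G) y \<and> y 0 = 0" and i: "i < n" "y i \<noteq> 0"
    have "y 0 \<noteq> 0" by (rule nut_on_full[OF nut conjunct1[OF y], of i]) (use i n in simp_all)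
    then show False using y by simp
  qed
  moreover have "core_vertex G v" if v: "v < n" for v
    unfolding core_vertex_iff[OF G v] by (rule exI[of _ x]) (use x v in simp)
  ultimately show ?thesis unfolding nut_graph_def core_graph_def V by simp
qed

text \<open>Singularity passes through the determinant, which is the same integer over both rings; a
  zero determinant over the integers again yields a nonzero null vector.\<close>

lemma integer_kernel:
  assumes G: "simple_graph_on n G" and x: "kernel {..<n} (nbhd G) x" "\<exists>v<n. x v \<noteq> 0"
  shows "\<exists>y :: nat \<Rightarrow> int. (\<forall>v\<in>{..<n}. (\<Sum>u\<in>nbhd G v. y u) = 0) \<and> (\<exists>v\<in>{..<n}. y v \<noteq> 0)"
proof -
  define B :: "int mat" where "B = mat n n (\<lambda>(i, j). of_bool (j \<in> nbhd G i))"
  have cB: "B \<in> carrier_mat n n" by (simp add: B_def)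
  note A = adjacency_carrier[OF G]
  have AB: "adjacency_matrix G = map_mat real_of_int B"
    by (rule eq_matI) (use A adjacency_entry[OF G] in \<open>auto simp: B_def\<close>)
  have k: "vec n x \<in> mat_kernel (adjacency_matrix G)"
  proof -
    have "(\<Sum>u\<in>nbhd G w. vec n x $ u) = (\<Sum>u\<in>nbhd G w. x u)" for w
      by (rule sum.cong) (use simple_graph_nbhd(1)[OF G, of w] in auto)
    then have "kernel {..<n} (nbhd G) (\<lambda>i. vec n x $ i)" using x(1) by (simp only: kernel_def)
    then show ?thesis using mat_kernel_iff[OF G, of "vec n x"] by simp
  qed
  have "vec n x \<noteq> 0\<^sub>v n"
  proof
    assume "vec n x = 0\<^sub>v n"
    then have "x v = 0" if "v < n" for v using that index_vec[of v n x] by simp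
    then show False using x(2) by blast
  qed
  moreover have "adjacency_matrix G *\<^sub>v vec n x = 0\<^sub>v n" using k A by (auto simp: mat_kernel_def)
  ultimately have "det (adjacency_matrix G) = 0"
    unfolding det_0_iff_vec_prod_zero[OF A] using vec_carrier by blast
  then have "det B = 0" unfolding AB of_int_hom.hom_det by simp
  then obtain v where v: "v \<in> carrier_vec n" "v \<noteq> 0\<^sub>v n" "B *\<^sub>v v = 0\<^sub>v n"
    using det_0_iff_vec_prod_zero[OF cB] by blast
  have "(\<Sum>u\<in>nbhd G i. v $ u) = 0" if "i < n" for i
  proof -
    have "(B *\<^sub>v v) $ i = (\<Sum>k<n. of_bool (k \<in> nbhd G i) * v $ k)"
      using v(1) that by (simp add: B_def scalar_prod_def atLeast0LessThan)
    then show ?thesis using v(3) that sum_nbhd[OF G, of i "\<lambda>k. v $ k"] by simp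
  qed
  moreover have "\<exists>i<n. v $ i \<noteq> 0"
  proof (rule ccontr)
    assume "\<not> (\<exists>i<n. v $ i \<noteq> 0)"
    then have "v = 0\<^sub>v n" using v(1) by (intro eq_vecI) auto
    then show False using v(2) by simp
  qed
  ultimately show ?thesis by (intro exI[of _ "\<lambda>i. v $ i"]) auto
qed

subsection \<open>Existence\<close>

definition cubic_nut :: "nat \<Rightarrow> bool" where
  "cubic_nut n \<longleftrightarrow> (\<exists>N. nut_on {..<n} N \<and> (\<forall>v<n. card (N v) = 3))"

lemma cubic_nut_graph:
  assumes "cubic_nut n" "n > 0"
  shows "\<exists>G. simple_graph_on n G \<and> cubic_graph G \<and> nut_graph G"
proof -
  obtain N where N: "nut_on {..<n} N" "\<And>v. v < n \<Longrightarrow> card (N v) = 3"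
    using assms(1) unfolding cubic_nut_def by blast
  define G where "G = \<lparr>pverts = {0..<n}, parcs = {(v, u). v < n \<and> u \<in> N v}\<rparr>"
  have N1: "u < n" "u \<noteq> v" "v \<in> N u" if v: "v < n" and u: "u \<in> N v" for u v
  proof -
    have "N v \<subseteq> {..<n}" by (rule nut_on_subset[OF N(1)]) (use v in simp)
    then show un: "u < n" using u by blast
    show "v \<in> N u" using nut_on_sym[OF N(1), of u v] u v un by simp
    have "v \<notin> N v" by (rule nut_on_irrefl[OF N(1)]) (use v in simp)
    then show "u \<noteq> v" using u by blast
  qed
  have arc: "(v, u) \<in> parcs G \<longleftrightarrow> v < n \<and> u \<in> N v" for u v by (simp add: G_def)
  have vs: "pverts G = {0..<n}" by (simp add: G_def)
  have ends: "v < n \<and> u < n \<and> u \<noteq> v \<and> (u, v) \<in> parcs G" if "(v, u) \<in> parcs G" for u v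
    using that N1[of v u] unfolding arc by blast
  have G: "simple_graph_on n G"
    unfolding simple_graph_on_def
  proof
    show "pair_graph G"
    proof unfold_locales
      fix e assume e: "e \<in> parcs G"
      show "fst e \<in> pverts G" "snd e \<in> pverts G" "fst e \<noteq> snd e"
        using ends[of "fst e" "snd e"] e unfolding vs by simp_all
    next
      show "finite (pverts G)" unfolding vs by simp
      have "parcs G \<subseteq> {0..<n} \<times> {0..<n}" using ends by (intro subrelI) simp
      then show "finite (parcs G)" by (rule finite_subset) simp
      show "symmetric (with_proj G)"
        unfolding symmetric_def with_proj_simps by (rule symI) (use ends in blast)
    qed
    show "pverts G = {0..<n}" by (rule vs)
  qed
  have nb: "nbhd G v = N v" if "v < n" for v using that unfolding nbhd_def arc by simp
  have nut: "nut_on {..<n} (nbhd G)"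
    by (rule nut_on_cong[OF N(1)]) (simp add: nb)
  have "cubic_graph G" unfolding cubic_graph_iff[OF G] using nb N(2) by simp
  then show ?thesis using G nut_on_imp_nut_graph[OF G assms(2) nut] by blast
qed

definition cubic_list :: "nat list list \<Rightarrow> bool" where
  "cubic_list L \<longleftrightarrow> (\<forall>v \<in> set [0..<length L]. distinct (L ! v) \<and> length (L ! v) = 3 \<and> v \<notin> set (L ! v) \<and>
     (\<forall>u \<in> set (L ! v). u < length L \<and> v \<in> set (L ! u)))"

definition kernel_list :: "nat list list \<Rightarrow> int list \<Rightarrow> bool" where
  "kernel_list L c \<longleftrightarrow> (\<forall>l \<in> set L. sum_list (map (\<lambda>i. c ! i) l) = 0) \<and> length c = length L \<and> 0 \<notin> set c"

text \<open>\<open>t\<close> is a position where the kernel vector \<open>c\<close> has entry 1, so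
  \<open>unique\<close> says that \<open>c\<close> spans the kernel.\<close>

lemma cubic_nut_list:
  assumes n: "length L = n" and L: "cubic_list L" and c: "kernel_list L c" and t: "t < n"
    and unique: "\<And>x :: nat \<Rightarrow> real. \<forall>l \<in> set L. sum_list (map x l) = 0 \<Longrightarrow> map x [0..<n] = map (\<lambda>a. of_int a * x t) c"
  shows "cubic_nut n"
proof -
  let ?N = "\<lambda>v. set (L ! v)"
  have d: "distinct (L ! v)" "length (L ! v) = 3" "v \<notin> ?N v" "u \<in> ?N v \<Longrightarrow> u < n \<and> v \<in> ?N u" if "v < n" for u v
  proof -
    have "v \<in> set [0..<length L]" using that n by simp
    then have P: "distinct (L ! v) \<and> length (L ! v) = 3 \<and> v \<notin> ?N v \<and> (\<forall>u \<in> ?N v. u < n \<and> v \<in> ?N u)"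
      using L unfolding cubic_list_def n by (blast dest: bspec)
    show "distinct (L ! v)" "length (L ! v) = 3" "v \<notin> ?N v" "u \<in> ?N v \<Longrightarrow> u < n \<and> v \<in> ?N u"
      using P by blast+
  qed
  have ker: "kernel {..<n} ?N x \<longleftrightarrow> (\<forall>l \<in> set L. sum_list (map x l) = 0)" for x
  proof -
    have "sum_list (map x (L ! v)) = (\<Sum>u\<in>?N v. x u)" if "v < n" for v
      by (rule sum_list_distinct_conv_sum_set[OF d(1)[OF that]])
    then show ?thesis unfolding kernel_def all_set_conv_all_nth n by (simp add: Ball_def)
  qed
  have c0: "c ! i \<noteq> 0" if "i < n" for i
  proof -
    have "c ! i \<in> set c" using c that n unfolding kernel_list_def by (intro nth_mem) simp
    then show ?thesis using c unfolding kernel_list_def by metis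
  qed
  have "nut_on {..<n} ?N"
    unfolding nut_on_def
  proof (intro conjI ballI allI impI)
    have "sum_list (map (\<lambda>i. real_of_int (c ! i)) l) = of_int (sum_list (map (\<lambda>i. c ! i) l))" for l
      by (induction l) simp_all
    then have "kernel {..<n} ?N (\<lambda>i. of_int (c ! i))"
      unfolding ker using c by (simp add: kernel_list_def)
    then show "\<exists>x. kernel {..<n} ?N x \<and> (\<exists>v\<in>{..<n}. x v \<noteq> 0)"
      using c0[OF t] t by (intro exI[of _ "\<lambda>i. of_int (c ! i)"]) auto
  next
    fix x v assume x: "kernel {..<n} ?N x \<and> (\<exists>v\<in>{..<n}. x v \<noteq> 0)" and v: "v \<in> {..<n}"
    have len: "length c = n" using c n by (simp add: kernel_list_def)
    have eq: "map x [0..<n] = map (\<lambda>a. of_int a * x t) c" by (rule unique) (use conjunct1[OF x] in \<open>simp only: ker\<close>)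
    have e: "x i = of_int (c ! i) * x t" if "i < n" for i
      using arg_cong[OF eq, of "\<lambda>l. l ! i"] that len by simp
    obtain u where "u < n" "x u \<noteq> 0" using x by auto
    then have "x t \<noteq> 0" using e[of u] by auto
    then show "x v \<noteq> 0" using e[of v] c0[of v] v by simp
  next
    fix v assume "v \<in> {..<n}"
    then have v: "v < n" by simp
    show "?N v \<subseteq> {..<n}" using d(4)[OF v] by blast
    show "v \<notin> ?N v" by (rule d(3)[OF v])
    fix u assume "u \<in> {..<n}" "v \<in> ?N u"
    then show "u \<in> ?N v" using d(4)[of u v] by simp
  qed simp
  moreover have "card (?N v) = 3" if "v < n" for v using d(1,2)[OF that] distinct_card by metis
  ultimately show ?thesis unfolding cubic_nut_def by (intro exI[of _ ?N]) blast
qed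

section \<open>Three explicit graphs\<close>

lemma cubic_nut_12: "cubic_nut 12"
proof (rule cubic_nut_list[where t = 0])
  let ?L = "[[1, 4, 5], [0, 2, 6], [1, 3, 7], [2, 4, 8], [0, 3, 9], [0, 7, 10], [1, 8, 11], [2, 5, 11], [3, 6, 10], [4, 10, 11], [5, 8, 9], [6, 7, 9]]"
  let ?c = "[1, - 2, - 2, 1, 1, 1, 1, 1, 1, - 2, - 2, 1] :: int list"
  show "length ?L = 12" by simp
  show "kernel_list ?L ?c" by (simp add: kernel_list_def nth_Cons' del: One_nat_def)
  show "cubic_list ?L"
    by (simp add: cubic_list_def upt_conv_Cons nth_Cons' One_nat_def[symmetric] del: set_upt One_nat_def)
  fix x :: "nat \<Rightarrow> real"
  assume "\<forall>l \<in> set ?L. sum_list (map x l) = 0"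
  then have e: "x 1 + x 4 + x 5 = 0" "x 0 + x 2 + x 6 = 0" "x 1 + x 3 + x 7 = 0" "x 2 + x 4 + x 8 = 0" "x 0 + x 3 + x 9 = 0" "x 0 + x 7 + x 10 = 0" "x 1 + x 8 + x 11 = 0" "x 2 + x 5 + x 11 = 0" "x 3 + x 6 + x 10 = 0" "x 4 + x 10 + x 11 = 0" "x 5 + x 8 + x 9 = 0" "x 6 + x 7 + x 9 = 0"
    by (simp_all only: list.set ball_simps list.map sum_list.Cons sum_list.Nil add_0_right add.assoc)
  \<comment> \<open>Elimination by hand: each f-equation solves one vertex condition for one entry,
    until all entries are expressed by \<open>x 0\<close>, \<open>x 1\<close>, \<open>x 4\<close>
    and \<open>x 7\<close>. The c-equations are the conditions left over. The next two graphs are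
    treated in the same way, again with four free entries.\<close>
  have f10: "x 10 = - x 0 - x 7" using e(6) by linarith
  have f11: "x 11 = x 0 - x 4 + x 7" using e(10) f10 by linarith
  have f5: "x 5 = - x 1 - x 4" using e(1) by linarith
  have f3: "x 3 = - x 1 - x 7" using e(3) by linarith
  have f9: "x 9 = - x 0 + x 1 + x 7" using e(5) f3 by linarith
  have f8: "x 8 = - x 0 - x 1 + x 4 - x 7" using e(7) f11 by linarith
  have f2: "x 2 = x 0 + x 1 - 2 * x 4 + x 7" using e(4) f8 by linarith
  have f6: "x 6 = - 2 * x 0 - x 1 + 2 * x 4 - x 7" using e(2) f2 by linarith
  have c7: "2 * x 0 - 4 * x 4 + 2 * x 7 = 0" using e(8) f2 f5 f11 by linarith
  have c8: "- 3 * x 0 - 2 * x 1 + 2 * x 4 - 3 * x 7 = 0" using e(9) f3 f6 f10 by linarith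
  have c10: "- 2 * x 0 - x 1 = 0" using e(11) f5 f8 f9 by linarith
  have c11: "- 3 * x 0 + 2 * x 4 + x 7 = 0" using e(12) f6 f9 by linarith
  have x7: "x 7 = 1 * x 0" using c7 c8 c10 c11 by linarith
  have x4: "x 4 = 1 * x 0" using c7 c8 c10 c11 by linarith
  have x1: "x 1 = - 2 * x 0" using c7 c8 c10 c11 by linarith
  have x2: "x 2 = - 2 * x 0" using f2 x4 x1 x7 by linarith
  have x3: "x 3 = 1 * x 0" using f3 x1 x7 by linarith
  have x5: "x 5 = 1 * x 0" using f5 x1 x4 by linarith
  have x6: "x 6 = 1 * x 0" using f6 x4 x1 x7 by linarith
  have x8: "x 8 = 1 * x 0" using f8 x1 x4 x7 by linarith
  have x9: "x 9 = - 2 * x 0" using f9 x1 x7 by linarith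
  have x10: "x 10 = - 2 * x 0" using f10 x7 by linarith
  have x11: "x 11 = 1 * x 0" using f11 x4 x7 by linarith
  show "map x [0..<12] = map (\<lambda>a. of_int a * x 0) ?c"
    using x1 x2 x3 x4 x5 x6 x7 x8 x9 x10 x11 by (simp add: upt_conv_Cons One_nat_def[symmetric] del: One_nat_def)
qed simp

lemma cubic_nut_20: "cubic_nut 20"
proof (rule cubic_nut_list[where t = 3])
  let ?L = "[[13, 16, 2], [19, 5, 11], [4, 12, 0], [18, 10, 5], [19, 17, 2], [15, 1, 3], [9, 7, 15], [13, 6, 10], [17, 9, 14], [8, 6, 12], [11, 3, 7], [16, 10, 1], [18, 9, 2], [7, 0, 18], [19, 15, 8], [14, 5, 6], [17, 11, 0], [8, 16, 4], [3, 12, 13], [14, 1, 4]]"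
  let ?c = "[3, 2, 2, 1, - 1, 3, - 2, 1, 4, 2, 1, - 2, - 2, 1, - 1, - 3, - 3, - 1, - 4, - 1] :: int list"
  show "length ?L = 20" by simp
  show "kernel_list ?L ?c" by (simp add: kernel_list_def nth_Cons' del: One_nat_def)
  show "cubic_list ?L"
    by (simp add: cubic_list_def upt_conv_Cons nth_Cons' One_nat_def[symmetric] del: set_upt One_nat_def)
  fix x :: "nat \<Rightarrow> real"
  assume "\<forall>l \<in> set ?L. sum_list (map x l) = 0"
  then have e: "x 13 + x 16 + x 2 = 0" "x 19 + x 5 + x 11 = 0" "x 4 + x 12 + x 0 = 0" "x 18 + x 10 + x 5 = 0" "x 19 + x 17 + x 2 = 0" "x 15 + x 1 + x 3 = 0" "x 9 + x 7 + x 15 = 0" "x 13 + x 6 + x 10 = 0" "x 17 + x 9 + x 14 = 0" "x 8 + x 6 + x 12 = 0" "x 11 + x 3 + x 7 = 0" "x 16 + x 10 + x 1 = 0" "x 18 + x 9 + x 2 = 0" "x 7 + x 0 + x 18 = 0" "x 19 + x 15 + x 8 = 0" "x 14 + x 5 + x 6 = 0" "x 17 + x 11 + x 0 = 0" "x 8 + x 16 + x 4 = 0" "x 3 + x 12 + x 13 = 0" "x 14 + x 1 + x 4 = 0"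
    by (simp_all only: list.set ball_simps list.map sum_list.Cons sum_list.Nil add_0_right add.assoc)
  have f11: "x 11 = - x 3 - x 7" using e(11) by linarith
  have f5: "x 5 = x 3 + x 7 - x 19" using e(2) f11 by linarith
  have f10: "x 10 = - x 3 - x 7 - x 18 + x 19" using e(4) f5 by linarith
  have f0: "x 0 = - x 7 - x 18" using e(14) by linarith
  have f17: "x 17 = x 3 + 2 * x 7 + x 18" using e(17) f11 f0 by linarith
  have f2: "x 2 = - x 3 - 2 * x 7 - x 18 - x 19" using e(5) f17 by linarith
  have f9: "x 9 = x 3 + 2 * x 7 + x 19" using e(13) f2 by linarith
  have f15: "x 15 = - x 3 - 3 * x 7 - x 19" using e(7) f9 by linarith
  have f1: "x 1 = 3 * x 7 + x 19" using e(6) f15 by linarith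
  have f14: "x 14 = - 2 * x 3 - 4 * x 7 - x 18 - x 19" using e(9) f17 f9 by linarith
  have f16: "x 16 = x 3 - 2 * x 7 + x 18 - 2 * x 19" using e(12) f10 f1 by linarith
  have f13: "x 13 = 4 * x 7 + 3 * x 19" using e(1) f16 f2 by linarith
  have f6: "x 6 = x 3 - 3 * x 7 + x 18 - 4 * x 19" using e(8) f13 f10 by linarith
  have f8: "x 8 = x 3 + 3 * x 7" using e(15) f15 by linarith
  have f12: "x 12 = - 2 * x 3 - x 18 + 4 * x 19" using e(10) f8 f6 by linarith
  have f4: "x 4 = 2 * x 3 + x 7 + 2 * x 18 - 4 * x 19" using e(3) f12 f0 by linarith
  have c15: "- 6 * x 7 - 6 * x 19 = 0" using e(16) f14 f5 f6 by linarith
  have c17: "4 * x 3 + 2 * x 7 + 3 * x 18 - 6 * x 19 = 0" using e(18) f8 f16 f4 by linarith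
  have c18: "- x 3 + 4 * x 7 - x 18 + 7 * x 19 = 0" using e(19) f12 f13 by linarith
  have c19: "x 18 - 4 * x 19 = 0" using e(20) f14 f1 f4 by linarith
  have x7: "x 7 = 1 * x 3" using c15 c17 c18 c19 by linarith
  have x19: "x 19 = - 1 * x 3" using c15 c17 c18 c19 by linarith
  have x18: "x 18 = - 4 * x 3" using c15 c17 c18 c19 by linarith
  have x0: "x 0 = 3 * x 3" using f0 x7 x18 by linarith
  have x1: "x 1 = 2 * x 3" using f1 x19 x7 by linarith
  have x2: "x 2 = 2 * x 3" using f2 x19 x7 x18 by linarith
  have x4: "x 4 = - 1 * x 3" using f4 x19 x18 x7 by linarith
  have x5: "x 5 = 3 * x 3" using f5 x19 x7 by linarith
  have x6: "x 6 = - 2 * x 3" using f6 x19 x7 x18 by linarith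
  have x8: "x 8 = 4 * x 3" using f8 x7 by linarith
  have x9: "x 9 = 2 * x 3" using f9 x19 x7 by linarith
  have x10: "x 10 = 1 * x 3" using f10 x18 x19 x7 by linarith
  have x11: "x 11 = - 2 * x 3" using f11 x7 by linarith
  have x12: "x 12 = - 2 * x 3" using f12 x19 x18 by linarith
  have x13: "x 13 = 1 * x 3" using f13 x19 x7 by linarith
  have x14: "x 14 = - 1 * x 3" using f14 x7 x18 x19 by linarith
  have x15: "x 15 = - 3 * x 3" using f15 x19 x7 by linarith
  have x16: "x 16 = - 3 * x 3" using f16 x18 x19 x7 by linarith
  have x17: "x 17 = - 1 * x 3" using f17 x7 x18 by linarith
  show "map x [0..<20] = map (\<lambda>a. of_int a * x 3) ?c"
    using x0 x1 x2 x4 x5 x6 x7 x8 x9 x10 x11 x12 x13 x14 x15 x16 x17 x18 x19 by (simp add: upt_conv_Cons One_nat_def[symmetric] del: One_nat_def)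
qed simp

lemma cubic_nut_22: "cubic_nut 22"
proof (rule cubic_nut_list[where t = 3])
  let ?L = "[[17, 7, 6], [20, 12, 2], [17, 3, 1], [19, 2, 13], [15, 10, 9], [13, 9, 18], [21, 13, 0], [14, 0, 16], [14, 15, 12], [15, 5, 4], [16, 4, 21], [19, 20, 17], [1, 16, 8], [5, 6, 3], [7, 8, 20], [9, 4, 8], [10, 12, 7], [0, 2, 11], [21, 19, 5], [3, 11, 18], [1, 11, 14], [6, 18, 10]]"
  let ?c = "[4, 5, - 2, 1, 2, - 4, 3, 3, - 4, 2, - 4, - 2, 1, - 3, - 3, 2, - 1, - 6, 1, 5, 1, - 1] :: int list"
  show "length ?L = 22" by simp
  show "kernel_list ?L ?c" by (simp add: kernel_list_def nth_Cons' del: One_nat_def)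
  show "cubic_list ?L"
    by (simp add: cubic_list_def upt_conv_Cons nth_Cons' One_nat_def[symmetric] del: set_upt One_nat_def)
  fix x :: "nat \<Rightarrow> real"
  assume "\<forall>l \<in> set ?L. sum_list (map x l) = 0"
  then have e: "x 17 + x 7 + x 6 = 0" "x 20 + x 12 + x 2 = 0" "x 17 + x 3 + x 1 = 0" "x 19 + x 2 + x 13 = 0" "x 15 + x 10 + x 9 = 0" "x 13 + x 9 + x 18 = 0" "x 21 + x 13 + x 0 = 0" "x 14 + x 0 + x 16 = 0" "x 14 + x 15 + x 12 = 0" "x 15 + x 5 + x 4 = 0" "x 16 + x 4 + x 21 = 0" "x 19 + x 20 + x 17 = 0" "x 1 + x 16 + x 8 = 0" "x 5 + x 6 + x 3 = 0" "x 7 + x 8 + x 20 = 0" "x 9 + x 4 + x 8 = 0" "x 10 + x 12 + x 7 = 0" "x 0 + x 2 + x 11 = 0" "x 21 + x 19 + x 5 = 0" "x 3 + x 11 + x 18 = 0" "x 1 + x 11 + x 14 = 0" "x 6 + x 18 + x 10 = 0"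
    by (simp_all only: list.set ball_simps list.map sum_list.Cons sum_list.Nil add_0_right add.assoc)
  have f18: "x 18 = - x 3 - x 11" using e(20) by linarith
  have f2: "x 2 = - x 0 - x 11" using e(18) by linarith
  have f13: "x 13 = - x 0 - x 21" using e(7) by linarith
  have f19: "x 19 = 2 * x 0 + x 11 + x 21" using e(4) f2 f13 by linarith
  have f9: "x 9 = x 0 + x 3 + x 11 + x 21" using e(6) f13 f18 by linarith
  have f5: "x 5 = - 2 * x 0 - x 11 - 2 * x 21" using e(19) f19 by linarith
  have f6: "x 6 = 2 * x 0 - x 3 + x 11 + 2 * x 21" using e(14) f5 by linarith
  have f10: "x 10 = - 2 * x 0 + 2 * x 3 - 2 * x 21" using e(22) f6 f18 by linarith
  have f15: "x 15 = x 0 - 3 * x 3 - x 11 + x 21" using e(5) f10 f9 by linarith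
  have f4: "x 4 = x 0 + 3 * x 3 + 2 * x 11 + x 21" using e(10) f15 f5 by linarith
  have f16: "x 16 = - x 0 - 3 * x 3 - 2 * x 11 - 2 * x 21" using e(11) f4 by linarith
  have f14: "x 14 = 3 * x 3 + 2 * x 11 + 2 * x 21" using e(8) f16 by linarith
  have f12: "x 12 = - x 0 - x 11 - 3 * x 21" using e(9) f14 f15 by linarith
  have f20: "x 20 = 2 * x 0 + 2 * x 11 + 3 * x 21" using e(2) f12 f2 by linarith
  have f17: "x 17 = - 4 * x 0 - 3 * x 11 - 4 * x 21" using e(12) f19 f20 by linarith
  have f7: "x 7 = 2 * x 0 + x 3 + 2 * x 11 + 2 * x 21" using e(1) f17 f6 by linarith
  have f1: "x 1 = 4 * x 0 - x 3 + 3 * x 11 + 4 * x 21" using e(3) f17 by linarith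
  have f8: "x 8 = - 3 * x 0 + 4 * x 3 - x 11 - 2 * x 21" using e(13) f1 f16 by linarith
  have c14: "x 0 + 5 * x 3 + 3 * x 11 + 3 * x 21 = 0" using e(15) f7 f8 f20 by linarith
  have c15: "- x 0 + 8 * x 3 + 2 * x 11 = 0" using e(16) f9 f4 f8 by linarith
  have c16: "- x 0 + 3 * x 3 + x 11 - 3 * x 21 = 0" using e(17) f10 f12 f7 by linarith
  have c20: "4 * x 0 + 2 * x 3 + 6 * x 11 + 6 * x 21 = 0" using e(21) f1 f14 by linarith
  have x11: "x 11 = - 2 * x 3" using c14 c15 c16 c20 by linarith
  have x0: "x 0 = 4 * x 3" using c14 c15 c16 c20 by linarith
  have x21: "x 21 = - 1 * x 3" using c14 c15 c16 c20 by linarith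
  have x1: "x 1 = 5 * x 3" using f1 x0 x11 x21 by linarith
  have x2: "x 2 = - 2 * x 3" using f2 x0 x11 by linarith
  have x4: "x 4 = 2 * x 3" using f4 x21 x0 x11 by linarith
  have x5: "x 5 = - 4 * x 3" using f5 x21 x0 x11 by linarith
  have x6: "x 6 = 3 * x 3" using f6 x21 x0 x11 by linarith
  have x7: "x 7 = 3 * x 3" using f7 x0 x11 x21 by linarith
  have x8: "x 8 = - 4 * x 3" using f8 x0 x11 x21 by linarith
  have x9: "x 9 = 2 * x 3" using f9 x21 x0 x11 by linarith
  have x10: "x 10 = - 4 * x 3" using f10 x21 x0 by linarith
  have x12: "x 12 = 1 * x 3" using f12 x21 x11 x0 by linarith
  have x13: "x 13 = - 3 * x 3" using f13 x21 x0 by linarith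
  have x14: "x 14 = - 3 * x 3" using f14 x21 x11 by linarith
  have x15: "x 15 = 2 * x 3" using f15 x21 x0 x11 by linarith
  have x16: "x 16 = - 1 * x 3" using f16 x21 x0 x11 by linarith
  have x17: "x 17 = - 6 * x 3" using f17 x0 x11 x21 by linarith
  have x18: "x 18 = 1 * x 3" using f18 x11 by linarith
  have x19: "x 19 = 5 * x 3" using f19 x0 x11 x21 by linarith
  have x20: "x 20 = 1 * x 3" using f20 x21 x11 x0 by linarith
  show "map x [0..<22] = map (\<lambda>a. of_int a * x 3) ?c"
    using x0 x1 x2 x4 x5 x6 x7 x8 x9 x10 x11 x12 x13 x14 x15 x16 x17 x18 x19 x20 x21 by (simp add: upt_conv_Cons One_nat_def[symmetric] del: One_nat_def)
qed simp

text \<open>The new vertices n, n + 1, n + 2 take over the edges of vertex 0 to \<open>a\<close>,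
  \<open>b\<close>, \<open>c\<close>; vertex 0 is joined to n + 3, n + 4, n + 5 instead. The six new
  vertices induce a 6-cycle in which n + i and n + 3 + i are opposite.\<close>

lemma cubic_nut_add_6:
  assumes "cubic_nut n" "n > 0"
  shows "cubic_nut (n + 6)"
proof -
  obtain N where nut: "nut_on {..<n} N" and cubic: "\<And>v. v < n \<Longrightarrow> card (N v) = 3"
    using assms(1) unfolding cubic_nut_def by blast
  obtain a b c where N0: "N 0 = {a, b, c}" and abc: "a \<noteq> b" "a \<noteq> c" "b \<noteq> c"
    using cubic[OF assms(2)] unfolding card_3_iff by blast
  have sub: "u < n" "u \<noteq> v" "v \<in> N u" if v: "v < n" and u: "u \<in> N v" for u v
  proof -
    have "N v \<subseteq> {..<n}" by (rule nut_on_subset[OF nut]) (use v in simp)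
    then show un: "u < n" using u by blast
    show "v \<in> N u" using nut_on_sym[OF nut, of u v] u v un by simp
    have "v \<notin> N v" by (rule nut_on_irrefl[OF nut]) (use v in simp)
    then show "u \<noteq> v" using u by blast
  qed
  have abc0: "a \<in> N 0" "b \<in> N 0" "c \<in> N 0" unfolding N0 by simp_all
  note lt = abc0[THEN sub(1)[OF assms(2)]] and nz = abc0[THEN sub(2)[OF assms(2)]]
    and zero_nb = abc0[THEN sub(3)[OF assms(2)]]
  have zero_nb_iff: "0 \<in> N w \<longleftrightarrow> w = a \<or> w = b \<or> w = c" if w: "w < n" for w
  proof
    assume "0 \<in> N w"
    from sub(3)[OF w this] show "w = a \<or> w = b \<or> w = c" unfolding N0 by simp
  next
    assume "w = a \<or> w = b \<or> w = c"
    then show "0 \<in> N w" using zero_nb by (elim disjE) simp_all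
  qed
  have finN: "finite (N w)" if "w < n" for w by (rule card_ge_0_finite) (simp add: cubic[OF that])
  define M where "M w = (if w = 0 then {n + 3, n + 4, n + 5} else if w = n then {a, n + 4, n + 5}
    else if w = n + 1 then {b, n + 3, n + 5} else if w = n + 2 then {c, n + 3, n + 4}
    else if w = n + 3 then {0, n + 1, n + 2} else if w = n + 4 then {0, n, n + 2}
    else if w = n + 5 then {0, n, n + 1} else if w = a then insert n (N a - {0})
    else if w = b then insert (n + 1) (N b - {0}) else if w = c then insert (n + 2) (N c - {0}) else N w)" for w
  have M: "M 0 = {n + 3, n + 4, n + 5}" "M n = {a, n + 4, n + 5}" "M (n + 1) = {b, n + 3, n + 5}"
    "M (n + 2) = {c, n + 3, n + 4}" "M (n + 3) = {0, n + 1, n + 2}" "M (n + 4) = {0, n, n + 2}"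
    "M (n + 5) = {0, n, n + 1}" "M a = insert n (N a - {0})" "M b = insert (n + 1) (N b - {0})"
    "M c = insert (n + 2) (N c - {0})"
    using assms(2) lt nz abc by (simp_all add: M_def)
  note Ms = M M[simplified]
  have Mo: "M w = N w" if "w < n" "w \<noteq> 0" "w \<noteq> a" "w \<noteq> b" "w \<noteq> c" for w
    using that by (simp add: M_def)
  have old: "z \<in> M w \<longleftrightarrow> z \<in> N w" if "w < n" "w \<noteq> 0" "z < n" "z \<noteq> 0" for z w
  proof (cases "w = a \<or> w = b \<or> w = c")
    case True
    then show ?thesis using that M(8-10) by (elim disjE) simp_all
  next
    case False
    then show ?thesis using Mo[OF that(1,2)] by simp
  qed
  have verts: "w \<in> {..<n + 6} \<longleftrightarrow> w = 0 \<or> w = n \<or> w = n + 1 \<or> w = n + 2 \<or> w = n + 3 \<or> w = n + 4 \<or> w = n + 5 \<or>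
      w = a \<or> w = b \<or> w = c \<or> (w < n \<and> w \<noteq> 0 \<and> w \<noteq> a \<and> w \<noteq> b \<and> w \<noteq> c)" for w
    using assms(2) lt by auto
  have cubicM: "card (M w) = 3" if "w \<in> {..<n + 6}" for w
  proof -
    have new: "card (insert k (N w - {0})) = 3" if "w < n" "0 \<in> N w" "k \<ge> n" for k w
    proof -
      have "k \<notin> N w" using sub(1)[OF that(1), of k] that(3) by auto
      then show ?thesis using finN[OF that(1)] cubic[OF that(1)] that(2) by (simp add: card_insert_if)
    qed
    show ?thesis
      using that[unfolded verts] assms(2) lt nz
      by (elim disjE) (simp_all add: Ms Mo cubic new zero_nb)
  qed
  \<comment> \<open>\<open>x(0 := x n)\<close> is the vector on the old graph: the old value at
    vertex 0 is now carried by \<open>n\<close>, and by n + 1 and n + 2 as well.\<close>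
  have fold: "(\<Sum>u\<in>N w. (x(0 := x n)) u) = (if 0 \<in> N w then x n + (\<Sum>u\<in>N w - {0}. x u) else (\<Sum>u\<in>N w. x u))"
    if "w < n" for w and x :: "nat \<Rightarrow> real"
  proof -
    have "(\<Sum>u\<in>N w - {0}. (x(0 := x n)) u) = (\<Sum>u\<in>N w - {0}. x u)" by (rule sum.cong) auto
    moreover have "(\<Sum>u\<in>N w. (x(0 := x n)) u) = (\<Sum>u\<in>N w. x u)" if "0 \<notin> N w"
      by (rule sum.cong) (use that in auto)
    ultimately show ?thesis
      using sum.remove[OF finN[OF that], of 0 "x(0 := x n)"] by (cases "0 \<in> N w") (simp_all only: fun_upd_same if_True if_False simp_thms)
  qed
  have new_sum: "(\<Sum>u\<in>insert k (N w - {0}). x u) = x k + (\<Sum>u\<in>N w - {0}. x u)"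
    if "w < n" "k \<ge> n" for k w and x :: "nat \<Rightarrow> real"
  proof -
    have "k \<notin> N w" using sub(1)[OF that(1), of k] that(2) by auto
    then show ?thesis using finN[OF that(1)] by simp
  qed
  have rows: "(\<Sum>u\<in>M 0. x u) = x (n + 3) + x (n + 4) + x (n + 5)" "(\<Sum>u\<in>M n. x u) = x a + x (n + 4) + x (n + 5)"
    "(\<Sum>u\<in>M (n + 1). x u) = x b + x (n + 3) + x (n + 5)" "(\<Sum>u\<in>M (n + 2). x u) = x c + x (n + 3) + x (n + 4)"
    "(\<Sum>u\<in>M (n + 3). x u) = x 0 + x (n + 1) + x (n + 2)" "(\<Sum>u\<in>M (n + 4). x u) = x 0 + x n + x (n + 2)"
    "(\<Sum>u\<in>M (n + 5). x u) = x 0 + x n + x (n + 1)" for x :: "nat \<Rightarrow> real"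
    unfolding M using lt assms(2) by simp_all
  have old_rows: "(\<Sum>u\<in>M w. x u) = (\<Sum>u\<in>N w. (x(0 := x n)) u)"
    if p: "x (n + 1) = x n" "x (n + 2) = x n" and w: "w < n" "w \<noteq> 0" for x :: "nat \<Rightarrow> real" and w
  proof (cases "w = a \<or> w = b \<or> w = c")
    case True
    then show ?thesis
      using p fold[OF lt(1), of x] fold[OF lt(2), of x] fold[OF lt(3), of x] new_sum[OF lt(1)] new_sum[OF lt(2)] new_sum[OF lt(3)] zero_nb
      unfolding M(8-10)[symmetric] by (elim disjE) (simp_all add: M(8-10))
  next
    case False
    then show ?thesis using fold[OF w(1), of x] zero_nb_iff[OF w(1)] Mo[OF w] by simp
  qed
  have row_0: "(\<Sum>u\<in>N 0. (x(0 := x n)) u) = x a + x b + x c" for x :: "nat \<Rightarrow> real"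
    unfolding N0 using abc nz by simp
  \<comment> \<open>Differences of the rows n + 3, n + 4, n + 5 equate the values at n, n + 1, n + 2
    and give -2 times that value at 0. Comparing row 0 with the rows n, n + 1, n + 2 copies the
    values of \<open>a\<close>, \<open>b\<close>, \<open>c\<close> to n + 3, n + 4, n + 5. So old
    and new kernel vectors correspond, and being nowhere zero is preserved.\<close>
  have ker: "kernel {..<n + 6} M x \<longleftrightarrow> kernel {..<n} N (x(0 := x n)) \<and> x (n + 1) = x n \<and> x (n + 2) = x n \<and>
      x 0 = - 2 * x n \<and> x (n + 3) = x a \<and> x (n + 4) = x b \<and> x (n + 5) = x c" for x
  proof
    assume k: "kernel {..<n + 6} M x"
    have r: "(\<Sum>u\<in>M w. x u) = 0" if "w < n + 6" for w using k that by (simp add: kernel_def)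
    have e: "x (n + 3) + x (n + 4) + x (n + 5) = 0" "x a + x (n + 4) + x (n + 5) = 0"
      "x b + x (n + 3) + x (n + 5) = 0" "x c + x (n + 3) + x (n + 4) = 0"
      "x 0 + x (n + 1) + x (n + 2) = 0" "x 0 + x n + x (n + 2) = 0" "x 0 + x n + x (n + 1) = 0"
      unfolding rows[symmetric] by (intro r; simp)+
    then have p: "x (n + 1) = x n" "x (n + 2) = x n" by linarith+
    have "(\<Sum>u\<in>N w. (x(0 := x n)) u) = 0" if w: "w < n" for w
    proof (cases "w = 0")
      case True
      then show ?thesis unfolding True row_0 using e by linarith
    next
      case False
      show ?thesis unfolding old_rows[OF p w False, symmetric] by (rule r) (use w in simp)
    qed
    then have "kernel {..<n} N (x(0 := x n))" by (simp only: kernel_def Ball_def lessThan_iff) blast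
    moreover have "x 0 = - 2 * x n" "x (n + 3) = x a" "x (n + 4) = x b" "x (n + 5) = x c"
      using e by linarith+
    ultimately show "kernel {..<n} N (x(0 := x n)) \<and> x (n + 1) = x n \<and> x (n + 2) = x n \<and>
      x 0 = - 2 * x n \<and> x (n + 3) = x a \<and> x (n + 4) = x b \<and> x (n + 5) = x c" using p by (intro conjI)
  next
    assume "kernel {..<n} N (x(0 := x n)) \<and> x (n + 1) = x n \<and> x (n + 2) = x n \<and>
      x 0 = - 2 * x n \<and> x (n + 3) = x a \<and> x (n + 4) = x b \<and> x (n + 5) = x c"
    then have k: "kernel {..<n} N (x(0 := x n))" and p: "x (n + 1) = x n" "x (n + 2) = x n"
      and q: "x 0 = - 2 * x n" "x (n + 3) = x a" "x (n + 4) = x b" "x (n + 5) = x c" by blast+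
    have r: "(\<Sum>u\<in>N w. (x(0 := x n)) u) = 0" if "w < n" for w
      using k that unfolding kernel_def by (simp only: Ball_def lessThan_iff)
    have s: "x a + x b + x c = 0" using r[OF assms(2)] unfolding row_0 .
    have o: "(\<Sum>u\<in>M w. x u) = 0" if "w < n" "w \<noteq> 0" for w
      unfolding old_rows[OF p that] by (rule r[OF that(1)])
    have 7: "(\<Sum>u\<in>M 0. x u) = 0" "(\<Sum>u\<in>M n. x u) = 0" "(\<Sum>u\<in>M (n + 1). x u) = 0" "(\<Sum>u\<in>M (n + 2). x u) = 0"
      "(\<Sum>u\<in>M (n + 3). x u) = 0" "(\<Sum>u\<in>M (n + 4). x u) = 0" "(\<Sum>u\<in>M (n + 5). x u) = 0"
      unfolding rows p q using s by linarith+
    have "(\<Sum>u\<in>M w. x u) = 0" if "w \<in> {..<n + 6}" for w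
      using that[unfolded verts] 7 o o[OF lt(1) nz(1)] o[OF lt(2) nz(2)] o[OF lt(3) nz(3)] by (elim disjE conjE) (simp_all only:)
    then show "kernel {..<n + 6} M x" by (simp only: kernel_def Ball_def) blast
  qed
  have "nut_on {..<n + 6} M"
    unfolding nut_on_def
  proof (intro conjI)
    have sub6: "N w \<subseteq> {..<n + 6}" if "w < n" for w using sub(1)[OF that] by fastforce
    have irr: "w \<notin> N w" if "w < n" for w using sub(2)[OF that] by blast
    show "\<forall>v\<in>{..<n + 6}. M v \<subseteq> {..<n + 6} \<and> v \<notin> M v"
    proof
      fix v assume "v \<in> {..<n + 6}"
      then show "M v \<subseteq> {..<n + 6} \<and> v \<notin> M v"
        using assms(2) lt nz sub6 irr unfolding verts[of v] by (elim disjE conjE) (auto simp: Ms Mo)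
    qed
    show "\<forall>u\<in>{..<n + 6}. \<forall>v\<in>{..<n + 6}. u \<in> M v \<longrightarrow> v \<in> M u"
    proof (intro ballI impI)
      fix u v assume u: "u \<in> {..<n + 6}" and v: "v \<in> {..<n + 6}" and uv: "u \<in> M v"
      show "v \<in> M u"
      proof (cases "v < n \<and> v \<noteq> 0 \<and> u < n \<and> u \<noteq> 0")
        case True
        then show ?thesis using uv old[of v u] old[of u v] sub(3)[of v u] by blast
      next
        case False
        have big: "u < n" if "u \<in> N w" "w < n" for w using sub(1) that by blast
        show ?thesis
          using v[unfolded verts]
        proof (elim disjE)
          assume "v < n \<and> v \<noteq> 0 \<and> v \<noteq> a \<and> v \<noteq> b \<and> v \<noteq> c"
          then show ?thesis using uv False big[of v] zero_nb_iff[of v] Mo[of v] by auto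
        qed (use uv False assms(2) lt nz big in \<open>auto simp: Ms\<close>)
      qed
    qed
    obtain y where y: "kernel {..<n} N y" "\<And>v. v \<in> {..<n} \<Longrightarrow> y v \<noteq> 0" using nut_on_kernel[OF nut] by blast
    define x where "x w = (if w = 0 then - 2 * y 0 else if w < n then y w else if w < n + 3 then y 0
      else if w = n + 3 then y a else if w = n + 4 then y b else y c)" for w
    have "(\<Sum>u\<in>N w. (x(0 := x n)) u) = (\<Sum>u\<in>N w. y u)" if "w < n" for w
      by (rule sum.cong) (use sub(1)[OF that] assms(2) in \<open>auto simp: x_def\<close>)
    then have "kernel {..<n} N (x(0 := x n))" using y(1) by (simp only: kernel_def Ball_def lessThan_iff) simp
    then have "kernel {..<n + 6} M x" unfolding ker using assms(2) lt nz by (simp add: x_def)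
    moreover have "x n \<noteq> 0" using y(2)[of 0] assms(2) by (simp add: x_def)
    ultimately show "\<exists>x. kernel {..<n + 6} M x \<and> (\<exists>v\<in>{..<n + 6}. x v \<noteq> 0)"
      by (intro exI[of _ x] conjI bexI[of _ n]) simp_all
    show "\<forall>x. kernel {..<n + 6} M x \<and> (\<exists>v\<in>{..<n + 6}. x v \<noteq> 0) \<longrightarrow> (\<forall>v\<in>{..<n + 6}. x v \<noteq> 0)"
    proof (intro allI impI ballI)
      fix x v assume x: "kernel {..<n + 6} M x \<and> (\<exists>v\<in>{..<n + 6}. x v \<noteq> 0)" and v: "v \<in> {..<n + 6}"
      have k: "kernel {..<n} N (x(0 := x n))" and e: "x (n + 1) = x n" "x (n + 2) = x n"
        "x 0 = - 2 * x n" "x (n + 3) = x a" "x (n + 4) = x b" "x (n + 5) = x c"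
        using x unfolding ker by blast+
      have "\<exists>w<n. (x(0 := x n)) w \<noteq> 0"
      proof (rule ccontr)
        assume "\<not> (\<exists>w<n. (x(0 := x n)) w \<noteq> 0)"
        then have z: "(x(0 := x n)) w = 0" if "w < n" for w using that by blast
        have "x n = 0" using z[OF assms(2)] by simp
        moreover have "x w = 0" if "w < n" "w \<noteq> 0" for w using z[OF that(1)] that(2) by simp
        ultimately have "x w = 0" if "w \<in> {..<n + 6}" for w
          using that[unfolded verts] lt nz e by (elim disjE) simp_all
        then show False using x by blast
      qed
      then obtain w where w: "w \<in> {..<n}" "(x(0 := x n)) w \<noteq> 0" by auto
      have f: "(x(0 := x n)) w \<noteq> 0" if "w < n" for w
        by (rule nut_on_full[OF nut k w]) (use that in simp)
      have "x n \<noteq> 0" using f[OF assms(2)] by simp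
      moreover have "x w \<noteq> 0" if "w < n" "w \<noteq> 0" for w using f[OF that(1)] that(2) by simp
      ultimately show "x v \<noteq> 0"
        using v[unfolded verts] lt nz e by (elim disjE) simp_all
    qed
  qed simp
  then show ?thesis unfolding cubic_nut_def using cubicM by (intro exI[of _ M]) simp
qed

text \<open>12, 20 and 22 are the least admissible orders in the residue classes 0, 2 and 4 modulo
  6.\<close>

lemma cubic_nut_exists: "even n \<Longrightarrow> n \<ge> 12 \<Longrightarrow> n \<notin> {14, 16} \<Longrightarrow> cubic_nut n"
proof (induction n rule: less_induct)
  case (less n)
  show ?case
  proof (cases "n \<in> {12, 20, 22}")
    case True
    then show ?thesis using cubic_nut_12 cubic_nut_20 cubic_nut_22 by auto
  next
    case False
    have "n \<noteq> 13 \<and> n \<noteq> 15 \<and> n \<noteq> 17 \<and> n \<noteq> 19 \<and> n \<noteq> 21" using less.prems(1) by auto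
    then have n: "n - 6 \<ge> 12" "n - 6 \<notin> {14, 16}" "n - 6 < n" "n - 6 + 6 = n" "even (n - 6)"
      using less.prems False by auto
    have "cubic_nut (n - 6)" by (rule less.IH[OF n(3,5,1,2)])
    then show ?thesis using cubic_nut_add_6[of "n - 6"] n by simp
  qed
qed

text \<open>The two bounds on \<open>c\<close> give 3 * k \<le> n \<le> 16, hence k \<le> 5 and c
  \<le> 10; the finitely many triples are enumerated.\<close>

lemma small_cases:
  fixes n k c :: nat
  assumes "even n" "n > 0" "n < 12 \<or> n \<in> {14, 16}" "k > 0" "4 dvd c" "c \<le> 2 * k" "5 * k \<le> n + c"
  shows "(c, 2 * k - c, 3 * k - c, n + c - 5 * k) \<in>
    {(0, 2, 3, 1), (4, 0, 2, 0), (0, 2, 3, 3), (4, 0, 2, 2), (0, 2, 3, 5), (4, 0, 2, 4), (0, 4, 6, 0), (0, 2, 3, 9),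
     (4, 0, 2, 8), (4, 2, 5, 3), (0, 2, 3, 11), (4, 0, 2, 10), (4, 2, 5, 5), (0, 4, 6, 4), (8, 0, 4, 2), (4, 4, 8, 0),
     (8, 0, 4, 4), (0, 6, 9, 1), (0, 4, 6, 6)}"
proof -
  have "n \<le> 16" using assms(3) by auto
  then have "k \<le> 5" using assms(6,7) by linarith
  then have k: "k = 1 \<or> k = 2 \<or> k = 3 \<or> k = 4 \<or> k = 5" using assms(4) by linarith
  have "c \<le> 10" using \<open>k \<le> 5\<close> assms(6) by linarith
  moreover obtain e where "c = 4 * e" using assms(5) by (rule dvdE)
  ultimately have c: "c = 0 \<or> c = 4 \<or> c = 8" by presburger
  obtain m where "n = 2 * m" using assms(1) by (rule dvdE)
  then have n: "n = 2 \<or> n = 4 \<or> n = 6 \<or> n = 8 \<or> n = 10 \<or> n = 14 \<or> n = 16" using assms(2,3) by auto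
  show ?thesis using k c n assms(6,7) by (elim disjE) simp_all
qed

subsection \<open>The orders of cubic nut graphs\<close>

lemma refuted_small:
  assumes "(a, b, c, d) \<in>
    {(0, 2, 3, 1), (4, 0, 2, 0), (0, 2, 3, 3), (4, 0, 2, 2), (0, 2, 3, 5), (4, 0, 2, 4), (0, 4, 6, 0), (0, 2, 3, 9),
     (4, 0, 2, 8), (4, 2, 5, 3), (0, 2, 3, 11), (4, 0, 2, 10), (4, 2, 5, 5), (0, 4, 6, 4), (8, 0, 4, 2), (4, 4, 8, 0),
     (8, 0, 4, 4), (0, 6, 9, 1), (0, 4, 6, 6)}"
  shows "refuted (types a b c d) []"
  using assms
  by (elim insertE emptyE)
    (simp_all only: prod.inject refuted_0_2_3_1 refuted_4_0_2_0 refuted_0_2_3_3 refuted_4_0_2_2 refuted_0_2_3_5 refuted_4_0_2_4 refuted_0_4_6_0 refuted_0_2_3_9 refuted_4_0_2_8 refuted_4_2_5_3 refuted_0_2_3_11 refuted_4_0_2_10 refuted_4_2_5_5 refuted_0_4_6_4 refuted_8_0_4_2 refuted_4_4_8_0 refuted_8_0_4_4 refuted_0_6_9_1 refuted_0_4_6_6)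

lemma cubic_nut_graph_order:
  assumes G: "simple_graph_on n G" "cubic_graph G" "nut_graph G" and n: "n > 0"
  shows "even n \<and> n \<ge> 12 \<and> n \<notin> {14, 16}"
proof -
  have nut: "nut_on {..<n} (nbhd G)" by (rule nut_graph_imp_nut_on[OF G(1) n G(3)])
  have cubic: "card (nbhd G v) = 3" if "v \<in> {..<n}" for v
    using G(2) that unfolding cubic_graph_iff[OF G(1)] by simp
  have ev: "even n" using even_order[OF nut cubic] by simp
  have False if small: "n < 12 \<or> n \<in> {14, 16}"
  proof -
    have n16: "card {..<n} \<le> 16" using small by auto
    obtain x where x: "kernel {..<n} (nbhd G) x" "\<And>v. v \<in> {..<n} \<Longrightarrow> x v \<noteq> 0"
      using nut_on_kernel[OF nut] by blast
    have "\<exists>v<n. x v \<noteq> 0" by (rule exI[of _ 0]) (use x(2)[of 0] n in simp)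
    then obtain y :: "nat \<Rightarrow> int" where y: "\<forall>v\<in>{..<n}. (\<Sum>u\<in>nbhd G v. y u) = 0" "\<exists>v\<in>{..<n}. y v \<noteq> 0"
      using integer_kernel[OF G(1) x(1)] by blast
    have sub: "\<forall>v\<in>{..<n}. nbhd G v \<subseteq> {..<n}" by (intro ballI simple_graph_nbhd(1)[OF G(1)])
    obtain z :: "nat \<Rightarrow> int" where z: "\<forall>v\<in>{..<n}. (\<Sum>u\<in>nbhd G v. z u) = 0" "\<exists>v\<in>{..<n}. odd (z v)"
      using primitive_kernel[OF finite_lessThan y(1) sub y(2)] by blast
    obtain k c where kc: "k > 0" "4 dvd c" "c \<le> 2 * k" "5 * k \<le> n + c"
      "\<not> refuted (types c (2 * k - c) (3 * k - c) (n + c - 5 * k)) []"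
      using not_refuted[OF nut cubic n16 z] unfolding card_lessThan by blast
    show False
      using kc(5) refuted_small[OF small_cases[OF ev n small kc(1-4)]] by blast
  qed
  then show ?thesis using ev by (meson not_le)
qed

theorem theorem1:
  fixes n :: nat
  assumes "n > 0"
  shows "(\<exists>G. simple_graph_on n G \<and> cubic_graph G \<and> nut_graph G)
    \<longleftrightarrow> even n \<and> n \<ge> 12 \<and> n \<notin> {14, 16}"
proof
  assume "\<exists>G. simple_graph_on n G \<and> cubic_graph G \<and> nut_graph G"
  then show "even n \<and> n \<ge> 12 \<and> n \<notin> {14, 16}"
    using cubic_nut_graph_order assms by blast
next
  assume "even n \<and> n \<ge> 12 \<and> n \<notin> {14, 16}"
  then show "\<exists>G. simple_graph_on n G \<and> cubic_graph G \<and> nut_graph G"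
    using cubic_nut_graph[OF cubic_nut_exists assms] by blast
qed

end
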